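(* Let $G=(V,E)$ be a locally finite, connected, infinite graph, and let $V_1\subset V_2\subset\dots\subset V$ be any exhaustion of $G$. Let $W\subset V$ be finite, and let $\xi$ be a minimal configuration on $W$. Then there exists a subset $\mathcal{E}$ of the set of edges of $G$ touching $W$ (i.e. having at least one endpoint in $W$) such that $$\lim_{n\to\infty}\nu_{V_n}[\eta:\eta_W=\xi]=\det\big(K_G(e,f)\big)_{e,f\in\mathcal{E}}.$$ The statement remains true if $\xi$ is only assumed to be a generalized minimal configuration on $W$.
   Context: Sandpiles on a finite graph with sink. Let $H=(U\cup\{s\},F)$ be a finite connected multigraph (multiple edges allowed, no loops) with distinguished vertex $s\notin U$, the sink. A sandpile on $H$ is a map $\eta:U\to\{0,1,2,\dots\}$. It is stable if $\eta(x)<\deg_H(x)$ for all $x\in U$ (degrees count multiplicity). A vertex $x\in U$ with $\eta(x)\ge\deg_H(x)$ can topple: it sends one particle along each edge incident with $x$; particles reaching $s$ are lost. Consider the Markov chain on stable sandpiles in which at each step a particle is added at a uniformly random vertex of $U$ and all possible topplings are carried out until a stable sandpile is reached (the result does not depend on the order of topplings). Let $\mathcal{R}_H$ be its set of recurrent states. The chain has a unique stationary distribution, denoted $\nu_H$, which is the uniform distribution on $\mathcal{R}_H$. $\eta_W$ denotes the restriction of $\eta$ to $W$, and $\delta_w$ the sandpile with a single particle at $w$ and no others. Exhaustions and wired graphs. Let $G=(V,E)$ be a locally finite, connected, infinite graph. An exhaustion of $G$ is a sequence of finite subsets $V_1\subset V_2\subset\dots\subset V$ with $\bigcup_n V_n=V$.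 For finite $V_1\subset V$, $G_{V_1}$ is the finite multigraph with vertex set $V_1\cup\{s\}$ obtained from $G$ by identifying all vertices of $V\setminus V_1$ to a single vertex $s$ (the sink) and removing loop-edges at $s$. Its edges are regarded as elements of $E$. Write $\nu_{V_1}:=\nu_{G_{V_1}}$. The limit is along those $n$ with $W\subset V_n$. Minimal configurations on finite graphs. Let $H=(U\cup\{s\},F)$ be a finite connected multigraph (multiple edges allowed, no loops) with sink $s\notin U$, let $\emptyset\ne W\subset U$ and let $\xi$ be a stable configuration on $W$, i.e. $\xi:W\to\{0,1,2,\dots\}$ with $\xi(w)<\deg_H(w)$ for $w \in W$. Then $\xi$ is generalized minimal in $H$ if there exists $\eta\in\mathcal{R}_H$ with $\eta_W=\xi$, and for any such $\eta$ and any $w\in W$ we have $\eta-\delta_w\notin\mathcal{R}_H$ (automatic at $w$ if $\eta(w)=0$). It is minimal in $H$ if, in addition, the graph $H\setminus W$ obtained by removing the vertices of $W$ is connected. Minimal configurations on the infinite graph $G$. Let $W\subset V$ be finite and let $\xi$ be a stable configuration on $W$. If all connected components of $G\setminus W$ are infinite, $\xi$ is called minimal if for some (and then for any) finite $V_1\supset W$ the configuration $\xi$ is minimal in the graph $G_{V_1}$. When $G\setminus W$ is allowed to have finite components, $\xi$ is called generalized minimal if it is generalized minimal in $G_{V_1}$ for some (and then for any) finite $V_1\supset W$ for which $G\setminus V_1$ has only infinite components. Transfer current matrix. Choose an orientation of each edge of $G$. In a finite connected multigraph $H$ with oriented edges, regarded as an electrical network with unit resistances, let $I^e_H(f)$ be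 the amount of current flowing through $f$ (signed with respect to the orientation of $f$) when unit current in total is made to flow from the tail of $e$ to the head of $e$. Equivalently, $I^e_H(f)=h(\text{tail of }f)-h(\text{head of }f)$, where $h$ is a real function on the vertices for which the net flow out of a vertex equals $1$ at the tail of $e$, $-1$ at the head of $e$, and $0$ elsewhere. Set $Y_H(e,f):=I^e_H(f)$. For the infinite graph $G$ and $e,f\in E$, set $Y_G(e,f):=\lim_{n\to\infty}Y_{G_{V_n}}(e,f)$ (the limit exists and is independent of the exhaustion) and $K_G(e,f):=\delta_G(e,f)-Y_G(e,f)$, where $\delta_G$ is the identity matrix indexed by $E$. The determinant does not depend on the chosen orientation. The determinant of the empty matrix is $1$. *)

theory Defs
  imports "HOL-Probability.Probability" "Graph_Theory.Digraph_Component"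
begin

section \<open>Multigraphs\<close>

text \<open>
  An undirected multigraph together with a chosen orientation of each of its edges is
  represented by a \<^typ>\<open>('v, 'e) pre_digraph\<close> with exactly one arc per undirected edge, so an
  antiparallel pair of arcs is a double edge. Only the transfer current matrix uses the
  orientation. In particular, undirected connectedness is the library's weak connectedness
  \<^const>\<open>Digraph_Component.connected\<close> (whose short name also denotes the topological notion).
\<close>

definition degree_of :: "('v, 'e) pre_digraph \<Rightarrow> 'v \<Rightarrow> nat" where
  "degree_of G v = in_degree G v + out_degree G v"

definition edge_mult :: "('v, 'e) pre_digraph \<Rightarrow> 'v \<Rightarrow> 'v \<Rightarrow> nat" where
  "edge_mult G u v = card {e \<in> arcs G. {tail G e, head G e} = {u, v}}"

definition locally_finite :: "('v, 'e) pre_digraph \<Rightarrow> bool" where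
  "locally_finite G \<longleftrightarrow> (\<forall>v \<in> verts G. finite (in_arcs G v) \<and> finite (out_arcs G v))"

definition remove_verts :: "('v, 'e) pre_digraph \<Rightarrow> 'v set \<Rightarrow> ('v, 'e) pre_digraph" where
  "remove_verts G W = G \<restriction> (verts G - W)"

definition component_of_vert :: "('v, 'e) pre_digraph \<Rightarrow> 'v \<Rightarrow> 'v set" where
  "component_of_vert G v = {u. v \<rightarrow>\<^sup>*\<^bsub>with_proj (mk_symmetric G)\<^esub> u}"

definition all_components_infinite :: "('v, 'e) pre_digraph \<Rightarrow> bool" where
  "all_components_infinite G \<longleftrightarrow> (\<forall>v \<in> verts G. infinite (component_of_vert G v))"

definition edges_touching :: "('v, 'e) pre_digraph \<Rightarrow> 'v set \<Rightarrow> 'e set" where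
  "edges_touching G W = {e \<in> arcs G. tail G e \<in> W \<or> head G e \<in> W}"


section \<open>Sandpiles on a finite multigraph with sink\<close>

text \<open>
  A multigraph on \<open>U \<union> {s}\<close> has vertex type \<^typ>\<open>'v option\<close>, where \<^term>\<open>None\<close> is the sink \<open>s\<close>.
  A sandpile on \<open>U\<close> is a function on \<^typ>\<open>'v\<close> that vanishes outside \<open>U\<close>, so that equality of
  such functions is equality of sandpiles.
\<close>

definition nonsink :: "('v option, 'e) pre_digraph \<Rightarrow> 'v set" where
  "nonsink H = {x. Some x \<in> verts H}"

definition stable_sandpiles :: "('v option, 'e) pre_digraph \<Rightarrow> ('v \<Rightarrow> nat) set" where
  "stable_sandpiles H =
     {\<eta>. (\<forall>x \<in> nonsink H. \<eta> x < degree_of H (Some x)) \<and> (\<forall>x. x \<notin> nonsink H \<longrightarrow> \<eta> x = 0)}"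

definition topple :: "('v option, 'e) pre_digraph \<Rightarrow> 'v \<Rightarrow> ('v \<Rightarrow> nat) \<Rightarrow> ('v \<Rightarrow> nat)" where
  "topple H x \<eta> =
     (\<lambda>y. if y = x then \<eta> x - degree_of H (Some x)
          else if y \<in> nonsink H then \<eta> y + edge_mult H (Some x) (Some y)
          else \<eta> y)"

definition legal_topple :: "('v option, 'e) pre_digraph \<Rightarrow> ('v \<Rightarrow> nat) \<Rightarrow> ('v \<Rightarrow> nat) \<Rightarrow> bool" where
  "legal_topple H \<eta> \<eta>' \<longleftrightarrow>
     (\<exists>x \<in> nonsink H. degree_of H (Some x) \<le> \<eta> x \<and> \<eta>' = topple H x \<eta>)"

definition stabilize :: "('v option, 'e) pre_digraph \<Rightarrow> ('v \<Rightarrow> nat) \<Rightarrow> ('v \<Rightarrow> nat)" where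
  "stabilize H \<eta> = (THE \<zeta>. (legal_topple H)\<^sup>*\<^sup>* \<eta> \<zeta> \<and> \<zeta> \<in> stable_sandpiles H)"

definition add_particle :: "('v option, 'e) pre_digraph \<Rightarrow> 'v \<Rightarrow> ('v \<Rightarrow> nat) \<Rightarrow> ('v \<Rightarrow> nat)" where
  "add_particle H x \<eta> = stabilize H (\<eta>(x := Suc (\<eta> x)))"

definition sandpile_kernel ::
    "('v option, 'e) pre_digraph \<Rightarrow> ('v \<Rightarrow> nat) \<Rightarrow> ('v \<Rightarrow> nat) pmf" where
  "sandpile_kernel H \<eta> = map_pmf (\<lambda>x. add_particle H x \<eta>) (pmf_of_set (nonsink H))"

text \<open>
  The chain started at \<open>\<eta>\<close> is driven by the i.i.d.\ uniform stream \<open>\<omega>\<close> of vertices at which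
  particles are added; a state is recurrent if the chain started there almost surely returns.
\<close>

definition sandpile_chain ::
    "('v option, 'e) pre_digraph \<Rightarrow> ('v \<Rightarrow> nat) \<Rightarrow> 'v stream \<Rightarrow> nat \<Rightarrow> ('v \<Rightarrow> nat)" where
  "sandpile_chain H \<eta> \<omega> n = fold (add_particle H) (stake n \<omega>) \<eta>"

definition recurrent :: "('v option, 'e) pre_digraph \<Rightarrow> ('v \<Rightarrow> nat) set" where
  "recurrent H = {\<eta> \<in> stable_sandpiles H.
     AE \<omega> in stream_space (measure_pmf (pmf_of_set (nonsink H))).
       \<exists>n>0. sandpile_chain H \<eta> \<omega> n = \<eta>}"

definition stationary :: "('v option, 'e) pre_digraph \<Rightarrow> ('v \<Rightarrow> nat) pmf \<Rightarrow> bool" where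
  "stationary H p \<longleftrightarrow>
     set_pmf p \<subseteq> stable_sandpiles H \<and> bind_pmf p (sandpile_kernel H) = p"

definition sandpile_measure :: "('v option, 'e) pre_digraph \<Rightarrow> ('v \<Rightarrow> nat) pmf" where
  "sandpile_measure H = (THE p. stationary H p)"


section \<open>Exhaustions and wired graphs\<close>

definition exhaustion :: "('v, 'e) pre_digraph \<Rightarrow> (nat \<Rightarrow> 'v set) \<Rightarrow> bool" where
  "exhaustion G Vs \<longleftrightarrow> incseq Vs \<and> (\<forall>n. finite (Vs n)) \<and> (\<Union>n. Vs n) = verts G"

definition wired :: "('v, 'e) pre_digraph \<Rightarrow> 'v set \<Rightarrow> ('v option, 'e) pre_digraph" where
  "wired G V1 =
     \<lparr> verts = insert None (Some ` V1),
       arcs = edges_touching G V1,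
       tail = (\<lambda>e. if tail G e \<in> V1 then Some (tail G e) else None),
       head = (\<lambda>e. if head G e \<in> V1 then Some (head G e) else None) \<rparr>"


section \<open>Minimal configurations\<close>

text \<open>
  Only the values of a configuration \<open>\<xi>\<close> on \<open>W\<close> are used. The guard \<open>0 < \<eta> w\<close> below is needed
  because subtraction on \<^typ>\<open>nat\<close> truncates.
\<close>

definition gen_minimal_in ::
    "('v option, 'e) pre_digraph \<Rightarrow> 'v set \<Rightarrow> ('v \<Rightarrow> nat) \<Rightarrow> bool" where
  "gen_minimal_in H W \<xi> \<longleftrightarrow>
     W \<noteq> {} \<and> W \<subseteq> nonsink H \<and> (\<forall>w \<in> W. \<xi> w < degree_of H (Some w)) \<and>
     (\<exists>\<eta> \<in> recurrent H. \<forall>w \<in> W. \<eta> w = \<xi> w) \<and>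
     (\<forall>\<eta> \<in> recurrent H. (\<forall>w \<in> W. \<eta> w = \<xi> w) \<longrightarrow>
        (\<forall>w \<in> W. 0 < \<eta> w \<longrightarrow> \<eta>(w := \<eta> w - 1) \<notin> recurrent H))"

definition minimal_in ::
    "('v option, 'e) pre_digraph \<Rightarrow> 'v set \<Rightarrow> ('v \<Rightarrow> nat) \<Rightarrow> bool" where
  "minimal_in H W \<xi> \<longleftrightarrow>
     gen_minimal_in H W \<xi> \<and> Digraph_Component.connected (remove_verts H (Some ` W))"

definition stable_on :: "('v, 'e) pre_digraph \<Rightarrow> 'v set \<Rightarrow> ('v \<Rightarrow> nat) \<Rightarrow> bool" where
  "stable_on G W \<xi> \<longleftrightarrow> (\<forall>w \<in> W. \<xi> w < degree_of G w)"

definition minimal_config :: "('v, 'e) pre_digraph \<Rightarrow> 'v set \<Rightarrow> ('v \<Rightarrow> nat) \<Rightarrow> bool" where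
  "minimal_config G W \<xi> \<longleftrightarrow>
     stable_on G W \<xi> \<and> all_components_infinite (remove_verts G W) \<and>
     (\<exists>V1. finite V1 \<and> W \<subseteq> V1 \<and> V1 \<subseteq> verts G \<and> minimal_in (wired G V1) W \<xi>)"

definition gen_minimal_config :: "('v, 'e) pre_digraph \<Rightarrow> 'v set \<Rightarrow> ('v \<Rightarrow> nat) \<Rightarrow> bool" where
  "gen_minimal_config G W \<xi> \<longleftrightarrow>
     stable_on G W \<xi> \<and>
     (\<exists>V1. finite V1 \<and> W \<subseteq> V1 \<and> V1 \<subseteq> verts G \<and>
        all_components_infinite (remove_verts G V1) \<and> gen_minimal_in (wired G V1) W \<xi>)"


section \<open>The transfer current matrix\<close>

definition net_outflow :: "('v, 'e) pre_digraph \<Rightarrow> ('v \<Rightarrow> real) \<Rightarrow> 'v \<Rightarrow> real" where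
  "net_outflow H h v =
     (\<Sum>f \<in> out_arcs H v. h (tail H f) - h (head H f))
     - (\<Sum>f \<in> in_arcs H v. h (tail H f) - h (head H f))"

definition unit_current_potential ::
    "('v, 'e) pre_digraph \<Rightarrow> 'e \<Rightarrow> ('v \<Rightarrow> real) \<Rightarrow> bool" where
  "unit_current_potential H e h \<longleftrightarrow>
     (\<forall>v \<in> verts H. net_outflow H h v = of_bool (v = tail H e) - of_bool (v = head H e))"

definition transfer_current :: "('v, 'e) pre_digraph \<Rightarrow> 'e \<Rightarrow> 'e \<Rightarrow> real" where
  "transfer_current H e f =
     (THE c. \<exists>h. unit_current_potential H e h \<and> c = h (tail H f) - h (head H f))"

definition transfer_current_inf :: "('v, 'e) pre_digraph \<Rightarrow> 'e \<Rightarrow> 'e \<Rightarrow> real" where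
  "transfer_current_inf G e f =
     (THE y. \<forall>Vs. exhaustion G Vs \<longrightarrow>
        (\<lambda>n. transfer_current (wired G (Vs n)) e f) \<longlonglongrightarrow> y)"

definition kernel_K :: "('v, 'e) pre_digraph \<Rightarrow> 'e \<Rightarrow> 'e \<Rightarrow> real" where
  "kernel_K G e f = of_bool (e = f) - transfer_current_inf G e f"

text \<open>The determinant of a matrix indexed by a finite set, as in \<^const>\<open>Determinants.det\<close>.\<close>

definition det_on :: "'e set \<Rightarrow> ('e \<Rightarrow> 'e \<Rightarrow> real) \<Rightarrow> real" where
  "det_on S M = (\<Sum>p | p permutes S. of_int (sign p) * (\<Prod>e \<in> S. M e (p e)))"

end

theory Submission
  imports Defs "Jordan_Normal_Form.Determinant" "HOL-Library.Confluence"
begin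

text \<open>
  Recurrent sandpiles satisfy a deletion-contraction recursion in the edges at the sink, so their
  number is the determinant of the reduced Laplacian. If \<open>\<xi>\<close> is generalized minimal on \<open>W\<close>, then in
  the burning algorithm the part of the graph joined to the sink off \<open>W\<close> burns before any vertex of
  \<open>W\<close>; then some \<open>w\<^sub>1 \<in> W\<close> burns, then all finite components of the complement adjacent to \<open>w\<^sub>1\<close>,
  then some \<open>w\<^sub>2\<close>, and so on. Hence the recurrent sandpiles extending \<open>\<xi>\<close> are counted by a product over
  these blocks, which is also the number of recurrent sandpiles of the graph in which each \<open>w\<^sub>i\<close>
  keeps, of its edges to earlier blocks, exactly one. The set \<open>\<E>\<close> of deleted edges touches \<open>W\<close>, does
  not depend on the exhaustion, and the ratio of the two Laplacian determinants is the determinant of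
  \<open>1 - Y\<close> over \<open>\<E>\<close>. By Dirichlet's principle the quadratic forms of the transfer currents of wired
  graphs increase along the exhaustion, so the entries converge.
\<close>

section \<open>Determinants over a finite index set\<close>

text \<open>Two obstacles shape the proof. The sandpile measure and recurrence are given
  probabilistically, so the burning criterion must be tied to both: adding a grain at a fixed vertex
  permutes the burnable configurations, and maximum principles on this finite set give almost sure
  return and uniqueness of the stationary law. Moreover, minimality refers to one wired graph, while
  \<E> must serve all of them. So everything except W and the finite components of its complement is
  merged into the sink, which preserves minimality; what remains is a finite core common to all
  large wired graphs, and the burning order is read off there. Why one edge is kept: the vertex
  \<open>w\<^sub>i\<close> has a prescribed height and contributes the factor 1 to the count, and a
  vertex hanging on the earlier blocks by a single edge has just one recurrent height. Keeping one
  edge thus reproduces the product block by block. Deleting edges subtracts a Gram matrix of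
  incidence vectors from the Laplacian, and a Schur complement turns the quotient of the
  determinants into one determinant over the deleted edges.\<close>

lemma det_on_cong:
  assumes "\<And>x y. x \<in> S \<Longrightarrow> y \<in> S \<Longrightarrow> M x y = N x y"
  shows "det_on S M = det_on S N"
  unfolding det_on_def
  by (intro sum.cong refl arg_cong2[where f = "(*)"] prod.cong)
     (use assms in \<open>auto simp: permutes_in_image\<close>)

text \<open>Carries the permutation sum over to an enumeration of \<open>S\<close>, which opens
  kernel vectors, inverses and block factorizations to matrices indexed by vertices or
  edges.\<close>

lemma det_on_eq_det:
  assumes f: "bij_betw f {0..<n} S"
  shows "det_on S M = Determinant.det (Matrix.mat n n (\<lambda>(i, j). M (f i) (f j)))"
proof -
  let ?g = "map_permutation {0..<n} f" and ?h = "map_permutation S (inv_into {0..<n} f)"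
  have inj: "inj_on f {0..<n}" and S: "S = f ` {0..<n}"
    using f by (auto simp: bij_betw_def)
  have f': "bij_betw (inv_into {0..<n} f) S {0..<n}"
    using f by (rule bij_betw_inv_into)
  have bij: "bij_betw ?g {p. p permutes {0..<n}} {p. p permutes S}"
  proof (rule bij_betwI[where g = ?h])
    show "?h (?g p) = p" if "p \<in> {p. p permutes {0..<n}}" for p
      using that f inj by (intro map_permutation_compose_inv[OF f]) (auto simp: bij_betw_inv_into_left)
    show "?g (?h p) = p" if "p \<in> {p. p permutes S}" for p
      using that f inj by (intro map_permutation_compose_inv[OF f']) (auto simp: bij_betw_inv_into_right)
  qed (use map_permutation_permutes[OF f] map_permutation_permutes[OF f'] in auto)
  have "det_on S M = (\<Sum>p | p permutes {0..<n}. of_int (sign (?g p)) * (\<Prod>e\<in>S. M e (?g p e)))"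
    unfolding det_on_def using bij by (rule sum.reindex_bij_betw[symmetric])
  also have "\<dots> = (\<Sum>p | p permutes {0..<n}. of_int (sign p) * (\<Prod>i = 0..<n. M (f i) (f (p i))))"
  proof (rule sum.cong[OF refl])
    fix p assume "p \<in> {p. p permutes {0..<n}}"
    then have p: "p permutes {0..<n}" by simp
    have "(\<Prod>e\<in>S. M e (?g p e)) = (\<Prod>i = 0..<n. M (f i) (f (p i)))"
      unfolding S using inj by (simp add: prod.reindex map_permutation_apply)
    then show "of_int (sign (?g p)) * (\<Prod>e\<in>S. M e (?g p e))
        = of_int (sign p) * (\<Prod>i = 0..<n. M (f i) (f (p i)))"
      using p inj by (simp add: sign_map_permutation)
  qed
  also have "\<dots> = Determinant.det (Matrix.mat n n (\<lambda>(i, j). M (f i) (f j)))"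
    by (subst Determinant.det_def'[of _ n])
       (auto intro!: sum.cong prod.cong simp: permutes_in_image)
  finally show ?thesis .
qed

lemma finite_bij_betw_nat:
  assumes "finite S"
  obtains f where "bij_betw f {0..<card S} S"
  using assms ex_bij_betw_nat_finite by blast

lemma det_on_empty [simp]: "det_on {} M = 1"
  by (simp add: det_on_def)

text \<open>Only permutations fixing \<open>x\<close> meet the changed entry, and these are the
  permutations of \<open>S - {x}\<close>. With \<open>N\<close> and \<open>M\<close> the Laplacians
  before and after removal of a sink edge at \<open>x\<close>, this is deletion-contraction for
  determinants.\<close>

lemma det_on_add_diag:
  assumes "finite S" "x \<in> S"
    and "\<And>y z. y \<in> S \<Longrightarrow> z \<in> S \<Longrightarrow> N y z = M y z + of_bool (y = x \<and> z = x)"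
  shows "det_on S N = det_on S M + det_on (S - {x}) M"
proof -
  let ?P = "{p. p permutes S}"
  have fin: "finite ?P" using assms by (simp add: finite_permutations)
  have prod_N: "(\<Prod>e\<in>S. N e (p e)) = (\<Prod>e\<in>S. M e (p e))
      + (if p x = x then (\<Prod>e\<in>S - {x}. M e (p e)) else 0)" if "p permutes S" for p
  proof -
    have rest: "(\<Prod>e\<in>S - {x}. N e (p e)) = (\<Prod>e\<in>S - {x}. M e (p e))"
      using assms that by (intro prod.cong) (auto simp: permutes_in_image)
    have "N x (p x) = M x (p x) + of_bool (p x = x)"
      using assms that by (simp add: permutes_in_image)
    then show ?thesis
      using assms rest by (simp add: prod.remove[of S x] algebra_simps)
  qed
  have "{p. p permutes S \<and> p x = x} = {p. p permutes (S - {x})}"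
    using assms(2) by (auto simp: permutes_def)

  then have "(\<Sum>p | p permutes S. of_int (sign p) * (if p x = x then (\<Prod>e\<in>S - {x}. M e (p e)) else 0))
      = det_on (S - {x}) M"
    unfolding det_on_def using fin
    by (simp add: sum.inter_filter[symmetric] if_distrib[of "(*) _"] cong: if_cong)
  then show ?thesis
    using prod_N by (simp add: det_on_def sum.distrib algebra_simps)
qed

lemma det_on_eq_0:
  assumes "finite S" "x \<in> S" "v x \<noteq> 0" "\<And>y. y \<in> S \<Longrightarrow> (\<Sum>z\<in>S. M y z * v z) = 0"
  shows "det_on S M = 0"
proof -
  obtain f where f: "bij_betw f {0..<card S} S"
    using assms(1) by (rule finite_bij_betw_nat)
  let ?n = "card S"
  let ?M = "Matrix.mat ?n ?n (\<lambda>(i, j). M (f i) (f j))" and ?v = "Matrix.vec ?n (\<lambda>i. v (f i))"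
  have "x \<in> f ` {0..<?n}" using f assms(2) by (simp add: bij_betw_def)
  then obtain i where i: "i < ?n" "f i = x" by auto
  have "?v $ i \<noteq> 0\<^sub>v ?n $ i"
    using i assms by simp
  then have "?v \<noteq> 0\<^sub>v ?n" by metis
  moreover have "?M *\<^sub>v ?v = 0\<^sub>v ?n"
  proof (rule eq_vecI)
    fix i assume i: "i < dim_vec (0\<^sub>v ?n)"
    then have "(?M *\<^sub>v ?v) $ i = (\<Sum>j = 0..<?n. M (f i) (f j) * v (f j))"
      by (simp add: scalar_prod_def)
    also have "\<dots> = (\<Sum>z\<in>S. M (f i) z * v z)"
      using f by (rule sum.reindex_bij_betw)
    also have "\<dots> = 0"
      using i f by (intro assms(4)) (auto simp: bij_betw_def)
    finally show "(?M *\<^sub>v ?v) $ i = 0\<^sub>v ?n $ i" using i by simp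
  qed simp
  ultimately have "Determinant.det ?M = 0"
    by (subst det_0_iff_vec_prod_zero[of _ ?n]) (auto intro!: exI[of _ ?v])
  then show ?thesis using f by (simp add: det_on_eq_det)
qed

lemma det_on_solvable:
  assumes "finite S" "det_on S M \<noteq> 0"
  obtains v where "\<And>y. y \<in> S \<Longrightarrow> (\<Sum>z\<in>S. M y z * v z) = b y"
proof -
  obtain f where f: "bij_betw f {0..<card S} S"
    using assms(1) by (rule finite_bij_betw_nat)
  let ?n = "card S"
  let ?M = "Matrix.mat ?n ?n (\<lambda>(i, j). M (f i) (f j))"
  have M: "?M \<in> carrier_mat ?n ?n" by simp
  have "Determinant.det ?M \<noteq> 0" using assms f by (simp add: det_on_eq_det)
  then obtain B where B: "B \<in> carrier_mat ?n ?n" "?M * B = 1\<^sub>m ?n"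
    using det_non_zero_imp_unit[OF M, of "()"] by (auto simp: Units_def ring_mat_def)
  let ?b = "Matrix.vec ?n (\<lambda>i. b (f i))"
  let ?w = "B *\<^sub>v ?b"
  have w: "?w \<in> carrier_vec ?n" using B by simp
  have Mw: "?M *\<^sub>v ?w = ?b"
    using B(2) assoc_mult_mat_vec[OF M B(1), of ?b] by (metis one_mult_mat_vec vec_carrier)
  define v where "v z = ?w $ inv_into {0..<?n} f z" for z
  have "(\<Sum>z\<in>S. M y z * v z) = b y" if "y \<in> S" for y
  proof -
    have "y \<in> f ` {0..<?n}" using f that by (simp add: bij_betw_def)
    then obtain i where i: "i < ?n" "f i = y" by auto
    have "(\<Sum>z\<in>S. M y z * v z) = (\<Sum>j = 0..<?n. M y (f j) * v (f j))"
      using f by (rule sum.reindex_bij_betw[symmetric])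
    also have "\<dots> = (\<Sum>j = 0..<?n. M (f i) (f j) * ?w $ j)"
      using f i by (intro sum.cong) (auto simp: v_def bij_betw_inv_into_left)
    also have "\<dots> = (?M *\<^sub>v ?w) $ i"
      using i w B by (simp add: scalar_prod_def del: assoc_mult_mat_vec)
    finally show ?thesis using i by (simp add: Mw)
  qed
  then show thesis by (rule that)
qed

text \<open>Both sides are the determinant of the block matrix with rows \<open>(D, B)\<close> and \<open>(B\<^sup>T, 1)\<close>.\<close>
lemma det_on_sub_gram:
  assumes "finite S" "finite T"
    and k: "\<And>e x. e \<in> T \<Longrightarrow> x \<in> S \<Longrightarrow> (\<Sum>y\<in>S. D x y * k e y) = b e x"
  shows "det_on S (\<lambda>x y. D x y - (\<Sum>e\<in>T. b e x * b e y))
    = det_on S D * det_on T (\<lambda>e f. of_bool (e = f) - (\<Sum>x\<in>S. b e x * k f x))"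
proof -
  obtain f where f: "bij_betw f {0..<card S} S"
    using assms(1) by (rule finite_bij_betw_nat)
  obtain g where g: "bij_betw g {0..<card T} T"
    using assms(2) by (rule finite_bij_betw_nat)
  let ?n = "card S" and ?m = "card T"
  define A where "A = Matrix.mat ?n ?n (\<lambda>(i, j). D (f i) (f j))"
  define B where "B = Matrix.mat ?n ?m (\<lambda>(i, j). b (g j) (f i))"
  define C where "C = Matrix.mat ?m ?n (\<lambda>(i, j). b (g i) (f j))"
  define X where "X = Matrix.mat ?n ?m (\<lambda>(i, j). k (g j) (f i))"
  have car: "A \<in> carrier_mat ?n ?n" "B \<in> carrier_mat ?n ?m" "C \<in> carrier_mat ?m ?n" "X \<in> carrier_mat ?n ?m"
    by (auto simp: A_def B_def C_def X_def)
  have gT: "g i \<in> T" if "i < ?m" for i using g that by (auto simp: bij_betw_def)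
  have fS: "f i \<in> S" if "i < ?n" for i using f that by (auto simp: bij_betw_def)
  have ginj: "g i = g j \<longleftrightarrow> i = j" if "i < ?m" "j < ?m" for i j
    using g that by (auto simp: bij_betw_def inj_on_def)
  have AX: "A * X = B"
  proof (rule eq_matI)
    fix i j assume ij: "i < dim_row B" "j < dim_col B"
    then have "(A * X) $$ (i, j) = (\<Sum>l = 0..<?n. D (f i) (f l) * k (g j) (f l))"
      by (simp add: A_def B_def X_def scalar_prod_def)
    also have "\<dots> = (\<Sum>y\<in>S. D (f i) y * k (g j) y)"
      using f by (rule sum.reindex_bij_betw)
    also have "\<dots> = B $$ (i, j)"
      using ij k gT fS by (simp add: B_def)
    finally show "(A * X) $$ (i, j) = B $$ (i, j)" .
  qed (auto simp: A_def B_def X_def)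
  have BC: "Matrix.mat ?n ?n (\<lambda>(i, j). D (f i) (f j) - (\<Sum>e\<in>T. b e (f i) * b e (f j))) = A - B * C"
    by (rule eq_matI)
       (auto simp: A_def B_def C_def scalar_prod_def sum.reindex_bij_betw[OF g, symmetric])
  have CX: "Matrix.mat ?m ?m (\<lambda>(i, j). of_bool (g i = g j) - (\<Sum>x\<in>S. b (g i) x * k (g j) x)) = 1\<^sub>m ?m - C * X"
    by (rule eq_matI)
       (auto simp: C_def X_def scalar_prod_def ginj sum.reindex_bij_betw[OF f, symmetric])
  have det_mult_blocks: "Determinant.det (four_block_mat A1 A2 A3 A4 * four_block_mat B1 B2 B3 B4)
      = Determinant.det (four_block_mat A1 A2 A3 A4) * Determinant.det (four_block_mat B1 B2 B3 B4)"
    if "A1 \<in> carrier_mat ?n ?n" "A4 \<in> carrier_mat ?m ?m" "B1 \<in> carrier_mat ?n ?n" "B4 \<in> carrier_mat ?m ?m"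
    for A1 A2 A3 A4 B1 B2 B3 B4 :: "real mat"
    using that by (intro det_mult[of _ "?n + ?m"] four_block_carrier_mat)
  have schur: "1\<^sub>m ?m - C * X \<in> carrier_mat ?m ?m" "A - B * C \<in> carrier_mat ?n ?n"
    using car by auto
  note upper_right_zero = det_four_block_mat_upper_right_zero[of _ ?n _ ?m]
    and lower_left_zero = det_four_block_mat_lower_left_zero[of _ ?n _ ?m]
  let ?K = "four_block_mat A B C (1\<^sub>m ?m)"
  \<comment> \<open>This factorization eliminates with \<open>X\<close>, which solves
    \<open>A * X = B\<close> by hypothesis, so no inverse of \<open>A\<close> enters. The next one
    eliminates with \<open>C\<close> and leaves \<open>A - B * C\<close>.\<close>
  have "?K = four_block_mat A (0\<^sub>m ?n ?m) C (1\<^sub>m ?m - C * X) * four_block_mat (1\<^sub>m ?n) X (0\<^sub>m ?m ?n) (1\<^sub>m ?m)"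
    using car by (subst mult_four_block_mat[of _ ?n ?n _ ?m _ ?m _ _ ?n _ ?m]) (auto simp: AX)
  then have "Determinant.det ?K = Determinant.det A * Determinant.det (1\<^sub>m ?m - C * X)"
    using car schur by (simp add: det_mult_blocks lower_left_zero upper_right_zero)
  moreover have "?K = four_block_mat (A - B * C) B (0\<^sub>m ?m ?n) (1\<^sub>m ?m) * four_block_mat (1\<^sub>m ?n) (0\<^sub>m ?n ?m) C (1\<^sub>m ?m)"
    using car by (subst mult_four_block_mat[of _ ?n ?n _ ?m _ ?m _ _ ?n _ ?m]) auto
  then have "Determinant.det ?K = Determinant.det (A - B * C)"
    using car schur by (simp add: det_mult_blocks lower_left_zero upper_right_zero)
  ultimately show ?thesis
    unfolding det_on_eq_det[OF f] det_on_eq_det[OF g] BC CX by (simp add: A_def)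
qed

section \<open>Recurrent configurations and the Laplacian\<close>

text \<open>Dhar's criterion, the absence of forbidden subconfigurations: \<open>F\<close> is the
  set of vertices not yet burnt, and \<open>x\<close> burns once its grains number at least its
  edges into \<open>F\<close>.\<close>

definition burnable :: "'v set \<Rightarrow> ('v \<Rightarrow> 'v \<Rightarrow> nat) \<Rightarrow> ('v \<Rightarrow> nat) \<Rightarrow> bool" where
  "burnable U a \<eta> \<longleftrightarrow> (\<forall>F\<subseteq>U. F \<noteq> {} \<longrightarrow> (\<exists>x\<in>F. sum (a x) F \<le> \<eta> x))"

definition stable_configs :: "'v set \<Rightarrow> ('v \<Rightarrow> nat) \<Rightarrow> ('v \<Rightarrow> nat) set" where
  "stable_configs U d = {\<eta>. (\<forall>x\<in>U. \<eta> x < d x) \<and> (\<forall>x. x \<notin> U \<longrightarrow> \<eta> x = 0)}"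

definition burnable_configs :: "'v set \<Rightarrow> ('v \<Rightarrow> 'v \<Rightarrow> nat) \<Rightarrow> ('v \<Rightarrow> nat) \<Rightarrow> ('v \<Rightarrow> nat) set" where
  "burnable_configs U a d = {\<eta> \<in> stable_configs U d. burnable U a \<eta>}"

text \<open>The degree \<open>d\<close> is a parameter separate from \<open>a\<close>:
  \<open>d x - sum (a x) U\<close> counts the edges from \<open>x\<close> to the sink. Deleting such
  an edge lowers \<open>d x\<close>; contracting it drops \<open>x\<close> from \<open>U\<close> and
  leaves \<open>d\<close> as it is.\<close>

definition lap :: "('v \<Rightarrow> 'v \<Rightarrow> nat) \<Rightarrow> ('v \<Rightarrow> nat) \<Rightarrow> 'v \<Rightarrow> 'v \<Rightarrow> real" where
  "lap a d x y = of_bool (x = y) * real (d x) - real (a x y)"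

lemma burnableD:
  assumes "burnable U a \<eta>" "F \<subseteq> U" "F \<noteq> {}"
  obtains x where "x \<in> F" "sum (a x) F \<le> \<eta> x"
  using assms unfolding burnable_def by blast

lemma burnable_subset: "burnable U a \<eta> \<Longrightarrow> V \<subseteq> U \<Longrightarrow> burnable V a \<eta>"
  unfolding burnable_def by blast

lemma burnable_cong:
  assumes "\<And>x. x \<in> U \<Longrightarrow> \<eta> x = \<zeta> x"
  shows "burnable U a \<eta> \<longleftrightarrow> burnable U a \<zeta>"
proof -
  have "(\<exists>x\<in>F. sum (a x) F \<le> \<eta> x) \<longleftrightarrow> (\<exists>x\<in>F. sum (a x) F \<le> \<zeta> x)" if "F \<subseteq> U" for F
    using assms that by (auto simp: subset_eq)
  then show ?thesis unfolding burnable_def by blast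
qed

text \<open>A vertex that can burn while all of \<open>U\<close> is unburnt can burn at any later
  stage, so only sets avoiding it remain to be tested.\<close>

lemma burnable_insert:
  assumes "finite U" "sum (a x) U \<le> \<eta> x" "burnable (U - {x}) a \<eta>"
  shows "burnable U a \<eta>"
  unfolding burnable_def
proof (intro allI impI)
  fix F assume F: "F \<subseteq> U" "F \<noteq> {}"
  show "\<exists>y\<in>F. sum (a y) F \<le> \<eta> y"
  proof (cases "x \<in> F")
    case True
    have "sum (a x) F \<le> sum (a x) U" using F assms(1) by (intro sum_mono2) auto
    then show ?thesis using True assms(2) by (intro bexI[of _ x]) auto
  next
    case False
    then have "F \<subseteq> U - {x}" using F by blast
    then show ?thesis using assms(3) F(2) by (meson burnableD)
  qed
qed

lemma finite_stable_configs:
  assumes "finite U"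
  shows "finite (stable_configs U d)"
proof (rule finite_subset)
  let ?B = "{..Max (d ` U)}"
  show "stable_configs U d \<subseteq> {\<eta>. \<forall>x. (x \<in> U \<longrightarrow> \<eta> x \<in> ?B) \<and> (x \<notin> U \<longrightarrow> \<eta> x = 0)}"
  proof safe
    fix \<eta> x assume \<eta>: "\<eta> \<in> stable_configs U d"
    show "\<eta> x \<le> Max (d ` U)" if "x \<in> U"
    proof -
      have "\<eta> x \<le> d x" using \<eta> that by (auto simp: stable_configs_def intro: less_imp_le)
      also have "d x \<le> Max (d ` U)" using assms that by simp
      finally show ?thesis .
    qed
    show "\<eta> x = 0" if "x \<notin> U" using \<eta> that by (simp add: stable_configs_def)
  qed
  show "finite {\<eta>. \<forall>x. (x \<in> U \<longrightarrow> \<eta> x \<in> ?B) \<and> (x \<notin> U \<longrightarrow> \<eta> x = 0)}"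
    using assms by (intro finite_set_of_finite_funs) auto
qed

lemma finite_burnable_configs: "finite U \<Longrightarrow> finite (burnable_configs U a d)"
  unfolding burnable_configs_def by (rule finite_subset[OF _ finite_stable_configs]) blast+

text \<open>The vertex \<open>x\<close> has an edge to the sink. Heights below
  \<open>d x - 1\<close> are the stable heights after deletion of this edge. At height
  \<open>d x - 1\<close> the vertex burns at once, so it may be merged into the sink, which is
  contraction.\<close>

lemma card_burnable_configs_split:
  assumes "finite U" "x \<in> U" and x: "sum (a x) U < d x"
  shows "card (burnable_configs U a d)
    = card (burnable_configs U a (d(x := d x - 1))) + card (burnable_configs (U - {x}) a d)"
proof -
  let ?R = "burnable_configs U a d"
  let ?A = "{\<eta> \<in> ?R. \<eta> x < d x - 1}" and ?B = "{\<eta> \<in> ?R. \<eta> x = d x - 1}"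
  have "\<eta> x < d x - 1 \<or> \<eta> x = d x - 1" if "\<eta> \<in> ?R" for \<eta>
    using that assms(2) by (force simp: burnable_configs_def stable_configs_def)
  then have "?R = ?A \<union> ?B" by blast
  then have "card ?R = card ?A + card ?B"
    using finite_burnable_configs[OF assms(1), of a d] by (subst card_Un_disjoint[symmetric]) auto
  moreover have "?A = burnable_configs U a (d(x := d x - 1))"
  proof -
    have "(\<forall>y\<in>U. \<eta> y < d y) \<and> \<eta> x < d x - 1 \<longleftrightarrow> (\<forall>y\<in>U. \<eta> y < (d(x := d x - 1)) y)" for \<eta>
      using assms(2) by (force split: if_splits)
    then show ?thesis unfolding burnable_configs_def stable_configs_def by blast
  qed
  moreover have "bij_betw (\<lambda>\<eta>. \<eta>(x := 0)) ?B (burnable_configs (U - {x}) a d)"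
  proof (rule bij_betwI[where g = "\<lambda>\<eta>. \<eta>(x := d x - 1)"])
    show "(\<lambda>\<eta>. \<eta>(x := 0)) \<in> ?B \<rightarrow> burnable_configs (U - {x}) a d"
    proof
      fix \<eta> assume \<eta>: "\<eta> \<in> ?B"
      then have "burnable (U - {x}) a \<eta>"
        by (auto simp: burnable_configs_def intro: burnable_subset)
      then have "burnable (U - {x}) a (\<eta>(x := 0))"
        by (subst burnable_cong[where \<zeta> = \<eta>]) auto
      then show "\<eta>(x := 0) \<in> burnable_configs (U - {x}) a d"
        using \<eta> by (auto simp: burnable_configs_def stable_configs_def)
    qed
    show "(\<lambda>\<eta>. \<eta>(x := d x - 1)) \<in> burnable_configs (U - {x}) a d \<rightarrow> ?B"
    proof
      fix \<eta> assume \<eta>: "\<eta> \<in> burnable_configs (U - {x}) a d"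
      then have "burnable (U - {x}) a (\<eta>(x := d x - 1))"
        by (subst burnable_cong[where \<zeta> = \<eta>]) (auto simp: burnable_configs_def)
      then have "burnable U a (\<eta>(x := d x - 1))"
        using assms by (intro burnable_insert[of U a x]) auto
      then show "\<eta>(x := d x - 1) \<in> ?B"
        using \<eta> assms by (auto simp: burnable_configs_def stable_configs_def)
    qed
  qed (use assms in \<open>auto simp: burnable_configs_def stable_configs_def fun_eq_iff\<close>)
  then have "card ?B = card (burnable_configs (U - {x}) a d)"
    by (rule bij_betw_same_card)
  ultimately show ?thesis by simp
qed

theorem card_burnable_configs:
  assumes "finite U" "\<And>x. x \<in> U \<Longrightarrow> sum (a x) U \<le> d x"
  shows "real (card (burnable_configs U a d)) = det_on U (lap a d)"
  using assms
\<comment> \<open>Deletion lowers \<open>d x\<close> by one and contraction removes \<open>x\<close>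
  from \<open>U\<close>, so both decrease this measure.\<close>
proof (induction "sum d U + card U" arbitrary: U d rule: less_induct)
  case less
  consider "U = {}" | x where "x \<in> U" "sum (a x) U < d x" | "U \<noteq> {}" "\<And>x. x \<in> U \<Longrightarrow> sum (a x) U = d x"
    using less.prems(2) by (metis ex_in_conv le_neq_implies_less)
  then show ?case
  proof cases
    case 1
    then have "burnable_configs U a d = {\<lambda>_. 0}"
      by (auto simp: burnable_configs_def stable_configs_def burnable_def)
    then show ?thesis using 1 by simp
  next
    case 2
    let ?d' = "d(x := d x - 1)"
    have "sum d U = d x + sum d (U - {x})"
      using less.prems(1) 2(1) by (rule sum.remove)
    moreover have "sum ?d' U = d x - 1 + sum d (U - {x})"
      by (subst sum.remove[OF less.prems(1) 2(1)]) (auto intro: sum.cong)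
    moreover have "card (U - {x}) < card U"
      using less.prems(1) 2(1) by (rule card_Diff1_less)
    ultimately have smaller: "sum ?d' U + card U < sum d U + card U"
      "sum d (U - {x}) + card (U - {x}) < sum d U + card U"
      using 2(2) by linarith+
    have "real (card (burnable_configs U a ?d')) = det_on U (lap a ?d')"
      using less.prems 2 by (intro less.hyps[OF smaller(1)]) auto
    moreover have "real (card (burnable_configs (U - {x}) a d)) = det_on (U - {x}) (lap a d)"
    proof (intro less.hyps[OF smaller(2)])
      show "sum (a y) (U - {x}) \<le> d y" if "y \<in> U - {x}" for y
      proof -
        have "sum (a y) (U - {x}) \<le> sum (a y) U" using less.prems(1) by (intro sum_mono2) auto
        also have "\<dots> \<le> d y" using less.prems(2) that by blast
        finally show ?thesis .
      qed
    qed (use less.prems in auto)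
    moreover have "det_on U (lap a d) = det_on U (lap a ?d') + det_on (U - {x}) (lap a ?d')"
      using less.prems 2 by (intro det_on_add_diag) (auto simp: lap_def of_bool_def)
    moreover have "det_on (U - {x}) (lap a ?d') = det_on (U - {x}) (lap a d)"
      by (rule det_on_cong) (auto simp: lap_def)
    ultimately show ?thesis
      using card_burnable_configs_split[where a = a and d = d, OF less.prems(1) 2] by simp
  next
    \<comment> \<open>No edge leads to the sink: the fire cannot start in \<open>U\<close>, and the
      constant vector lies in the kernel, so both sides are \<open>0\<close>.\<close>
    case 3
    then obtain x where x: "x \<in> U" by blast
    have False if "\<eta> \<in> burnable_configs U a d" for \<eta>
    proof -
      have \<eta>: "burnable U a \<eta>" "\<And>y. y \<in> U \<Longrightarrow> \<eta> y < d y"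
        using that by (auto simp: burnable_configs_def stable_configs_def)
      from \<eta>(1) order_refl 3(1) obtain y where "y \<in> U" "sum (a y) U \<le> \<eta> y"
        by (rule burnableD)
      then show False using \<eta>(2)[of y] 3(2)[of y] by simp
    qed
    then have "burnable_configs U a d = {}" by blast
    moreover have "det_on U (lap a d) = 0"
      using less.prems(1) x
    proof (rule det_on_eq_0[where v = "\<lambda>_. 1"])
      show "(\<Sum>z\<in>U. lap a d y z * 1) = 0" if "y \<in> U" for y
      proof -
        have "(\<Sum>z\<in>U. lap a d y z * 1) = (\<Sum>z\<in>U. of_bool (y = z) * real (d y)) - real (sum (a y) U)"
          by (simp add: lap_def sum_subtractf)
        also have "(\<Sum>z\<in>U. of_bool (y = z) * real (d y)) = real (d y)"
          using that less.prems(1) by (subst sum.remove[of _ y]) auto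
        finally show ?thesis using 3(2)[OF that] by simp
      qed
    qed simp
    ultimately show ?thesis by simp
  qed
qed

section \<open>Minimal configurations on multigraphs\<close>

text \<open>No vertex represents the sink. In \<open>rec E U\<close> below, everything outside
  \<open>U\<close> acts as the sink, so a single infinite edge set serves all finite
  \<open>U\<close> of an exhaustion, and merging vertices into the sink just means shrinking
  \<open>U\<close>.\<close>

locale loopless_multigraph =
  fixes ends :: "'e \<Rightarrow> 'v set" and E0 :: "'e set"
  assumes card_ends: "e \<in> E0 \<Longrightarrow> card (ends e) = 2"
    and finite_incident: "finite {e \<in> E0. x \<in> ends e}"
begin

text \<open>\<open>deg E UNIV x\<close> is the full degree.\<close>
definition deg :: "'e set \<Rightarrow> 'v set \<Rightarrow> 'v \<Rightarrow> nat" where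
  "deg E F x = card {e \<in> E. x \<in> ends e \<and> ends e \<subseteq> F}"

definition mult :: "'e set \<Rightarrow> 'v \<Rightarrow> 'v \<Rightarrow> nat" where
  "mult E x y = card {e \<in> E. ends e = {x, y}}"

definition burns :: "'e set \<Rightarrow> 'v set \<Rightarrow> ('v \<Rightarrow> nat) \<Rightarrow> bool" where
  "burns E U \<eta> \<longleftrightarrow> (\<forall>F\<subseteq>U. F \<noteq> {} \<longrightarrow> (\<exists>x\<in>F. deg E F x \<le> \<eta> x))"

definition rec :: "'e set \<Rightarrow> 'v set \<Rightarrow> ('v \<Rightarrow> nat) set" where
  "rec E U = {\<eta>. (\<forall>x\<in>U. \<eta> x < deg E UNIV x) \<and> (\<forall>x. x \<notin> U \<longrightarrow> \<eta> x = 0) \<and> burns E U \<eta>}"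

definition rec_on :: "'e set \<Rightarrow> 'v set \<Rightarrow> 'v set \<Rightarrow> ('v \<Rightarrow> nat) \<Rightarrow> ('v \<Rightarrow> nat) set" where
  "rec_on E U W \<xi> = {\<eta> \<in> rec E U. \<forall>w\<in>W. \<eta> w = \<xi> w}"

definition gen_minimal :: "'e set \<Rightarrow> 'v set \<Rightarrow> 'v set \<Rightarrow> ('v \<Rightarrow> nat) \<Rightarrow> bool" where
  "gen_minimal E U W \<xi> \<longleftrightarrow> rec_on E U W \<xi> \<noteq> {} \<and>
     (\<forall>\<eta>\<in>rec_on E U W \<xi>. \<forall>w\<in>W. 0 < \<eta> w \<longrightarrow> \<eta>(w := \<eta> w - 1) \<notin> rec E U)"

text \<open>For \<open>C \<subseteq> U\<close> this says that each vertex of \<open>C\<close> is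
  joined to the sink by a path through \<open>C\<close>: an edge not inside
  \<open>F \<union> (U - C)\<close> leads from \<open>F\<close> either out of \<open>U\<close> or
  into \<open>C - F\<close>.\<close>

definition attached :: "'e set \<Rightarrow> 'v set \<Rightarrow> 'v set \<Rightarrow> bool" where
  "attached E U C \<longleftrightarrow> (\<forall>F\<subseteq>C. F \<noteq> {} \<longrightarrow> (\<exists>x\<in>F. \<exists>e\<in>E. x \<in> ends e \<and> \<not> ends e \<subseteq> F \<union> (U - C)))"

lemma finite_incident': "E \<subseteq> E0 \<Longrightarrow> finite {e \<in> E. x \<in> ends e \<and> P e}"
  by (rule finite_subset[OF _ finite_incident[of x]]) auto

lemma ends_eqI:
  assumes "e \<in> E0" "x \<in> ends e" "y \<in> ends e" "x \<noteq> y"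
  shows "ends e = {x, y}"
proof -
  obtain u v where "ends e = {u, v}"
    using card_ends[OF assms(1)] by (meson card_2_iff)
  then show ?thesis using assms by auto
qed

lemma ends_other:
  assumes "e \<in> E0" "x \<in> ends e"
  obtains y where "y \<noteq> x" "ends e = {x, y}"
proof -
  obtain u v where "ends e = {u, v}" "u \<noteq> v"
    using card_ends[OF assms(1)] by (meson card_2_iff)
  then show thesis using assms(2) that[of u] that[of v] by (auto simp: insert_commute)
qed

lemma deg_mono: "E \<subseteq> E0 \<Longrightarrow> F \<subseteq> F' \<Longrightarrow> deg E F x \<le> deg E F' x"
  unfolding deg_def by (intro card_mono finite_incident') auto

lemma deg_less:
  assumes "E \<subseteq> E0" "F \<subseteq> F'" "e \<in> E" "x \<in> ends e" "ends e \<subseteq> F'" "\<not> ends e \<subseteq> F"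
  shows "deg E F x < deg E F' x"
  unfolding deg_def using assms by (intro psubset_card_mono finite_incident') auto

lemma deg_cong:
  assumes "\<And>e. x \<in> ends e \<Longrightarrow> e \<in> E \<and> ends e \<subseteq> F \<longleftrightarrow> e \<in> E' \<and> ends e \<subseteq> F'"
  shows "deg E F x = deg E' F' x"
  unfolding deg_def using assms by (intro arg_cong[where f = card]) auto

lemma sum_mult:
  assumes "E \<subseteq> E0" "finite F" "x \<in> F"
  shows "sum (mult E x) F = deg E F x"
proof -
  have "{e \<in> E. x \<in> ends e \<and> ends e \<subseteq> F} = (\<Union>y\<in>F. {e \<in> E. ends e = {x, y}})" (is "?L = ?R")
  proof
    show "?L \<subseteq> ?R"
    proof
      fix e assume e: "e \<in> ?L"
      then have "e \<in> E0" using assms by auto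
      then obtain y where "ends e = {x, y}" using e by (auto elim: ends_other)
      then show "e \<in> ?R" using e by auto
    qed
  qed (use assms in auto)
  moreover have "finite {e \<in> E. ends e = {x, y}}" for y
    by (rule finite_subset[OF _ finite_incident'[OF assms(1), of x "\<lambda>_. True"]]) auto
  ultimately show ?thesis
    unfolding deg_def mult_def using assms(2)
    by (simp add: card_UN_disjoint doubleton_eq_iff disjoint_iff)
qed

lemma rec_eq_burnable_configs:
  assumes "E \<subseteq> E0" "finite U"
  shows "rec E U = burnable_configs U (mult E) (deg E UNIV)"
proof -
  have "burns E U \<eta> \<longleftrightarrow> burnable U (mult E) \<eta>" for \<eta>
  proof -
    have "(\<exists>x\<in>F. deg E F x \<le> \<eta> x) \<longleftrightarrow> (\<exists>x\<in>F. sum (mult E x) F \<le> \<eta> x)" if "F \<subseteq> U" for F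
      using sum_mult[OF assms(1) finite_subset[OF that assms(2)]] by auto
    then show ?thesis unfolding burns_def burnable_def by blast
  qed
  then show ?thesis
    unfolding rec_def burnable_configs_def stable_configs_def by blast
qed

lemma burnsD: "burns E U \<eta> \<Longrightarrow> F \<subseteq> U \<Longrightarrow> F \<noteq> {} \<Longrightarrow> \<exists>x\<in>F. deg E F x \<le> \<eta> x"
  by (simp add: burns_def)

lemma burns_subset: "burns E U \<eta> \<Longrightarrow> V \<subseteq> U \<Longrightarrow> burns E V \<eta>"
  unfolding burns_def by blast

lemma burns_cong:
  assumes "\<And>x. x \<in> U \<Longrightarrow> \<eta> x = \<zeta> x" "\<And>e. ends e \<inter> U \<noteq> {} \<Longrightarrow> e \<in> E \<longleftrightarrow> e \<in> E'"
  shows "burns E U \<eta> \<longleftrightarrow> burns E' U \<zeta>"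
proof -
  have "(\<exists>x\<in>F. deg E F x \<le> \<eta> x) \<longleftrightarrow> (\<exists>x\<in>F. deg E' F x \<le> \<zeta> x)" if F: "F \<subseteq> U" for F
  proof (rule bex_cong[OF refl])
    fix x assume x: "x \<in> F"
    have "deg E F x = deg E' F x"
      using x F by (intro deg_cong) (use assms(2) in blast)
    then show "deg E F x \<le> \<eta> x \<longleftrightarrow> deg E' F x \<le> \<zeta> x"
      using assms(1) x F by auto
  qed
  then show ?thesis unfolding burns_def by blast
qed

lemma rec_cong:
  assumes "\<And>e. ends e \<inter> U \<noteq> {} \<Longrightarrow> e \<in> E \<longleftrightarrow> e \<in> E'"
  shows "rec E U = rec E' U"
proof -
  have "deg E UNIV x = deg E' UNIV x" if "x \<in> U" for x
    using that by (intro deg_cong) (use assms in blast)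
  moreover have "burns E U \<eta> \<longleftrightarrow> burns E' U \<eta>" for \<eta>
    using assms by (intro burns_cong) auto
  ultimately show ?thesis unfolding rec_def by auto
qed

section \<open>Restricting and extending recurrent configurations, and the order of burning\<close>

definition restr :: "'v set \<Rightarrow> ('v \<Rightarrow> nat) \<Rightarrow> 'v \<Rightarrow> nat" where
  "restr V \<eta> x = (if x \<in> V then \<eta> x else 0)"

lemma restr_rec:
  assumes "\<eta> \<in> rec E U" "V \<subseteq> U"
  shows "restr V \<eta> \<in> rec E V"
proof -
  have "burns E V \<eta>" using assms by (auto simp: rec_def intro: burns_subset)
  then have "burns E V (restr V \<eta>)" by (subst burns_cong[where \<zeta> = \<eta>]) (auto simp: restr_def)
  then show ?thesis using assms by (auto simp: rec_def restr_def)
qed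

lemma attachedE:
  assumes "attached E U C" "F \<subseteq> C" "F \<noteq> {}"
  obtains x e where "x \<in> F" "e \<in> E" "x \<in> ends e" "\<not> ends e \<subseteq> F \<union> (U - C)"
proof -
  have "\<exists>x\<in>F. \<exists>e\<in>E. x \<in> ends e \<and> \<not> ends e \<subseteq> F \<union> (U - C)"
    using assms unfolding attached_def by simp
  then show thesis using that by (elim bexE conjE)
qed

text \<open>At maximal height a vertex burns as soon as one of its edges leads to a burnt vertex.
  Attachment therefore makes all of \<open>C\<close> burn while \<open>U - C\<close> is still
  unburnt, after which \<open>C\<close> acts as part of the sink.\<close>

lemma extend_max_rec:
  assumes E: "E \<subseteq> E0" and "C \<subseteq> U" and att: "attached E U C" and \<zeta>: "\<zeta> \<in> rec E (U - C)"
  shows "(\<lambda>x. if x \<in> C then deg E UNIV x - 1 else \<zeta> x) \<in> rec E U" (is "?\<eta> \<in> _")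
proof -
  have key: "\<exists>x\<in>F. deg E (F \<union> (U - C)) x < deg E UNIV x" if "F \<subseteq> C" "F \<noteq> {}" for F
  proof -
    obtain x e where x: "x \<in> F" and "e \<in> E" "x \<in> ends e" "\<not> ends e \<subseteq> F \<union> (U - C)"
      using att \<open>F \<subseteq> C\<close> \<open>F \<noteq> {}\<close> by (rule attachedE)
    then have "deg E (F \<union> (U - C)) x < deg E UNIV x"
      using E by (intro deg_less[of _ _ _ e]) auto
    then show ?thesis using x by blast
  qed
  have "burns E U ?\<eta>"
    unfolding burns_def
  proof (intro allI impI)
    fix F assume F: "F \<subseteq> U" "F \<noteq> {}"
    show "\<exists>x\<in>F. deg E F x \<le> ?\<eta> x"
    proof (cases "F \<inter> C = {}")
      case True
      then have "F \<subseteq> U - C" using F by blast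
      have "burns E (U - C) ?\<eta>"
        using \<zeta> by (subst burns_cong[where \<zeta> = \<zeta>]) (auto simp: rec_def)
      then show ?thesis using \<open>F \<subseteq> U - C\<close> F(2) by (rule burnsD)
    next
      case False
      then obtain x where x: "x \<in> F \<inter> C" "deg E (F \<inter> C \<union> (U - C)) x < deg E UNIV x"
        using key[of "F \<inter> C"] by blast
      moreover have "deg E F x \<le> deg E (F \<inter> C \<union> (U - C)) x"
        using E F by (intro deg_mono) auto
      ultimately show ?thesis by (intro bexI[of _ x]) auto
    qed
  qed
  moreover have "0 < deg E UNIV x" if "x \<in> C" for x
    using key[of "{x}"] that by auto
  ultimately show ?thesis using \<zeta> \<open>C \<subseteq> U\<close> by (auto simp: rec_def)
qed

text \<open>If a grain could be taken from \<open>W\<close> in \<open>U - C\<close>, filling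
  \<open>C\<close> up to maximal height would produce a configuration on \<open>U\<close> from which
  the same grain could be taken.\<close>

lemma gen_minimal_diff:
  assumes E: "E \<subseteq> E0" and C: "C \<subseteq> U" "W \<subseteq> U - C" and att: "attached E U C"
    and gm: "gen_minimal E U W \<xi>"
  shows "gen_minimal E (U - C) W \<xi>"
proof -
  obtain \<eta> where "\<eta> \<in> rec_on E U W \<xi>" using gm by (auto simp: gen_minimal_def)
  then have "restr (U - C) \<eta> \<in> rec_on E (U - C) W \<xi>"
    using C(2) by (auto simp: rec_on_def restr_def subset_iff intro!: restr_rec)
  moreover have False
    if \<zeta>: "\<zeta> \<in> rec_on E (U - C) W \<xi>" "w \<in> W" "0 < \<zeta> w" "\<zeta>(w := \<zeta> w - 1) \<in> rec E (U - C)" for \<zeta> w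
  proof -
    define ext where "ext \<zeta> = (\<lambda>x. if x \<in> C then deg E UNIV x - 1 else \<zeta> x)" for \<zeta> :: "'v \<Rightarrow> nat"
    have w: "w \<notin> C" using C \<zeta> by blast
    have "ext \<zeta> \<in> rec_on E U W \<xi>"
      using \<zeta>(1) C extend_max_rec[OF E C(1) att] by (auto simp: rec_on_def ext_def)
    moreover have "(ext \<zeta>)(w := ext \<zeta> w - 1) = ext (\<zeta>(w := \<zeta> w - 1))"
      using w by (auto simp: ext_def fun_eq_iff)
    moreover have "ext (\<zeta>(w := \<zeta> w - 1)) \<in> rec E U"
      unfolding ext_def by (rule extend_max_rec[OF E C(1) att \<zeta>(4)])
    moreover have "0 < ext \<zeta> w" using w \<zeta> by (simp add: ext_def)
    ultimately show False using gm \<zeta>(2) unfolding gen_minimal_def by metis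
  qed
  ultimately show ?thesis unfolding gen_minimal_def by blast
qed

text \<open>
  The part \<open>D\<close> of \<open>U - C\<close> still unburnt while \<open>F\<close> is stuck: if a vertex of \<open>D\<close> with a
  neighbour in \<open>F\<close> could burn, it could do so with one particle less after \<open>C\<close> has burnt,
  contradicting minimality; so \<open>D\<close> burns without ever helping \<open>F\<close>.
\<close>
lemma gen_minimal_burns_first:
  assumes E: "E \<subseteq> E0" and fin: "finite U" and C: "C \<subseteq> U" "W \<subseteq> U - C"
    and sep: "\<And>e. e \<in> E \<Longrightarrow> ends e \<inter> C \<noteq> {} \<Longrightarrow> ends e \<inter> (U - C - W) = {}"
    and gm: "gen_minimal E (U - C) W \<xi>" and \<eta>: "\<eta> \<in> rec_on E U W \<xi>" and F: "F \<subseteq> C" "F \<noteq> {}"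
  shows "\<exists>x\<in>F. deg E (F \<union> (U - C)) x \<le> \<eta> x"
proof (rule ccontr)
  assume "\<not> (\<exists>x\<in>F. deg E (F \<union> (U - C)) x \<le> \<eta> x)"
  then have stuck0: "\<eta> x < deg E (F \<union> (U - C)) x" if "x \<in> F" for x
    using that by (meson not_le)
  have burns: "burns E U \<eta>" using \<eta> by (simp add: rec_on_def rec_def)
  \<comment> \<open>The last premise states, without naming a burning order, that the vertices of
    \<open>U - C\<close> off \<open>D\<close> burn once \<open>C\<close> is burnt, even while
    \<open>D\<close> is kept unburnt.\<close>
  have False
    if "finite D" "D \<subseteq> U - C" "\<And>x. x \<in> F \<Longrightarrow> \<eta> x < deg E (F \<union> D) x"
      "\<And>X. X \<subseteq> U - C \<Longrightarrow> \<not> X \<subseteq> D \<Longrightarrow> \<exists>y\<in>X - D. deg E (X \<union> D) y \<le> \<eta> y" for D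
    using that
  proof (induction "card D" arbitrary: D rule: less_induct)
    case less
    note stuck = less.prems(3) and burnt = less.prems(4)
    have "F \<union> D \<subseteq> U" "F \<union> D \<noteq> {}" using F C less.prems(2) by auto
    then obtain x where x: "x \<in> F \<union> D" "deg E (F \<union> D) x \<le> \<eta> x"
      using burnsD[OF burns] by blast
    then have xF: "x \<notin> F" using stuck[of x] by auto
    then have xD: "x \<in> D" using x by blast
    show False
    proof (cases "\<exists>e\<in>E. x \<in> ends e \<and> ends e \<inter> F \<noteq> {}")
      case True
      then obtain e z where e: "e \<in> E" "x \<in> ends e" "z \<in> ends e" "z \<in> F" by blast
      have xz: "x \<noteq> z" using xF e by blast
      have ends_e: "ends e = {x, z}" using E e xz by (intro ends_eqI) auto
      have zC: "z \<in> C" using e F by blast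
      have "ends e \<inter> C \<noteq> {}" using e(3) zC by blast
      then have "x \<in> W" using sep[OF e(1)] e(2) xD less.prems(2) by blast
      have "z \<notin> D" using zC less.prems(2) by blast
      \<comment> \<open>The edge from \<open>x\<close> to the unburnt \<open>F\<close> shows that
        \<open>x\<close> burns with a grain to spare once \<open>F\<close> is gone. Since
        \<open>x \<in> W\<close>, removing that grain contradicts minimality.\<close>
      have "deg E D x < deg E (F \<union> D) x"
        using E e ends_e xD \<open>z \<notin> D\<close> by (intro deg_less[of _ _ _ e]) auto
      then have lt: "deg E D x < \<eta> x" using x(2) by simp
      let ?\<zeta> = "restr (U - C) \<eta>"
      have \<zeta>x: "?\<zeta> x = \<eta> x" using xD less.prems(2) by (auto simp: restr_def)
      have \<zeta>: "?\<zeta> \<in> rec_on E (U - C) W \<xi>"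
        using \<eta> C by (auto simp: rec_on_def restr_def intro!: restr_rec)
      have "burns E (U - C) (?\<zeta>(x := ?\<zeta> x - 1))"
        unfolding burns_def
      proof (intro allI impI)
        fix X assume X: "X \<subseteq> U - C" "X \<noteq> {}"
        show "\<exists>y\<in>X. deg E X y \<le> (?\<zeta>(x := ?\<zeta> x - 1)) y"
        proof (cases "X \<subseteq> D")
          case XD: True
          show ?thesis
          proof (cases "x \<in> X")
            case True
            have "deg E X x \<le> deg E D x" using E XD by (rule deg_mono)
            then show ?thesis using True lt \<zeta>x by (intro bexI[of _ x]) auto
          next
            case False
            have "X \<subseteq> U" using X C by blast
            then obtain y where y: "y \<in> X" "deg E X y \<le> \<eta> y"
              using burnsD[OF burns _ X(2)] by blast
            moreover have "?\<zeta> y = \<eta> y" using y X by (auto simp: restr_def)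
            ultimately show ?thesis using False by (intro bexI[of _ y]) auto
          qed
        next
          case False
          then obtain y where y: "y \<in> X - D" "deg E (X \<union> D) y \<le> \<eta> y"
            using burnt[OF X(1)] by blast
          have "deg E X y \<le> deg E (X \<union> D) y" using E by (intro deg_mono) auto
          moreover have "?\<zeta> y = \<eta> y" using y X by (auto simp: restr_def)
          moreover have "y \<noteq> x" using y xD by blast
          ultimately show ?thesis using y by (intro bexI[of _ y]) auto
        qed
      qed
      then have "?\<zeta>(x := ?\<zeta> x - 1) \<in> rec E (U - C)"
        using \<zeta> xD less.prems(2) by (auto simp: rec_on_def rec_def less_imp_diff_less)
      moreover have "0 < ?\<zeta> x" using lt \<zeta>x by simp
      ultimately show False using gm \<zeta> \<open>x \<in> W\<close> unfolding gen_minimal_def by blast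
    next
      case False
      show False
      proof (rule less.hyps)
        show "card (D - {x}) < card D" using less.prems(1) xD by (rule card_Diff1_less)
        show "finite (D - {x})" using less.prems(1) by simp
        show "D - {x} \<subseteq> U - C" using less.prems(2) by blast
        fix y assume y: "y \<in> F"
        have "deg E (F \<union> (D - {x})) y = deg E (F \<union> D) y"
        proof (rule deg_cong)
          fix e assume e: "y \<in> ends e"
          have "x \<notin> ends e" if "e \<in> E" using False that e y by blast
          then show "e \<in> E \<and> ends e \<subseteq> F \<union> (D - {x}) \<longleftrightarrow> e \<in> E \<and> ends e \<subseteq> F \<union> D" by blast
        qed
        then show "\<eta> y < deg E (F \<union> (D - {x})) y" using stuck[OF y] by simp
      next
        fix X assume X: "X \<subseteq> U - C" "\<not> X \<subseteq> D - {x}"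
        show "\<exists>y\<in>X - (D - {x}). deg E (X \<union> (D - {x})) y \<le> \<eta> y"
        proof (cases "X \<subseteq> D")
          case True
          then have "x \<in> X" using X(2) by blast
          moreover have "deg E (X \<union> (D - {x})) x \<le> deg E (F \<union> D) x"
            using E True by (intro deg_mono) auto
          ultimately show ?thesis using x(2) by (intro bexI[of _ x]) auto
        next
          case False
          then obtain y where y: "y \<in> X - D" "deg E (X \<union> D) y \<le> \<eta> y"
            using burnt[OF X(1)] by blast
          moreover have "deg E (X \<union> (D - {x})) y \<le> deg E (X \<union> D) y"
            using E by (intro deg_mono) auto
          ultimately show ?thesis by (intro bexI[of _ y]) auto
        qed
      qed
    qed
  qed
  from this[of "U - C"] show False using stuck0 fin by blast
qed

text \<open>As \<open>C\<close> burns while all of \<open>U - C\<close> is unburnt, each of its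
  edges into \<open>U - C\<close> costs one extra grain. Subtracting these costs \<open>m x\<close>
  amounts to deleting those edges; on \<open>U - C\<close> the burnt \<open>C\<close> is part of the
  sink, and the two parts are independent.\<close>

lemma card_rec_on_factor:
  assumes E: "E \<subseteq> E0" and fin: "finite U" and C: "C \<subseteq> U" "W \<subseteq> U - C"
    and sep: "\<And>e. e \<in> E \<Longrightarrow> ends e \<inter> C \<noteq> {} \<Longrightarrow> ends e \<inter> (U - C - W) = {}"
    and gm: "gen_minimal E (U - C) W \<xi>"
  shows "card (rec_on E U W \<xi>)
    = card (rec {e \<in> E. ends e \<inter> (U - C) = {}} C) * card (rec_on E (U - C) W \<xi>)"
proof -
  let ?E = "{e \<in> E. ends e \<inter> (U - C) = {}}"
  define m where "m x = card {e \<in> E. x \<in> ends e \<and> ends e \<inter> (U - C) \<noteq> {}}" for x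
  have split: "deg E F' x = deg ?E F x + m x"
    if "\<And>e. e \<in> E \<Longrightarrow> x \<in> ends e \<Longrightarrow> ends e \<subseteq> F' \<longleftrightarrow> ends e \<subseteq> F \<or> ends e \<inter> (U - C) \<noteq> {}" for F F' x
  proof -
    have "{e \<in> E. x \<in> ends e \<and> ends e \<subseteq> F'} = {e \<in> ?E. x \<in> ends e \<and> ends e \<subseteq> F}
        \<union> {e \<in> E. x \<in> ends e \<and> ends e \<inter> (U - C) \<noteq> {}}"
      using that by blast
    moreover have "finite {e \<in> ?E. x \<in> ends e \<and> ends e \<subseteq> F}"
      by (rule finite_subset[OF _ finite_incident'[OF E, of x "\<lambda>_. True"]]) auto
    ultimately show ?thesis
      unfolding deg_def m_def using finite_incident'[OF E]
      by (subst card_Un_disjoint[symmetric]) auto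
  qed
  have deg_full: "deg E UNIV x = deg ?E UNIV x + m x" for x
    by (rule split) blast
  have deg_part: "deg E (F \<union> (U - C)) x = deg ?E F x + m x" if "x \<in> F" "F \<subseteq> C" for F x
  proof (rule split)
    fix e assume e: "e \<in> E" "x \<in> ends e"
    have "ends e \<subseteq> F \<union> (U - C)" if "y \<in> ends e" "y \<in> U - C" for y
    proof -
      have "ends e = {x, y}" using e E that \<open>x \<in> F\<close> \<open>F \<subseteq> C\<close> by (intro ends_eqI) auto
      then show ?thesis using that(2) \<open>x \<in> F\<close> by simp
    qed
    then show "ends e \<subseteq> F \<union> (U - C) \<longleftrightarrow> ends e \<subseteq> F \<or> ends e \<inter> (U - C) \<noteq> {}" by blast
  qed
  have first: "\<exists>x\<in>F. deg ?E F x + m x \<le> \<eta> x"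
    if "\<eta> \<in> rec_on E U W \<xi>" "F \<subseteq> C" "F \<noteq> {}" for \<eta> F
    using gen_minimal_burns_first[OF E fin C sep gm that] deg_part that(2) by auto
  define split_conf where "split_conf \<eta> = (restr C (\<lambda>x. \<eta> x - m x), restr (U - C) \<eta>)" for \<eta>
  define join where "join = (\<lambda>(\<alpha>, \<zeta>) x. if x \<in> C then \<alpha> x + m x else \<zeta> x :: nat)"
  have "bij_betw split_conf (rec_on E U W \<xi>) (rec ?E C \<times> rec_on E (U - C) W \<xi>)"
  proof (rule bij_betwI[where g = join])
    show "split_conf \<in> rec_on E U W \<xi> \<rightarrow> rec ?E C \<times> rec_on E (U - C) W \<xi>"
    proof
      fix \<eta> assume \<eta>: "\<eta> \<in> rec_on E U W \<xi>"
      have mle: "m x \<le> \<eta> x" if "x \<in> C" for x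
        using first[OF \<eta>, of "{x}"] that by auto
      have "burns ?E C (restr C (\<lambda>x. \<eta> x - m x))"
        unfolding burns_def
      proof (intro allI impI)
        fix F assume F: "F \<subseteq> C" "F \<noteq> {}"
        then obtain x where "x \<in> F" "deg ?E F x + m x \<le> \<eta> x" using first[OF \<eta>] by blast
        then show "\<exists>x\<in>F. deg ?E F x \<le> restr C (\<lambda>x. \<eta> x - m x) x"
          using F by (intro bexI[of _ x]) (auto simp: restr_def)
      qed
      moreover have "\<eta> x - m x < deg ?E UNIV x" if x: "x \<in> C" for x
      proof -
        have "\<eta> x < deg E UNIV x" using \<eta> x C by (auto simp: rec_on_def rec_def)
        then show ?thesis using mle[OF x] deg_full[of x] by simp
      qed
      ultimately have "restr C (\<lambda>x. \<eta> x - m x) \<in> rec ?E C"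
        by (auto simp: rec_def restr_def)
      moreover have "restr (U - C) \<eta> \<in> rec_on E (U - C) W \<xi>"
        using \<eta> C by (auto simp: rec_on_def restr_def intro!: restr_rec)
      ultimately show "split_conf \<eta> \<in> rec ?E C \<times> rec_on E (U - C) W \<xi>"
        by (simp add: split_conf_def)
    qed
    show "join \<in> rec ?E C \<times> rec_on E (U - C) W \<xi> \<rightarrow> rec_on E U W \<xi>"
    proof (intro funcsetI, clarify)
      fix \<alpha> \<zeta> assume \<alpha>: "\<alpha> \<in> rec ?E C" and \<zeta>: "\<zeta> \<in> rec_on E (U - C) W \<xi>"
      let ?\<eta> = "join (\<alpha>, \<zeta>)"
      have \<eta>C: "?\<eta> x = \<alpha> x + m x" if "x \<in> C" for x using that by (simp add: join_def)
      have \<eta>nC: "?\<eta> x = \<zeta> x" if "x \<notin> C" for x using that by (simp add: join_def)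
      have b\<alpha>: "burns ?E C \<alpha>" and b\<zeta>: "burns E (U - C) \<zeta>"
        using \<alpha> \<zeta> by (simp_all add: rec_on_def rec_def)
      have "burns E U ?\<eta>"
        unfolding burns_def
      proof (intro allI impI)
        fix F assume F: "F \<subseteq> U" "F \<noteq> {}"
        show "\<exists>x\<in>F. deg E F x \<le> ?\<eta> x"
        proof (cases "F \<inter> C = {}")
          case True
          then have "F \<subseteq> U - C" using F by blast
          then obtain x where x: "x \<in> F" "deg E F x \<le> \<zeta> x"
            using burnsD[OF b\<zeta> _ F(2)] by blast
          moreover have "x \<notin> C" using x True by blast
          ultimately show ?thesis using \<eta>nC by (intro bexI[of _ x]) auto
        next
          case False
          then obtain x where x: "x \<in> F \<inter> C" "deg ?E (F \<inter> C) x \<le> \<alpha> x"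
            using burnsD[OF b\<alpha>, of "F \<inter> C"] by blast
          have "deg E F x \<le> deg E (F \<inter> C \<union> (U - C)) x" using E F by (intro deg_mono) auto
          also have "\<dots> = deg ?E (F \<inter> C) x + m x" using x by (intro deg_part) auto
          also have "\<dots> \<le> ?\<eta> x" using x \<eta>C by simp
          finally show ?thesis using x by blast
        qed
      qed
      moreover have "?\<eta> x < deg E UNIV x" if x: "x \<in> U" for x
      proof (cases "x \<in> C")
        case True
        then show ?thesis using \<alpha> \<eta>C deg_full[of x] by (simp add: rec_def)
      next
        case False
        then show ?thesis using \<zeta> x \<eta>nC by (auto simp: rec_on_def rec_def)
      qed
      moreover have "?\<eta> x = 0" if x: "x \<notin> U" for x
      proof -
        have "x \<notin> C" using x C by blast
        then show ?thesis using \<zeta> x \<eta>nC by (auto simp: rec_on_def rec_def)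
      qed
      ultimately have "?\<eta> \<in> rec E U" by (simp add: rec_def)
      moreover have "?\<eta> w = \<xi> w" if w: "w \<in> W" for w
      proof -
        have "w \<notin> C" using w C by blast
        then show ?thesis using w \<zeta> \<eta>nC by (simp add: rec_on_def)
      qed
      ultimately show "?\<eta> \<in> rec_on E U W \<xi>" by (simp add: rec_on_def)
    qed
  next
    fix \<eta> assume \<eta>: "\<eta> \<in> rec_on E U W \<xi>"
    have "m x \<le> \<eta> x" if "x \<in> C" for x
      using first[OF \<eta>, of "{x}"] that by auto
    moreover have "\<eta> x = 0" if "x \<notin> U" for x using \<eta> that by (simp add: rec_on_def rec_def)
    ultimately show "join (split_conf \<eta>) = \<eta>"
      by (auto simp: join_def split_conf_def restr_def fun_eq_iff)
  next
    fix p assume "p \<in> rec ?E C \<times> rec_on E (U - C) W \<xi>"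
    then show "split_conf (join p) = p"
      by (auto simp: join_def split_conf_def restr_def fun_eq_iff rec_on_def rec_def)
  qed
  then have "card (rec_on E U W \<xi>) = card (rec ?E C \<times> rec_on E (U - C) W \<xi>)"
    by (rule bij_betw_same_card)
  then show ?thesis by (simp add: card_cartesian_product)
qed

text \<open>The height \<open>\<xi> w\<close> lets \<open>w\<close> burn while all of
  \<open>Q\<close> is unburnt, so \<open>w\<close> joins the sink before anything else happens. As
  this height is prescribed, the passage to \<open>Q - {w}\<close> changes no count.\<close>

lemma rec_on_burn_vertex:
  assumes E: "E \<subseteq> E0" and w: "w \<in> W" "W \<subseteq> Q" "deg E Q w \<le> \<xi> w" "\<xi> w < deg E UNIV w"
    and \<zeta>: "\<zeta> \<in> rec E (Q - {w})"
  shows "\<zeta>(w := \<xi> w) \<in> rec E Q"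
proof -
  have "burns E Q (\<zeta>(w := \<xi> w))"
    unfolding burns_def
  proof (intro allI impI)
    fix F assume F: "F \<subseteq> Q" "F \<noteq> {}"
    show "\<exists>x\<in>F. deg E F x \<le> (\<zeta>(w := \<xi> w)) x"
    proof (cases "w \<in> F")
      case True
      have "deg E F w \<le> deg E Q w" using E F(1) by (rule deg_mono)
      then show ?thesis using True w(3) by (intro bexI[of _ w]) auto
    next
      case False
      then have FQ: "F \<subseteq> Q - {w}" using F by blast
      have "burns E (Q - {w}) \<zeta>" using \<zeta> by (simp add: rec_def)
      from burnsD[OF this FQ F(2)] obtain x where "x \<in> F" "deg E F x \<le> \<zeta> x" by blast
      then show ?thesis using False by (intro bexI[of _ x]) auto
    qed
  qed
  then show ?thesis using \<zeta> w by (auto simp: rec_def)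
qed

lemma card_rec_on_burn_vertex:
  assumes E: "E \<subseteq> E0" and w: "w \<in> W" "W \<subseteq> Q" "deg E Q w \<le> \<xi> w" "\<xi> w < deg E UNIV w"
  shows "card (rec_on E Q W \<xi>) = card (rec_on E (Q - {w}) (W - {w}) \<xi>)"
proof (rule bij_betw_same_card)
  show "bij_betw (\<lambda>\<eta>. restr (Q - {w}) \<eta>) (rec_on E Q W \<xi>) (rec_on E (Q - {w}) (W - {w}) \<xi>)"
  proof (rule bij_betwI[where g = "\<lambda>\<zeta>. \<zeta>(w := \<xi> w)"])
    show "(\<lambda>\<eta>. restr (Q - {w}) \<eta>) \<in> rec_on E Q W \<xi> \<rightarrow> rec_on E (Q - {w}) (W - {w}) \<xi>"
      using w(2) by (auto simp: rec_on_def restr_def subset_iff split: if_splits intro!: restr_rec)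
    show "(\<lambda>\<zeta>. \<zeta>(w := \<xi> w)) \<in> rec_on E (Q - {w}) (W - {w}) \<xi> \<rightarrow> rec_on E Q W \<xi>"
      using rec_on_burn_vertex[of E w W Q \<xi>, OF E w] by (auto simp: rec_on_def)
  next
    fix \<eta> assume "\<eta> \<in> rec_on E Q W \<xi>"
    then show "(restr (Q - {w}) \<eta>)(w := \<xi> w) = \<eta>"
      using w by (auto simp: rec_on_def rec_def restr_def fun_eq_iff)
  next
    fix \<zeta> assume "\<zeta> \<in> rec_on E (Q - {w}) (W - {w}) \<xi>"
    then show "restr (Q - {w}) (\<zeta>(w := \<xi> w)) = \<zeta>"
      by (auto simp: rec_on_def rec_def restr_def fun_eq_iff)
  qed
qed

lemma gen_minimal_burn_vertex:
  assumes E: "E \<subseteq> E0" and w: "w \<in> W" "W \<subseteq> Q" "deg E Q w \<le> \<xi> w" "\<xi> w < deg E UNIV w"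
    and gm: "gen_minimal E Q W \<xi>"
  shows "gen_minimal E (Q - {w}) (W - {w}) \<xi>"
proof -
  obtain \<eta> where "\<eta> \<in> rec_on E Q W \<xi>" using gm by (auto simp: gen_minimal_def)
  then have "restr (Q - {w}) \<eta> \<in> rec_on E (Q - {w}) (W - {w}) \<xi>"
    using w(2) by (auto simp: rec_on_def restr_def intro!: restr_rec)
  moreover have False
    if \<zeta>: "\<zeta> \<in> rec_on E (Q - {w}) (W - {w}) \<xi>" "v \<in> W - {w}" "0 < \<zeta> v"
      "\<zeta>(v := \<zeta> v - 1) \<in> rec E (Q - {w})" for \<zeta> v
  proof -
    let ?\<eta> = "\<zeta>(w := \<xi> w)"
    have "?\<eta> \<in> rec_on E Q W \<xi>"
      using \<zeta>(1) rec_on_burn_vertex[of E w W Q \<xi>, OF E w] by (auto simp: rec_on_def)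
    moreover have "?\<eta>(v := ?\<eta> v - 1) \<in> rec E Q"
    proof -
      have "?\<eta>(v := ?\<eta> v - 1) = (\<zeta>(v := \<zeta> v - 1))(w := \<xi> w)" using \<zeta>(2) by auto
      then show ?thesis using rec_on_burn_vertex[of E w W Q \<xi>, OF E w \<zeta>(4)] by (simp only:)
    qed
    moreover have "v \<in> W" "0 < ?\<eta> v" using \<zeta> by auto
    ultimately show False using gm unfolding gen_minimal_def by blast
  qed
  ultimately show ?thesis unfolding gen_minimal_def by blast
qed

section \<open>Gluing blocks at a single vertex\<close>

text \<open>
  The degenerate case \<open>p \<notin> U\<close>, in which \<open>C\<close> hangs off the sink, is included.
\<close>
lemma card_rec_pendant:
  assumes E: "E1 \<subseteq> E0" "EC \<subseteq> E0" and UC: "U \<inter> C = {}" and p: "p \<notin> C"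
    and E1: "\<And>e. e \<in> E1 \<Longrightarrow> ends e \<inter> C = {}" and EC: "\<And>e. e \<in> EC \<Longrightarrow> ends e \<subseteq> insert p C"
  shows "card (rec (E1 \<union> EC) (U \<union> C)) = card (rec E1 U) * card (rec EC C)"
proof -
  have disj: "E1 \<inter> EC = {}"
  proof -
    have False if e: "e \<in> E1" "e \<in> EC" for e
    proof -
      have "ends e \<subseteq> {p}" using E1[OF that(1)] EC[OF that(2)] by blast
      then have "card (ends e) \<le> 1" using card_mono[of "{p}"] by simp
      moreover have "card (ends e) = 2" using card_ends E(1) e(1) by blast
      ultimately show False by simp
    qed
    then show ?thesis by blast
  qed
  have deg_split: "deg (E1 \<union> EC) F x = deg E1 F x + deg EC F x" for F x
  proof -
    let ?P = "\<lambda>e. x \<in> ends e \<and> ends e \<subseteq> F"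
    have "card ({e \<in> E1. ?P e} \<union> {e \<in> EC. ?P e}) = card {e \<in> E1. ?P e} + card {e \<in> EC. ?P e}"
      by (rule card_Un_disjoint)
        (use disj in \<open>auto intro: finite_incident'[OF E(1)] finite_incident'[OF E(2)]\<close>)
    moreover have "{e \<in> E1 \<union> EC. ?P e} = {e \<in> E1. ?P e} \<union> {e \<in> EC. ?P e}" by blast
    ultimately show ?thesis unfolding deg_def by simp
  qed
  have deg_C: "deg (E1 \<union> EC) F x = deg EC F x" if "x \<in> C" for F x
    using that E1 by (intro deg_cong) blast
  have deg_EC_full: "deg EC F x = deg EC UNIV x" if "insert p C \<subseteq> F" for F x
    using that EC by (intro deg_cong) blast
  have deg_EC_0: "deg EC F x = 0" if "x \<notin> C" "x \<noteq> p" for F x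
  proof -
    have "{e \<in> EC. x \<in> ends e \<and> ends e \<subseteq> F} = {}" using that EC by blast
    then show ?thesis unfolding deg_def by (simp only: card.empty)
  qed
  have deg_E1: "deg E1 F x = deg E1 F' x" if "F - C = F' - C" for F F' x
    using that E1 by (intro deg_cong) blast
  have stuck: "\<exists>x\<in>F. deg E1 F x + deg EC UNIV x \<le> \<eta> x"
    if \<eta>: "\<eta> \<in> rec (E1 \<union> EC) (U \<union> C)" and F: "F \<subseteq> U" "F \<noteq> {}" for \<eta> F
  proof -
    have burns: "burns (E1 \<union> EC) (U \<union> C) \<eta>" using \<eta> by (simp add: rec_def)
    show ?thesis
    proof (cases "p \<in> F")
      case True
      \<comment> \<open>While \<open>p\<close> and \<open>C\<close> are unburnt, a vertex of
        \<open>C\<close> needs its full degree in grains, which stability forbids. So testing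
        \<open>F \<union> C\<close> must produce a vertex of \<open>F\<close>.\<close>
      have "F \<union> C \<subseteq> U \<union> C" "F \<union> C \<noteq> {}" using F by auto
      then obtain x where x: "x \<in> F \<union> C" "deg (E1 \<union> EC) (F \<union> C) x \<le> \<eta> x"
        using burnsD[OF burns] by blast
      have full: "deg EC (F \<union> C) x = deg EC UNIV x" using True by (intro deg_EC_full) auto
      have "x \<notin> C"
      proof
        assume xC: "x \<in> C"
        have "\<eta> x < deg (E1 \<union> EC) UNIV x" using \<eta> xC by (simp add: rec_def)
        then show False using x(2) full deg_C[OF xC] by simp
      qed
      moreover have "deg E1 (F \<union> C) x = deg E1 F x" by (rule deg_E1) blast
      ultimately show ?thesis using x full deg_split[of "F \<union> C" x] by (intro bexI[of _ x]) auto
    next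
      case False
      have "F \<subseteq> U \<union> C" using F by blast
      then obtain x where x: "x \<in> F" "deg (E1 \<union> EC) F x \<le> \<eta> x"
        using burnsD[OF burns _ F(2)] by blast
      moreover have "x \<notin> C" "x \<noteq> p" using x(1) F UC False by auto
      ultimately show ?thesis using deg_split[of F x] deg_EC_0[of x] by (intro bexI[of _ x]) auto
    qed
  qed
  \<comment> \<open>On \<open>U\<close> only \<open>m p\<close> can be nonzero: the edges from
    \<open>p\<close> into \<open>C\<close> raise the heights admissible at \<open>p\<close> by a
    constant, because \<open>p\<close> burns before \<open>C\<close>.\<close>
  define m where "m = deg EC UNIV"
  define split_conf where "split_conf \<eta> = (restr U (\<lambda>x. \<eta> x - m x), restr C \<eta>)" for \<eta>
  define join where "join = (\<lambda>(\<alpha>, \<beta>) x. if x \<in> C then \<beta> x else if x \<in> U then \<alpha> x + m x else 0 :: nat)"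
  have mle: "m x \<le> \<eta> x" if "\<eta> \<in> rec (E1 \<union> EC) (U \<union> C)" "x \<in> U" for \<eta> x
    using stuck[OF that(1), of "{x}"] that(2) by (auto simp: m_def)
  have "bij_betw split_conf (rec (E1 \<union> EC) (U \<union> C)) (rec E1 U \<times> rec EC C)"
  proof (rule bij_betwI[where g = join])
    show "split_conf \<in> rec (E1 \<union> EC) (U \<union> C) \<rightarrow> rec E1 U \<times> rec EC C"
    proof
      fix \<eta> assume \<eta>: "\<eta> \<in> rec (E1 \<union> EC) (U \<union> C)"
      have "burns E1 U (restr U (\<lambda>x. \<eta> x - m x))"
        unfolding burns_def
      proof (intro allI impI)
        fix F assume F: "F \<subseteq> U" "F \<noteq> {}"
        then obtain x where "x \<in> F" "deg E1 F x + m x \<le> \<eta> x"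
          using stuck[OF \<eta>] unfolding m_def by blast
        then show "\<exists>x\<in>F. deg E1 F x \<le> restr U (\<lambda>x. \<eta> x - m x) x"
          using F by (intro bexI[of _ x]) (auto simp: restr_def)
      qed
      moreover have "\<eta> x - m x < deg E1 UNIV x" if x: "x \<in> U" for x
      proof -
        have "\<eta> x < deg (E1 \<union> EC) UNIV x" using \<eta> x by (simp add: rec_def)
        then show ?thesis using mle[OF \<eta> x] deg_split[of UNIV x] by (simp add: m_def)
      qed
      ultimately have "restr U (\<lambda>x. \<eta> x - m x) \<in> rec E1 U"
        by (auto simp: rec_def restr_def)
      moreover have "restr C \<eta> \<in> rec EC C"
      proof -
        have "restr C \<eta> \<in> rec (E1 \<union> EC) C" using \<eta> by (rule restr_rec) blast
        moreover have "rec (E1 \<union> EC) C = rec EC C" by (rule rec_cong) (use E1 in blast)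
        ultimately show ?thesis by simp
      qed
      ultimately show "split_conf \<eta> \<in> rec E1 U \<times> rec EC C" by (simp add: split_conf_def)
    qed
    show "join \<in> rec E1 U \<times> rec EC C \<rightarrow> rec (E1 \<union> EC) (U \<union> C)"
    proof (intro funcsetI, clarify)
      fix \<alpha> \<beta> assume \<alpha>: "\<alpha> \<in> rec E1 U" and \<beta>: "\<beta> \<in> rec EC C"
      let ?\<eta> = "join (\<alpha>, \<beta>)"
      have \<eta>C: "?\<eta> x = \<beta> x" if "x \<in> C" for x using that by (simp add: join_def)
      have \<eta>U: "?\<eta> x = \<alpha> x + m x" if "x \<in> U" for x using that UC by (auto simp: join_def)
      have b\<alpha>: "burns E1 U \<alpha>" and b\<beta>: "burns EC C \<beta>"
        using \<alpha> \<beta> by (simp_all add: rec_def)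
      have "burns (E1 \<union> EC) (U \<union> C) ?\<eta>"
        unfolding burns_def
      proof (intro allI impI)
        fix F assume F: "F \<subseteq> U \<union> C" "F \<noteq> {}"
        show "\<exists>x\<in>F. deg (E1 \<union> EC) F x \<le> ?\<eta> x"
        proof (cases "F \<inter> U = {}")
          case True
          then have "F \<subseteq> C" using F by blast
          then obtain x where x: "x \<in> F" "deg EC F x \<le> \<beta> x"
            using burnsD[OF b\<beta> _ F(2)] by blast
          moreover have "x \<in> C" using x \<open>F \<subseteq> C\<close> by blast
          ultimately show ?thesis using \<eta>C deg_C by (intro bexI[of _ x]) auto
        next
          case False
          then obtain x where x: "x \<in> F \<inter> U" "deg E1 (F \<inter> U) x \<le> \<alpha> x"
            using burnsD[OF b\<alpha>, of "F \<inter> U"] by blast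
          have "F - C = F \<inter> U - C" using F by blast
          then have "deg (E1 \<union> EC) F x = deg E1 (F \<inter> U) x + deg EC F x"
            using deg_split[of F x] deg_E1 by metis
          also have "\<dots> \<le> \<alpha> x + m x"
            using x(2) deg_mono[OF E(2), of F UNIV x] by (simp add: m_def)
          finally show ?thesis using x \<eta>U by (intro bexI[of _ x]) auto
        qed
      qed
      moreover have "?\<eta> x < deg (E1 \<union> EC) UNIV x" if x: "x \<in> U \<union> C" for x
      proof (cases "x \<in> C")
        case True
        then show ?thesis using \<beta> \<eta>C deg_C by (simp add: rec_def)
      next
        case False
        then have "x \<in> U" using x by blast
        then show ?thesis using \<alpha> \<eta>U deg_split[of UNIV x] by (simp add: rec_def m_def)
      qed
      moreover have "?\<eta> x = 0" if x: "x \<notin> U \<union> C" for x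
        using x by (simp add: join_def)
      ultimately show "?\<eta> \<in> rec (E1 \<union> EC) (U \<union> C)" by (simp add: rec_def)
    qed
  next
    fix \<eta> assume \<eta>: "\<eta> \<in> rec (E1 \<union> EC) (U \<union> C)"
    then have "\<eta> x = 0" if "x \<notin> U" "x \<notin> C" for x using that by (simp add: rec_def)
    then show "join (split_conf \<eta>) = \<eta>"
      using mle[OF \<eta>] by (auto simp: join_def split_conf_def restr_def fun_eq_iff)
  next
    fix q assume "q \<in> rec E1 U \<times> rec EC C"
    then obtain \<alpha> \<beta> where q: "q = (\<alpha>, \<beta>)" "\<alpha> \<in> rec E1 U" "\<beta> \<in> rec EC C" by blast
    have "\<alpha> x = 0" if "x \<notin> U" for x using that q(2) by (simp add: rec_def)
    moreover have "\<beta> x = 0" if "x \<notin> C" for x using that q(3) by (simp add: rec_def)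
    moreover have "x \<notin> C" if "x \<in> U" for x using that UC by blast
    ultimately show "split_conf (join q) = q"
      by (auto simp: q(1) join_def split_conf_def restr_def fun_eq_iff)
  qed
  then have "card (rec (E1 \<union> EC) (U \<union> C)) = card (rec E1 U \<times> rec EC C)"
    by (rule bij_betw_same_card)
  then show ?thesis by (simp add: card_cartesian_product)
qed

text \<open>A block consisting of a vertex of \<open>W\<close> must contribute the factor 1 to match
  its prescribed height. A single kept edge does this.\<close>

lemma rec_singleton_one_edge:
  assumes "e \<in> E0" "ends e = {w, p}" "w \<noteq> p"
  shows "card (rec {e} {w}) = 1"
proof -
  have "{f \<in> {e}. w \<in> ends f \<and> ends f \<subseteq> UNIV} = {e}" using assms(2) by auto
  then have deg_full: "deg {e} UNIV w = 1" unfolding deg_def by simp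
  have "{f \<in> {e}. w \<in> ends f \<and> ends f \<subseteq> {w}} = {}" using assms(2,3) by auto
  then have deg_w: "deg {e} {w} w = 0" unfolding deg_def by (simp only: card.empty)
  have "burns {e} {w} (\<lambda>_. 0)"
    unfolding burns_def
  proof (intro allI impI)
    fix F assume "F \<subseteq> {w}" "F \<noteq> {}"
    then have "F = {w}" by blast
    then show "\<exists>x\<in>F. deg {e} F x \<le> 0" using deg_w by simp
  qed
  then have "rec {e} {w} = {\<lambda>_. 0}"
    using deg_full by (auto simp: rec_def fun_eq_iff) metis
  then show ?thesis by simp
qed

text \<open>Applies the gluing twice: \<open>w\<close> hangs on \<open>p\<close> by the one kept
  edge and contributes the factor 1, then \<open>C\<close> hangs on \<open>w\<close>.\<close>

lemma card_rec_two_pendants: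
  assumes E: "E1 \<subseteq> E0" "EC \<subseteq> E0" "e \<in> E0" and e: "ends e = {w, p}" "w \<noteq> p" "p \<notin> C" "e \<notin> E1"
    and disj: "w \<notin> P" "w \<notin> C" "P \<inter> C = {}"
    and E1: "\<And>f. f \<in> E1 \<Longrightarrow> ends f \<inter> insert w C = {}" and EC: "\<And>f. f \<in> EC \<Longrightarrow> ends f \<subseteq> insert w C"
  shows "card (rec (E1 \<union> {e} \<union> EC) (P \<union> insert w C)) = card (rec E1 P) * card (rec EC C)"
proof -
  have "card (rec ((E1 \<union> {e}) \<union> EC) ((P \<union> {w}) \<union> C)) = card (rec (E1 \<union> {e}) (P \<union> {w})) * card (rec EC C)"
  proof (rule card_rec_pendant[where p = w])
    show "ends f \<inter> C = {}" if "f \<in> E1 \<union> {e}" for f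
      using that E1[of f] e disj by auto
  qed (use assms in auto)
  also have "card (rec (E1 \<union> {e}) (P \<union> {w})) = card (rec E1 P) * card (rec {e} {w})"
    using E e disj E1 by (intro card_rec_pendant[where p = p]) auto
  also have "card (rec {e} {w}) = 1" using E e by (intro rec_singleton_one_edge[where p = p])
  finally show ?thesis by (simp add: Un_assoc)
qed

text \<open>\<open>E2\<close> is the set of kept edges at \<open>Q\<close>. It must be found from
  \<open>Q\<close> alone, so the blocks burnt earlier enter as arbitrary \<open>P\<close> and
  \<open>E1\<close>; this also lets the induction step hand its own new blocks to the induction
  hypothesis. The last assumption says that \<open>Q - W\<close> is cut off from the sink by
  \<open>W\<close>.\<close>

theorem card_rec_on_eq_card_rec:
  assumes "E \<subseteq> E0" "finite Q" "W \<subseteq> Q" "gen_minimal E Q W \<xi>"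
    and "\<And>e. e \<in> E \<Longrightarrow> ends e \<inter> (Q - W) \<noteq> {} \<Longrightarrow> ends e \<subseteq> Q"
  shows "\<exists>E2\<subseteq>{e \<in> E. ends e \<inter> Q \<noteq> {}}. (\<forall>e\<in>E - E2. ends e \<inter> Q \<noteq> {} \<longrightarrow> ends e \<inter> W \<noteq> {}) \<and>
    (\<forall>P E1. finite P \<longrightarrow> P \<inter> Q = {} \<longrightarrow> E1 \<subseteq> E \<longrightarrow> (\<forall>e\<in>E1. ends e \<inter> Q = {}) \<longrightarrow>
      card (rec (E1 \<union> E2) (P \<union> Q)) = card (rec E1 P) * card (rec_on E Q W \<xi>))"
  using assms
proof (induction "card W" arbitrary: Q W rule: less_induct)
  case less
  note E = less.prems(1) and finQ = less.prems(2) and WQ = less.prems(3)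
    and gm = less.prems(4) and closed = less.prems(5)
  obtain \<eta> where \<eta>: "\<eta> \<in> rec E Q" "\<And>w. w \<in> W \<Longrightarrow> \<eta> w = \<xi> w"
    using gm by (auto simp: gen_minimal_def rec_on_def)
  show ?case
  proof (cases "Q = {}")
    case True
    have "rec_on E {} W \<xi> = {\<lambda>_. 0}"
      using \<eta> WQ True by (auto simp: rec_on_def rec_def burns_def)
    then show ?thesis using True by (intro exI[of _ "{}"]) simp
  next
    case False
    have "burns E Q \<eta>" using \<eta> by (simp add: rec_def)
    then obtain w where w: "w \<in> Q" "deg E Q w \<le> \<eta> w"
      using burnsD[OF _ order_refl False] by blast
    have full: "\<eta> w < deg E UNIV w" using \<eta>(1) w(1) by (simp add: rec_def)
    \<comment> \<open>Off \<open>W\<close> every edge stays inside \<open>Q\<close>, so a vertex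
      there would need its full degree in grains to burn first.\<close>
    have wW: "w \<in> W"
    proof (rule ccontr)
      assume "w \<notin> W"
      then have "deg E Q w = deg E UNIV w"
        using w(1) closed by (intro deg_cong) blast
      then show False using w(2) full by simp
    qed
    have w1: "deg E Q w \<le> \<xi> w" "\<xi> w < deg E UNIV w" using w(2) full \<eta>(2)[OF wW] by simp_all
    have "\<exists>e\<in>E. w \<in> ends e \<and> \<not> ends e \<subseteq> Q"
    proof (rule ccontr)
      assume "\<not> (\<exists>e\<in>E. w \<in> ends e \<and> \<not> ends e \<subseteq> Q)"
      then have "deg E Q w = deg E UNIV w" by (intro deg_cong) blast
      then show False using w1 by simp
    qed
    \<comment> \<open>This \<open>e\<close> is the one edge from \<open>w\<close> to the earlier
      blocks or the sink that is kept.\<close>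
    then obtain e where e: "e \<in> E" "w \<in> ends e" "\<not> ends e \<subseteq> Q" by blast
    have "e \<in> E0" using e(1) E by blast
    then obtain p where p: "p \<noteq> w" "ends e = {w, p}" using e(2) by (rule ends_other)
    have pQ: "p \<notin> Q" using e(3) p(2) w(1) by simp
    \<comment> \<open>\<open>C\<close> consists of the vertices that \<open>w\<close> reaches
      through \<open>Q - W\<close>: the components of \<open>Q - W\<close> adjacent to
      \<open>w\<close>, which burn right after it.\<close>
    define r where "r = {(x, y). y \<in> Q - W \<and> (\<exists>e\<in>E. ends e = {x, y})}"
    define C where "C = r\<^sup>+ `` {w}"
    have CQ: "C \<subseteq> Q - W"
    proof
      fix y assume "y \<in> C"
      then have "(w, y) \<in> r\<^sup>+" unfolding C_def by simp
      then obtain z where "(z, y) \<in> r" by (meson tranclD2)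
      then show "y \<in> Q - W" unfolding r_def by simp
    qed
    have C_first: "y \<in> C" if "f \<in> E" "ends f = {w, y}" "y \<in> Q - W" for f y
    proof -
      have "(w, y) \<in> r" using that unfolding r_def by blast
      then show ?thesis unfolding C_def by (simp add: r_into_trancl)
    qed
    have C_step: "y \<in> C" if "x \<in> C" "f \<in> E" "ends f = {x, y}" "y \<in> Q - W" for f x y
    proof -
      have "(x, y) \<in> r" using that unfolding r_def by blast
      moreover have "(w, x) \<in> r\<^sup>+" using that(1) unfolding C_def by simp
      ultimately show ?thesis unfolding C_def by (simp add: trancl_into_trancl)
    qed
    define Q' where "Q' = Q - {w} - C"
    let ?W = "W - {w}"
    have wC: "w \<notin> C" using CQ wW by blast
    have att: "attached E (Q - {w}) C"
      unfolding attached_def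
    proof (intro allI impI, rule ccontr)
      fix F assume F: "F \<subseteq> C" "F \<noteq> {}"
        and "\<not> (\<exists>x\<in>F. \<exists>e\<in>E. x \<in> ends e \<and> \<not> ends e \<subseteq> F \<union> (Q - {w} - C))"
      then have no: "ends f \<subseteq> F \<union> (Q - {w} - C)" if "x \<in> F" "f \<in> E" "x \<in> ends f" for x f
        using that by blast
      \<comment> \<open>On a path from \<open>w\<close> no vertex can be the first one in
        \<open>F\<close>: its predecessor is \<open>w\<close> or lies in \<open>C - F\<close>, and
        \<open>no\<close> excludes an edge from \<open>F\<close> to either.\<close>
      have "y \<notin> F" if "(w, y) \<in> r\<^sup>+" for y
        using that
      proof (induction rule: trancl_induct)
        case (base y)
        then obtain f where f: "f \<in> E" "ends f = {w, y}" unfolding r_def by blast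
        have "w \<notin> F" using F wC by blast
        then show ?case using no[of y f] f by blast
      next
        case (step y z)
        then obtain f where f: "f \<in> E" "ends f = {y, z}" unfolding r_def by blast
        have "y \<in> C" using step.hyps(1) unfolding C_def by simp
        then show ?case using no[of z f] f step.IH by blast
      qed
      then have "F \<inter> C = {}" unfolding C_def by auto
      then show False using F by blast
    qed
    have gm1: "gen_minimal E (Q - {w}) ?W \<xi>"
      using E wW WQ w1 gm by (rule gen_minimal_burn_vertex)
    have CQw: "C \<subseteq> Q - {w}" and WQ': "?W \<subseteq> Q - {w} - C" using CQ wC WQ by blast+
    have gm': "gen_minimal E Q' ?W \<xi>"
      unfolding Q'_def using E CQw WQ' att gm1 by (rule gen_minimal_diff)
    have nbr_C: "ends f \<subseteq> insert w C \<union> ?W" if f: "f \<in> E" "ends f \<inter> C \<noteq> {}" for f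
    proof -
      obtain x where x: "x \<in> ends f" "x \<in> C" using f(2) by blast
      have "f \<in> E0" using f E by blast
      then obtain y where y: "ends f = {x, y}" using x(1) by (rule ends_other)
      have "ends f \<subseteq> Q" using closed[OF f(1)] x CQ by blast
      then have "y \<in> Q" using y by blast
      then have "y \<in> C \<or> y \<in> W" using C_step[OF x(2) f(1) y] by blast
      then show ?thesis using x(2) wC unfolding y by auto
    qed
    have closed': "ends f \<subseteq> Q'" if f: "f \<in> E" "ends f \<inter> (Q' - ?W) \<noteq> {}" for f
    proof -
      obtain x where x: "x \<in> ends f" "x \<in> Q'" "x \<notin> ?W" using f(2) by blast
      then have xQW: "x \<in> Q - W" "x \<notin> C" unfolding Q'_def by blast+
      have "f \<in> E0" using f E by blast
      then obtain y where y: "ends f = {x, y}" using x(1) by (rule ends_other)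
      have "ends f \<subseteq> Q" using closed[OF f(1)] x(1) xQW by blast
      then have yQ: "y \<in> Q" using y by blast
      have y': "ends f = {y, x}" using y by blast
      have "y \<noteq> w" using C_first[OF f(1), of x] y' xQW by blast
      moreover have "y \<notin> C" using C_step[OF _ f(1) y'] xQW by blast
      ultimately show ?thesis using x(2) yQ unfolding y Q'_def by simp
    qed
    have "card ?W < card W"
      using wW finite_subset[OF WQ finQ] by (intro card_Diff1_less)
    moreover have "finite Q'" "?W \<subseteq> Q'" using finQ WQ' unfolding Q'_def by auto
    ultimately have "\<exists>E2\<subseteq>{e \<in> E. ends e \<inter> Q' \<noteq> {}}. (\<forall>e\<in>E - E2. ends e \<inter> Q' \<noteq> {} \<longrightarrow> ends e \<inter> ?W \<noteq> {}) \<and>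
        (\<forall>P E1. finite P \<longrightarrow> P \<inter> Q' = {} \<longrightarrow> E1 \<subseteq> E \<longrightarrow> (\<forall>e\<in>E1. ends e \<inter> Q' = {}) \<longrightarrow>
          card (rec (E1 \<union> E2) (P \<union> Q')) = card (rec E1 P) * card (rec_on E Q' ?W \<xi>))"
      using E gm' closed' by (intro less.hyps)
    then obtain E2 where E2: "E2 \<subseteq> {e \<in> E. ends e \<inter> Q' \<noteq> {}}"
      "\<And>e. e \<in> E - E2 \<Longrightarrow> ends e \<inter> Q' \<noteq> {} \<Longrightarrow> ends e \<inter> ?W \<noteq> {}"
      and IH: "\<And>P E1. finite P \<Longrightarrow> P \<inter> Q' = {} \<Longrightarrow> E1 \<subseteq> E \<Longrightarrow> (\<And>e. e \<in> E1 \<Longrightarrow> ends e \<inter> Q' = {}) \<Longrightarrow>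
        card (rec (E1 \<union> E2) (P \<union> Q')) = card (rec E1 P) * card (rec_on E Q' ?W \<xi>)"
      by (elim exE conjE) simp
    define EC where "EC = {f \<in> E. ends f \<subseteq> insert w C}"
    have "card (rec_on E Q W \<xi>) = card (rec_on E (Q - {w}) ?W \<xi>)"
      using E wW WQ w1 by (rule card_rec_on_burn_vertex)
    also have "\<dots> = card (rec {f \<in> E. ends f \<inter> Q' = {}} C) * card (rec_on E Q' ?W \<xi>)"
      unfolding Q'_def
    proof (rule card_rec_on_factor[OF E _ CQw WQ' _ gm'[unfolded Q'_def]])
      show "ends f \<inter> (Q - {w} - C - ?W) = {}" if "f \<in> E" "ends f \<inter> C \<noteq> {}" for f
        using nbr_C[OF that] by blast
    qed (use finQ in simp)
    \<comment> \<open>In the count for \<open>C\<close> the vertex \<open>w\<close> already belongs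
      to the sink, and every other way out of \<open>C\<close> leads into \<open>Q'\<close>. This is
      why \<open>C\<close> can be hung onto \<open>w\<close> alone.\<close>
    also have "rec {f \<in> E. ends f \<inter> Q' = {}} C = rec EC C"
    proof (rule rec_cong)
      fix f assume f: "ends f \<inter> C \<noteq> {}"
      have "ends f \<inter> Q' = {} \<longleftrightarrow> ends f \<subseteq> insert w C" if "f \<in> E"
        using nbr_C[OF that f] WQ CQ unfolding Q'_def by blast
      then show "f \<in> {f \<in> E. ends f \<inter> Q' = {}} \<longleftrightarrow> f \<in> EC" unfolding EC_def by blast
    qed
    finally have count: "card (rec_on E Q W \<xi>) = card (rec EC C) * card (rec_on E Q' ?W \<xi>)" .
    let ?E2 = "{e} \<union> EC \<union> E2"
    have Qsplit: "insert w C \<union> Q' = Q" using w(1) CQ unfolding Q'_def by blast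
    show ?thesis
    proof (intro exI[of _ ?E2] conjI ballI impI allI)
      have "ends f \<inter> Q \<noteq> {}" if "f \<in> EC" for f
      proof -
        have "f \<in> E0" "ends f \<subseteq> Q" using that E w(1) CQ unfolding EC_def by blast+
        then show ?thesis using card_ends[of f] by (auto simp: Int_absorb2)
      qed
      moreover have "ends f \<inter> Q \<noteq> {}" if "f \<in> E2" for f
        using that E2(1) unfolding Q'_def by blast
      ultimately show "?E2 \<subseteq> {e \<in> E. ends e \<inter> Q \<noteq> {}}"
        using e w(1) E2(1) unfolding EC_def by blast
    next
      fix f assume f: "f \<in> E - ?E2" "ends f \<inter> Q \<noteq> {}"
      show "ends f \<inter> W \<noteq> {}"
      proof (rule ccontr)
        assume no: "\<not> ends f \<inter> W \<noteq> {}"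
        have "f \<in> E" "f \<notin> EC" "f \<notin> E2" using f by blast+
        have "ends f \<inter> Q' = {}" using E2(2)[of f] no \<open>f \<in> E\<close> \<open>f \<notin> E2\<close> by blast
        moreover have "ends f \<subseteq> Q" using closed[OF \<open>f \<in> E\<close>] f(2) no by blast
        ultimately have "ends f \<subseteq> insert w C" using Qsplit by blast
        then show False using \<open>f \<in> E\<close> \<open>f \<notin> EC\<close> unfolding EC_def by blast
      qed
    next
      fix P E1 assume P: "finite P" "P \<inter> Q = {}" and E1: "E1 \<subseteq> E" "\<forall>e\<in>E1. ends e \<inter> Q = {}"
      \<comment> \<open>For the remaining blocks, \<open>w\<close> and \<open>C\<close> count as
        burnt earlier, so together with \<open>P\<close> they form the \<open>P\<close> of the
        induction hypothesis.\<close>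
      have "card (rec (E1 \<union> {e} \<union> EC \<union> E2) ((P \<union> insert w C) \<union> Q'))
          = card (rec (E1 \<union> {e} \<union> EC) (P \<union> insert w C)) * card (rec_on E Q' ?W \<xi>)"
      proof (rule IH)
        show "finite (P \<union> insert w C)" using P(1) finQ CQ by (auto intro: finite_subset)
        show "(P \<union> insert w C) \<inter> Q' = {}" using P(2) unfolding Q'_def by blast
        show "E1 \<union> {e} \<union> EC \<subseteq> E" using E1(1) e(1) unfolding EC_def by blast
        show "ends f \<inter> Q' = {}" if f: "f \<in> E1 \<union> {e} \<union> EC" for f
        proof -
          consider "f \<in> E1" | "f = e" | "f \<in> EC" using f by blast
          then show ?thesis
          proof cases
            case 1
            then show ?thesis using E1(2) unfolding Q'_def by blast
          next
            case 2
            then show ?thesis using p(2) pQ unfolding Q'_def by simp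
          next
            case 3
            then show ?thesis unfolding Q'_def EC_def by blast
          qed
        qed
      qed
      also have "card (rec (E1 \<union> {e} \<union> EC) (P \<union> insert w C)) = card (rec E1 P) * card (rec EC C)"
      proof (rule card_rec_two_pendants[where p = p])
        show "E1 \<subseteq> E0" "EC \<subseteq> E0" "e \<in> E0" using E E1(1) e(1) unfolding EC_def by blast+
        show "ends e = {w, p}" "w \<noteq> p" using p by auto
        show "p \<notin> C" using pQ CQ by blast
        show "e \<notin> E1" using E1(2) e(2) w(1) by blast
        show "w \<notin> P" "w \<notin> C" "P \<inter> C = {}" using P(2) w(1) wC CQ by blast+
        show "ends f \<inter> insert w C = {}" if "f \<in> E1" for f
          using E1(2) that w(1) CQ by blast
        show "ends f \<subseteq> insert w C" if "f \<in> EC" for f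
          using that unfolding EC_def by blast
      qed
      also have "E1 \<union> {e} \<union> EC \<union> E2 = E1 \<union> ?E2" by blast
      also have "(P \<union> insert w C) \<union> Q' = P \<union> Q" using Qsplit by blast
      finally show "card (rec (E1 \<union> ?E2) (P \<union> Q)) = card (rec E1 P) * card (rec_on E Q W \<xi>)"
        using count by simp
    qed
  qed
qed

corollary deleted_edges_exist:
  assumes E: "E \<subseteq> E0" and Q: "finite Q" "W \<subseteq> Q" and gm: "gen_minimal E Q W \<xi>"
    and closed: "\<And>e. e \<in> E \<Longrightarrow> ends e \<inter> (Q - W) \<noteq> {} \<Longrightarrow> ends e \<subseteq> Q"
  obtains D where "D \<subseteq> {e \<in> E. ends e \<inter> W \<noteq> {}}"
    "\<And>U. finite U \<Longrightarrow> Q \<subseteq> U \<Longrightarrow> card (rec (E - D) U) = card (rec_on E U W \<xi>)"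
proof -
  have "\<exists>E2\<subseteq>{e \<in> E. ends e \<inter> Q \<noteq> {}}. (\<forall>e\<in>E - E2. ends e \<inter> Q \<noteq> {} \<longrightarrow> ends e \<inter> W \<noteq> {}) \<and>
      (\<forall>P E1. finite P \<longrightarrow> P \<inter> Q = {} \<longrightarrow> E1 \<subseteq> E \<longrightarrow> (\<forall>e\<in>E1. ends e \<inter> Q = {}) \<longrightarrow>
        card (rec (E1 \<union> E2) (P \<union> Q)) = card (rec E1 P) * card (rec_on E Q W \<xi>))"
    using E Q gm closed by (rule card_rec_on_eq_card_rec)
  then obtain E2 where E2: "E2 \<subseteq> {e \<in> E. ends e \<inter> Q \<noteq> {}}"
    "\<And>e. e \<in> E - E2 \<Longrightarrow> ends e \<inter> Q \<noteq> {} \<Longrightarrow> ends e \<inter> W \<noteq> {}"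
    and card_E2: "\<And>P E1. finite P \<Longrightarrow> P \<inter> Q = {} \<Longrightarrow> E1 \<subseteq> E \<Longrightarrow> (\<And>e. e \<in> E1 \<Longrightarrow> ends e \<inter> Q = {}) \<Longrightarrow>
      card (rec (E1 \<union> E2) (P \<union> Q)) = card (rec E1 P) * card (rec_on E Q W \<xi>)"
    by (elim exE conjE) simp
  define D where "D = {e \<in> E. ends e \<inter> Q \<noteq> {}} - E2"
  show thesis
  proof (rule that[of D])
    show "D \<subseteq> {e \<in> E. ends e \<inter> W \<noteq> {}}" using E2(2) unfolding D_def by blast
    fix U assume U: "finite U" "Q \<subseteq> U"
    \<comment> \<open>The part of \<open>U\<close> off \<open>Q\<close> burns first and takes the
      place of \<open>P\<close>. As \<open>P\<close> is arbitrary there, \<open>D\<close> is fixed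
      before \<open>U\<close> is chosen.\<close>
    let ?C = "U - Q" and ?E1 = "{e \<in> E. ends e \<inter> Q = {}}"
    have UC: "U - ?C = Q" using U by blast
    have "card (rec_on E U W \<xi>) = card (rec {e \<in> E. ends e \<inter> (U - ?C) = {}} ?C) * card (rec_on E (U - ?C) W \<xi>)"
    proof (rule card_rec_on_factor[OF E U(1)])
      show "ends e \<inter> (U - ?C - W) = {}" if "e \<in> E" "ends e \<inter> ?C \<noteq> {}" for e
        using closed[OF that(1)] that(2) unfolding UC by blast
    qed (use Q gm UC in auto)
    also have "\<dots> = card (rec (?E1 \<union> E2) (?C \<union> Q))"
      unfolding UC using U(1) by (intro card_E2[symmetric]) auto
    also have "?E1 \<union> E2 = E - D" using E2(1) unfolding D_def by blast
    also have "?C \<union> Q = U" using U by blast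
    finally show "card (rec (E - D) U) = card (rec_on E U W \<xi>)" ..
  qed
qed

end

section \<open>The sandpile chain\<close>

lemma AE_stream_space_Cons:
  assumes "AE \<omega> in stream_space (measure_pmf q). P \<omega>" "x \<in> set_pmf q"
  shows "AE \<omega> in stream_space (measure_pmf q). P (x ## \<omega>)"
proof -
  let ?S = "stream_space (measure_pmf q)"
  \<comment> \<open>\<open>P\<close> is an arbitrary predicate, so the exceptional set is first
    enclosed in a measurable null set.\<close>
  obtain N where N: "{\<omega> \<in> space ?S. \<not> P \<omega>} \<subseteq> N" "N \<in> null_sets ?S"
    using assms(1) by (auto simp: eventually_ae_filter)
  have [measurable]: "N \<in> sets ?S" using N(2) by blast
  have "AE \<omega> in ?S. \<omega> \<notin> N" using N(2) by (rule AE_not_in)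
  then have "AE x in measure_pmf q. AE \<omega> in ?S. x ## \<omega> \<notin> N"
    by (subst (asm) prob_space.AE_stream_space[OF measure_pmf.prob_space_axioms]) auto
  then have "AE \<omega> in ?S. x ## \<omega> \<notin> N" using assms(2) by (simp add: AE_measure_pmf_iff)
  then show ?thesis
    using N(1) by (auto simp: space_stream_space elim!: eventually_mono)
qed

lemma AE_stream_space_shift:
  assumes "AE \<omega> in stream_space (measure_pmf q). P \<omega>" "set l \<subseteq> set_pmf q"
  shows "AE \<omega> in stream_space (measure_pmf q). P (l @- \<omega>)"
  using assms
proof (induction l arbitrary: P)
  case (Cons x l)
  have "AE \<omega> in stream_space (measure_pmf q). P (x ## \<omega>)"
    using Cons.prems by (intro AE_stream_space_Cons) auto
  then show ?case using Cons.IH[of "\<lambda>\<omega>. P (x ## \<omega>)"] Cons.prems by simp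
qed simp

lemma AE_stream_space_stake:
  "AE \<omega> in stream_space (measure_pmf q). \<forall>n. set (stake n \<omega>) \<subseteq> set_pmf q"
proof -
  have "AE \<omega> in stream_space (measure_pmf q). stream_all (\<lambda>x. x \<in> set_pmf q) \<omega>"
    by (rule prob_space.AE_stream_all[OF measure_pmf.prob_space_axioms]) (auto simp: AE_measure_pmf_iff)
  then show ?thesis
    by eventually_elim (auto simp: stream_all_def in_set_conv_nth)
qed

lemma AE_stream_space_ex:
  assumes "AE \<omega> in stream_space (measure_pmf q). P \<omega>"
  shows "\<exists>\<omega>. P \<omega>"
proof (rule ccontr)
  assume "\<nexists>\<omega>. P \<omega>"
  then have "AE \<omega> in stream_space (measure_pmf q). \<not> P \<omega>" by simp
  moreover have "prob_space (stream_space (measure_pmf q))"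
    by (rule prob_space.prob_space_stream_space) (rule measure_pmf.prob_space_axioms)
  ultimately show False using assms prob_space.AE_contr by blast
qed

lemma pred_stake_eq [measurable]:
  "Measurable.pred (stream_space (measure_pmf q)) (\<lambda>\<omega>. stake n \<omega> = l)"
proof (induction n arbitrary: l)
  case (Suc n)
  show ?case
  proof (cases l)
    case (Cons x k)
    have "Measurable.pred (stream_space (measure_pmf q)) (\<lambda>\<omega>. shd \<omega> \<in> {x})"
      by (rule measurable_compose[OF measurable_shd]) simp
    moreover have "Measurable.pred (stream_space (measure_pmf q)) (\<lambda>\<omega>. stake n (stl \<omega>) = k)"
      by (rule measurable_compose[OF measurable_stl Suc])
    ultimately show ?thesis unfolding Cons by simp
  qed simp
qed simp

text \<open>The assumption \<open>leaving\<close> is connectedness to the sink in the form that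
  burning uses: every nonempty \<open>F\<close> has an edge leading out of it.\<close>

locale sandpile =
  fixes H :: "('v option, 'e) pre_digraph"
    and U :: "'v set" and a :: "'v \<Rightarrow> 'v \<Rightarrow> nat" and d :: "'v \<Rightarrow> nat"
  defines "U \<equiv> nonsink H" and "a \<equiv> \<lambda>x y. edge_mult H (Some x) (Some y)"
    and "d \<equiv> \<lambda>x. degree_of H (Some x)"
  assumes finite_U: "finite U" and U_nonempty: "U \<noteq> {}"
    and no_loop: "x \<in> U \<Longrightarrow> a x x = 0"
    and sum_le_degree: "x \<in> U \<Longrightarrow> sum (a x) U \<le> d x"
    and leaving: "F \<subseteq> U \<Longrightarrow> F \<noteq> {} \<Longrightarrow> \<exists>x\<in>F. sum (a x) F < d x"
begin

definition R :: "('v \<Rightarrow> nat) set" where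
  "R = burnable_configs U a d"

definition S :: "('v \<Rightarrow> nat) set" where
  "S = stable_sandpiles H"

definition Z :: "('v \<Rightarrow> nat) set" where
  "Z = {\<eta>. \<forall>x. x \<notin> U \<longrightarrow> \<eta> x = 0}"

lemma S_eq: "S = stable_configs U d"
  unfolding S_def stable_sandpiles_def stable_configs_def U_def d_def ..

lemma R_subset_S: "R \<subseteq> S"
  unfolding R_def S_eq burnable_configs_def by blast

lemma S_subset_Z: "S \<subseteq> Z"
  unfolding S_eq stable_configs_def Z_def by blast

lemma finite_R: "finite R"
  unfolding R_def by (rule finite_burnable_configs[OF finite_U])

lemma a_sym: "a x y = a y x"
  unfolding a_def edge_mult_def by (simp add: insert_commute)

definition max_config :: "'v \<Rightarrow> nat" where
  "max_config x = (if x \<in> U then d x - 1 else 0)"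

lemma degree_pos: "x \<in> U \<Longrightarrow> 0 < d x"
  using leaving[of "{x}"] by auto

lemma max_config_R: "max_config \<in> R"
proof -
  have "burnable U a max_config"
    unfolding burnable_def
  proof (intro allI impI)
    fix F assume F: "F \<subseteq> U" "F \<noteq> {}"
    then obtain x where "x \<in> F" "sum (a x) F < d x" using leaving by blast
    then show "\<exists>x\<in>F. sum (a x) F \<le> max_config x"
      using F by (intro bexI[of _ x]) (auto simp: max_config_def)
  qed
  then show ?thesis
    using degree_pos by (auto simp: R_def burnable_configs_def stable_configs_def max_config_def)
qed

lemma R_nonempty: "R \<noteq> {}"
  using max_config_R by blast

text \<open>Invertibility by counting: the determinant is the number of burnable configurations, and
  \<open>max_config\<close> is one of them.\<close>

lemma det_lap_nonzero: "det_on U (lap a d) \<noteq> 0"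
proof -
  have "card R > 0" using R_nonempty finite_R by (simp add: card_gt_0_iff)
  then show ?thesis
    using card_burnable_configs[where a = a and d = d, OF finite_U sum_le_degree] unfolding R_def by simp
qed

section \<open>Termination of toppling and the abelian property\<close>

lemma topple_eq:
  "topple H x \<eta> = (\<lambda>y. if y = x then \<eta> x - d x else if y \<in> U then \<eta> y + a x y else \<eta> y)"
  unfolding topple_def U_def a_def d_def ..

lemma legal_toppleI: "x \<in> U \<Longrightarrow> d x \<le> \<eta> x \<Longrightarrow> legal_topple H \<eta> (topple H x \<eta>)"
  unfolding legal_topple_def U_def d_def by blast

lemma topple_eq_lap:
  assumes "x \<in> U" "d x \<le> \<eta> x" "y \<in> U"
  shows "real (topple H x \<eta> y) = real (\<eta> y) - lap a d x y"
  using assms no_loop[OF assms(1)]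
  by (auto simp: topple_eq lap_def of_nat_diff)

text \<open>The expected exit time \<open>g\<close> of the random walk: toppling lowers \<open>\<Sum>y. \<eta> y * g y\<close> by \<open>1\<close>.\<close>
lemma exit_time:
  obtains g where "\<And>x. x \<in> U \<Longrightarrow> 0 \<le> g x" "\<And>x. x \<in> U \<Longrightarrow> (\<Sum>y\<in>U. lap a d x y * g y) = 1"
proof -
  obtain g where g: "\<And>x. x \<in> U \<Longrightarrow> (\<Sum>y\<in>U. lap a d x y * g y) = 1"
    using det_on_solvable[OF finite_U det_lap_nonzero, of "\<lambda>_. 1"] by blast
  have "0 \<le> g x" if x: "x \<in> U" for x
  proof -
    \<comment> \<open>Minimum principle: at a minimizer \<open>z\<close> with negative value the
      Laplacian of \<open>g\<close> would be at most \<open>0\<close>, whereas it equals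
      \<open>1\<close>.\<close>
    let ?m = "Min (g ` U)"
    have "?m \<in> g ` U" using finite_U x by (intro Min_in) auto
    then obtain z where z: "z \<in> U" "g z = ?m" by auto
    have le: "g z \<le> g y" if "y \<in> U" for y using that z finite_U by simp
    have "0 \<le> g z"
    proof (rule ccontr)
      assume neg: "\<not> 0 \<le> g z"
      have "1 = (\<Sum>y\<in>U. of_bool (z = y) * real (d z) * g y - real (a z y) * g y)"
        using g[OF z(1)] by (simp add: lap_def left_diff_distrib)
      also have "\<dots> = real (d z) * g z - (\<Sum>y\<in>U. real (a z y) * g y)"
        using z(1) finite_U by (simp add: sum_subtractf of_bool_def if_distrib[of "\<lambda>t. t * _"] sum.delta' cong: if_cong)
      also have "\<dots> \<le> real (d z) * g z - (\<Sum>y\<in>U. real (a z y) * g z)"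
        using le by (intro diff_left_mono sum_mono mult_left_mono) auto
      also have "\<dots> = real (d z - sum (a z) U) * g z"
        using sum_le_degree[OF z(1)] by (simp add: sum_distrib_right left_diff_distrib of_nat_diff)
      also have "\<dots> \<le> 0" using neg by (simp add: mult_nonneg_nonpos)
      finally show False by simp
    qed
    then show ?thesis using le[OF x] by simp
  qed
  then show thesis using g that by blast
qed

lemma legal_topple_Z: "legal_topple H \<eta> \<eta>' \<Longrightarrow> \<eta> \<in> Z \<Longrightarrow> \<eta>' \<in> Z"
  by (auto simp: legal_topple_def topple_def Z_def simp flip: U_def)

lemma legal_topples_Z: "(legal_topple H)\<^sup>*\<^sup>* \<eta> \<eta>' \<Longrightarrow> \<eta> \<in> Z \<Longrightarrow> \<eta>' \<in> Z"
  by (induction rule: rtranclp_induct) (auto intro: legal_topple_Z)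

lemma stabilizes:
  assumes "\<eta> \<in> Z"
  shows "\<exists>\<zeta>. (legal_topple H)\<^sup>*\<^sup>* \<eta> \<zeta> \<and> \<zeta> \<in> S"
proof -
  obtain g where g: "\<And>x. x \<in> U \<Longrightarrow> 0 \<le> g x" "\<And>x. x \<in> U \<Longrightarrow> (\<Sum>y\<in>U. lap a d x y * g y) = 1"
    using exit_time by blast
  define \<Phi> where "\<Phi> \<eta> = (\<Sum>y\<in>U. real (\<eta> y) * g y)" for \<eta> :: "'v \<Rightarrow> nat"
  have \<Phi>_nonneg: "0 \<le> \<Phi> \<eta>" for \<eta>
    unfolding \<Phi>_def using g(1) by (intro sum_nonneg mult_nonneg_nonneg) auto
  have \<Phi>_topple: "\<Phi> (topple H x \<eta>) = \<Phi> \<eta> - 1" if "x \<in> U" "d x \<le> \<eta> x" for x \<eta>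
  proof -
    have "\<Phi> (topple H x \<eta>) = (\<Sum>y\<in>U. (real (\<eta> y) - lap a d x y) * g y)"
      unfolding \<Phi>_def using topple_eq_lap[where \<eta> = \<eta>, OF that] by (intro sum.cong) auto
    then show ?thesis using g(2)[OF that(1)] by (simp add: \<Phi>_def left_diff_distrib sum_subtractf)
  qed
  from assms show ?thesis
  proof (induction "nat \<lfloor>\<Phi> \<eta>\<rfloor>" arbitrary: \<eta> rule: less_induct)
    case less
    show ?case
    proof (cases "\<eta> \<in> S")
      case True
      then show ?thesis by blast
    next
      case False
      then obtain x where x: "x \<in> U" "d x \<le> \<eta> x"
        using less.prems unfolding S_eq stable_configs_def Z_def by (auto simp: not_less)
      then have topple: "legal_topple H \<eta> (topple H x \<eta>)" by (rule legal_toppleI)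
      have "1 \<le> \<Phi> \<eta>" using \<Phi>_topple[where \<eta> = \<eta>, OF x] \<Phi>_nonneg[of "topple H x \<eta>"] by simp
      then have "nat \<lfloor>\<Phi> (topple H x \<eta>)\<rfloor> < nat \<lfloor>\<Phi> \<eta>\<rfloor>"
        unfolding \<Phi>_topple[where \<eta> = \<eta>, OF x] by linarith
      then obtain \<zeta> where "(legal_topple H)\<^sup>*\<^sup>* (topple H x \<eta>) \<zeta>" "\<zeta> \<in> S"
        using less.hyps[of "topple H x \<eta>"] legal_topple_Z[OF topple less.prems] by blast
      then show ?thesis using topple by (meson converse_rtranclp_into_rtranclp)
    qed
  qed
qed

text \<open>A toppling at \<open>x\<close> only adds grains elsewhere, so it leaves a toppling at
  \<open>y \<noteq> x\<close> legal, and the two commute.\<close>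

lemma legal_topple_confluent: "confluentp (legal_topple H)"
proof (rule strong_confluentp_imp_confluentp, rule strong_confluentpI)
  fix \<eta> \<eta>1 \<eta>2 assume "legal_topple H \<eta> \<eta>1" "legal_topple H \<eta> \<eta>2"
  then obtain x y where x: "x \<in> U" "d x \<le> \<eta> x" "\<eta>1 = topple H x \<eta>"
    and y: "y \<in> U" "d y \<le> \<eta> y" "\<eta>2 = topple H y \<eta>"
    unfolding legal_topple_def U_def d_def by blast
  show "\<exists>\<zeta>. (legal_topple H)\<^sup>*\<^sup>* \<eta>1 \<zeta> \<and> (legal_topple H)\<^sup>=\<^sup>= \<eta>2 \<zeta>"
  proof (cases "x = y")
    case True
    then show ?thesis using x y by blast
  next
    case False
    have "d y \<le> \<eta>1 y" "d x \<le> \<eta>2 x"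
      using x y False by (auto simp: topple_eq)
    then have "legal_topple H \<eta>1 (topple H y \<eta>1)" "legal_topple H \<eta>2 (topple H x \<eta>2)"
      using x(1) y(1) by (auto intro: legal_toppleI)
    moreover have "topple H y \<eta>1 = topple H x \<eta>2"
      using x y False by (auto simp: topple_eq fun_eq_iff)
    ultimately show ?thesis by (metis r_into_rtranclp sup2I1)
  qed
qed

lemma stable_final:
  assumes "\<zeta> \<in> S" "(legal_topple H)\<^sup>*\<^sup>* \<zeta> \<zeta>'"
  shows "\<zeta>' = \<zeta>"
  using assms(2)
proof (cases rule: converse_rtranclpE)
  case (step \<xi>)
  then show ?thesis
    using assms(1) unfolding legal_topple_def S_eq stable_configs_def U_def d_def
    by (auto simp: not_less[symmetric])
qed simp

lemma stabilize_eqI: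
  assumes "(legal_topple H)\<^sup>*\<^sup>* \<eta> \<zeta>" "\<zeta> \<in> S"
  shows "stabilize H \<eta> = \<zeta>"
  unfolding stabilize_def
proof (rule the_equality)
  fix \<zeta>' assume \<zeta>': "(legal_topple H)\<^sup>*\<^sup>* \<eta> \<zeta>' \<and> \<zeta>' \<in> stable_sandpiles H"
  then obtain \<xi> where "(legal_topple H)\<^sup>*\<^sup>* \<zeta> \<xi>" "(legal_topple H)\<^sup>*\<^sup>* \<zeta>' \<xi>"
    using confluentpD[OF legal_topple_confluent assms(1)] by blast
  then show "\<zeta>' = \<zeta>" using stable_final assms(2) \<zeta>' unfolding S_def by metis
qed (use assms in \<open>simp add: S_def\<close>)

lemma stabilize:
  assumes "\<eta> \<in> Z"
  shows "(legal_topple H)\<^sup>*\<^sup>* \<eta> (stabilize H \<eta>)" "stabilize H \<eta> \<in> S"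
  using stabilizes[OF assms] stabilize_eqI by metis+

lemma stabilize_stable: "\<eta> \<in> S \<Longrightarrow> stabilize H \<eta> = \<eta>"
  by (rule stabilize_eqI) auto

lemma stabilize_topples:
  assumes "(legal_topple H)\<^sup>*\<^sup>* \<eta> \<eta>'" "\<eta> \<in> Z"
  shows "stabilize H \<eta> = stabilize H \<eta>'"
  using stabilize[OF legal_topples_Z[OF assms]] assms(1)
  by (intro stabilize_eqI) (auto intro: rtranclp_trans)

section \<open>Addition operators and their action on burnable configurations\<close>

lemma legal_topple_add:
  assumes "legal_topple H \<eta> \<eta>'"
  shows "legal_topple H (\<lambda>x. \<eta> x + \<sigma> x) (\<lambda>x. \<eta>' x + \<sigma> x)"
proof -
  obtain x where x: "x \<in> nonsink H" "degree_of H (Some x) \<le> \<eta> x" "\<eta>' = topple H x \<eta>"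
    using assms unfolding legal_topple_def by blast
  then have "(\<lambda>x. \<eta>' x + \<sigma> x) = topple H x (\<lambda>x. \<eta> x + \<sigma> x)"
    by (auto simp: topple_def fun_eq_iff)
  then show ?thesis
    using x unfolding legal_topple_def by (intro bexI[of _ x]) auto
qed

lemma legal_topples_add:
  "(legal_topple H)\<^sup>*\<^sup>* \<eta> \<eta>' \<Longrightarrow> (legal_topple H)\<^sup>*\<^sup>* (\<lambda>x. \<eta> x + \<sigma> x) (\<lambda>x. \<eta>' x + \<sigma> x)"
  by (induction rule: rtranclp_induct) (auto intro: legal_topple_add rtranclp.rtrancl_into_rtrancl)

definition add_conf :: "('v \<Rightarrow> nat) \<Rightarrow> ('v \<Rightarrow> nat) \<Rightarrow> 'v \<Rightarrow> nat" where
  "add_conf \<sigma> \<eta> = stabilize H (\<lambda>x. \<eta> x + \<sigma> x)"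

abbreviation single :: "'v \<Rightarrow> 'v \<Rightarrow> nat" where
  "single x \<equiv> (\<lambda>y. if y = x then 1 else 0)"

abbreviation add :: "'v \<Rightarrow> ('v \<Rightarrow> nat) \<Rightarrow> 'v \<Rightarrow> nat" where
  "add \<equiv> add_particle H"

lemma add_eq: "add x = add_conf (single x)"
  unfolding add_particle_def add_conf_def
  by (intro ext arg_cong[where f = "stabilize H"]) auto

lemma single_Z: "x \<in> U \<Longrightarrow> single x \<in> Z"
  by (auto simp: Z_def)

lemma plus_Z: "\<eta> \<in> Z \<Longrightarrow> \<sigma> \<in> Z \<Longrightarrow> (\<lambda>x. \<eta> x + \<sigma> x) \<in> Z"
  by (simp add: Z_def)

lemma add_conf_S: "\<eta> \<in> Z \<Longrightarrow> \<sigma> \<in> Z \<Longrightarrow> add_conf \<sigma> \<eta> \<in> S"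
  unfolding add_conf_def by (intro stabilize plus_Z)

text \<open>Extra grains keep legal topplings legal, so the intermediate stabilization is part of a
  toppling sequence for the total. In particular all additions commute.\<close>

lemma add_conf_plus:
  assumes "\<eta> \<in> Z" "\<sigma> \<in> Z" "\<tau> \<in> Z"
  shows "add_conf \<sigma> (add_conf \<tau> \<eta>) = add_conf (\<lambda>x. \<tau> x + \<sigma> x) \<eta>"
proof -
  have "stabilize H (\<lambda>x. (\<eta> x + \<tau> x) + \<sigma> x) = stabilize H (\<lambda>x. stabilize H (\<lambda>x. \<eta> x + \<tau> x) x + \<sigma> x)"
    using assms by (intro stabilize_topples legal_topples_add stabilize plus_Z)
  then show ?thesis by (simp add: add_conf_def add.assoc)
qed

lemma add_S: "\<eta> \<in> S \<Longrightarrow> x \<in> U \<Longrightarrow> add x \<eta> \<in> S"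
  unfolding add_eq using S_subset_Z by (intro add_conf_S single_Z) auto

text \<open>The grains that \<open>y \<noteq> x\<close> receives pay exactly for its edges to
  \<open>x\<close>, so a vertex found for \<open>F - {x}\<close> before the toppling also works for
  \<open>F\<close> after it. For \<open>F = {x}\<close> the absence of loops suffices.\<close>

lemma burnable_topple:
  assumes b: "burnable U a \<eta>" and x: "x \<in> U" "d x \<le> \<eta> x"
  shows "burnable U a (topple H x \<eta>)"
  unfolding burnable_def
proof (intro allI impI)
  fix F assume F: "F \<subseteq> U" "F \<noteq> {}"
  have finF: "finite F" using F finite_U finite_subset by blast
  show "\<exists>y\<in>F. sum (a y) F \<le> topple H x \<eta> y"
  proof (cases "F = {x}")
    case True
    then show ?thesis using no_loop[OF x(1)] by simp
  next
    case False
    then have "F - {x} \<noteq> {}" "F - {x} \<subseteq> U" using F by auto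
    then obtain y where y: "y \<in> F - {x}" "sum (a y) (F - {x}) \<le> \<eta> y"
      using b by (metis burnableD)
    have "sum (a y) F \<le> sum (a y) (F - {x}) + a y x"
      using finF by (cases "x \<in> F") (simp_all add: sum.remove)
    also have "\<dots> \<le> \<eta> y + a x y" using y(2) a_sym[of y x] by simp
    also have "\<dots> = topple H x \<eta> y" using y F by (auto simp: topple_eq)
    finally show ?thesis using y(1) by blast
  qed
qed

lemma burnable_topples:
  assumes "(legal_topple H)\<^sup>*\<^sup>* \<eta> \<eta>'" "burnable U a \<eta>"
  shows "burnable U a \<eta>'"
  using assms
  by (induction rule: rtranclp_induct) (auto simp: legal_topple_def U_def d_def intro: burnable_topple[unfolded U_def d_def])

lemma burnable_mono:
  assumes "burnable U a \<eta>" "\<And>x. \<eta> x \<le> \<zeta> x"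
  shows "burnable U a \<zeta>"
  using assms unfolding burnable_def by (meson le_trans)

lemma add_conf_R:
  assumes "\<eta> \<in> R" "\<sigma> \<in> Z"
  shows "add_conf \<sigma> \<eta> \<in> R"
proof -
  have \<eta>: "\<eta> \<in> Z" "burnable U a \<eta>"
    using assms R_subset_S S_subset_Z by (auto simp: R_def burnable_configs_def)
  have "burnable U a (\<lambda>x. \<eta> x + \<sigma> x)" using \<eta>(2) by (rule burnable_mono) simp
  then have "burnable U a (add_conf \<sigma> \<eta>)"
    unfolding add_conf_def using \<eta>(1) assms(2) by (intro burnable_topples[OF stabilize(1)] plus_Z)
  then show ?thesis
    using add_conf_S[OF \<eta>(1) assms(2)] by (simp add: R_def S_eq burnable_configs_def)
qed

lemma add_R: "\<eta> \<in> R \<Longrightarrow> x \<in> U \<Longrightarrow> add x \<eta> \<in> R"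
  unfolding add_eq by (intro add_conf_R single_Z)

lemma R_subset_Z: "R \<subseteq> Z"
  using R_subset_S S_subset_Z by blast

text \<open>Dhar's burning test: after firing the sink every vertex topples exactly once.\<close>
lemma add_conf_sink:
  assumes "\<eta> \<in> R"
  shows "add_conf (\<lambda>x. if x \<in> U then d x - sum (a x) U else 0) \<eta> = \<eta>"
proof -
  let ?s = "\<lambda>x. if x \<in> U then d x - sum (a x) U else 0"
  \<comment> \<open>\<open>burnt B\<close> is the state after the sink has fired and exactly the
    vertices of \<open>B\<close> have toppled, once each. The truncated subtraction is exact by the
    last conjunct of the induction claim below.\<close>
  define burnt where
    "burnt B x = (if x \<in> B then \<eta> x + ?s x + sum (a x) B - d x else if x \<in> U then \<eta> x + ?s x + sum (a x) B else 0)" for B x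
  have \<eta>: "\<eta> \<in> Z" "burnable U a \<eta>" "\<eta> \<in> S"
    using assms R_subset_S S_subset_Z by (auto simp: R_def burnable_configs_def)
  have "\<exists>B. (legal_topple H)\<^sup>*\<^sup>* (burnt {}) (burnt B) \<and> B \<subseteq> U \<and> card B = n \<and>
      (\<forall>x\<in>B. d x \<le> \<eta> x + ?s x + sum (a x) B)" if "n \<le> card U" for n
    using that
  proof (induction n)
    case 0
    show ?case by (intro exI[of _ "{}"]) auto
  next
    case (Suc n)
    then obtain B where B: "(legal_topple H)\<^sup>*\<^sup>* (burnt {}) (burnt B)" "B \<subseteq> U" "card B = n"
      "\<And>x. x \<in> B \<Longrightarrow> d x \<le> \<eta> x + ?s x + sum (a x) B" by auto
    have finB: "finite B" using B(2) finite_U finite_subset by blast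
    have "U - B \<noteq> {}" using B Suc.prems finite_U by auto
    then obtain x where x: "x \<in> U - B" "sum (a x) (U - B) \<le> \<eta> x"
      using \<eta>(2) by (metis Diff_subset burnableD)
    \<comment> \<open>As \<open>d x\<close> is the sum of \<open>?s x\<close> and
      \<open>sum (a x) U\<close>, the burning inequality for the unburnt set \<open>U - B\<close>
      becomes the toppling condition for \<open>x\<close> in \<open>burnt B\<close>.\<close>
    have "sum (a x) U = sum (a x) (U - B) + sum (a x) B"
      using B(2) finite_U by (simp add: sum.subset_diff)
    then have dx: "d x \<le> burnt B x"
      using x sum_le_degree[of x] by (simp add: burnt_def)
    have "topple H x (burnt B) = burnt (insert x B)"
    proof
      fix y
      have sum_ins: "sum (a y) (insert x B) = a x y + sum (a y) B"
        using x finB a_sym[of y x] by simp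
      have xx: "sum (a x) (insert x B) = sum (a x) B"
        using x finB no_loop[of x] by simp
      consider "y = x" | "y \<in> B" "y \<noteq> x" | "y \<notin> B" "y \<in> U" "y \<noteq> x" | "y \<notin> U" "y \<noteq> x" by blast
      then show "topple H x (burnt B) y = burnt (insert x B) y"
      proof cases
        case 1
        then show ?thesis using x xx by (simp add: topple_eq burnt_def)
      next
        case 2
        have "y \<in> U" using 2 B(2) by blast
        then show ?thesis using 2 B(4)[of y] sum_ins by (simp add: topple_eq burnt_def)
      next
        case 3
        then show ?thesis using sum_ins by (simp add: topple_eq burnt_def)
      next
        case 4
        then have "y \<notin> B" using B(2) by blast
        then show ?thesis using 4 by (simp add: topple_eq burnt_def)
      qed
    qed
    then have "legal_topple H (burnt B) (burnt (insert x B))"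
      using x dx legal_toppleI[of x "burnt B"] by simp
    then have "(legal_topple H)\<^sup>*\<^sup>* (burnt {}) (burnt (insert x B))"
      using B(1) by (rule rtranclp.rtrancl_into_rtrancl[rotated])
    moreover have "d y \<le> \<eta> y + ?s y + sum (a y) (insert x B)" if y: "y \<in> insert x B" for y
    proof (cases "y = x")
      case True
      have "sum (a x) (insert x B) = sum (a x) B" using x finB no_loop[of x] by simp
      then show ?thesis using dx x True by (simp add: burnt_def)
    next
      case False
      then have "d y \<le> \<eta> y + ?s y + sum (a y) B" using B(4) y by blast
      also have "sum (a y) B \<le> sum (a y) (insert x B)" using finB by (intro sum_mono2) auto
      finally show ?thesis by simp
    qed
    moreover have "insert x B \<subseteq> U" "card (insert x B) = Suc n" using x B finB by auto
    ultimately show ?case by (intro exI[of _ "insert x B"]) auto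
  qed
  from this[of "card U"] obtain B where B: "(legal_topple H)\<^sup>*\<^sup>* (burnt {}) (burnt B)" "B \<subseteq> U" "card B = card U"
    by auto
  then have "B = U" using finite_U card_subset_eq by blast
  have "burnt U = \<eta>"
  proof
    fix x show "burnt U x = \<eta> x"
      using \<eta>(1) sum_le_degree[of x] by (auto simp: burnt_def Z_def)
  qed
  moreover have "burnt {} = (\<lambda>x. \<eta> x + ?s x)"
    using \<eta>(1) by (auto simp: burnt_def Z_def fun_eq_iff)
  ultimately show ?thesis
    unfolding add_conf_def using B(1) \<open>B = U\<close> \<eta>(3) by (intro stabilize_eqI) auto
qed

text \<open>\<open>add x\<close> is the map applied first when \<open>add_conf \<sigma>\<close> is
  split into two additions, and the first map of an injective composition is injective.\<close>

lemma inj_on_factor: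
  assumes "inj_on (add_conf \<sigma>) R" "\<sigma> \<in> Z" "x \<in> U" "0 < \<sigma> x"
  shows "inj_on (add x) R"
proof -
  let ?\<tau> = "\<sigma>(x := \<sigma> x - 1)"
  have \<tau>: "?\<tau> \<in> Z" using assms by (auto simp: Z_def)
  have "add_conf \<sigma> \<eta> = add_conf ?\<tau> (add x \<eta>)" if "\<eta> \<in> R" for \<eta>
  proof -
    have "add_conf ?\<tau> (add x \<eta>) = add_conf (\<lambda>y. single x y + ?\<tau> y) \<eta>"
      unfolding add_eq using that \<tau> R_subset_Z assms by (intro add_conf_plus single_Z) auto
    also have "(\<lambda>y. single x y + ?\<tau> y) = \<sigma>" using assms(4) by (auto simp: fun_eq_iff)
    finally show ?thesis by (rule sym)
  qed
  then show ?thesis using assms(1) unfolding inj_on_def by metis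
qed

lemma add_conf_multiple:
  assumes "inj_on (add x) R" "x \<in> U"
  shows "inj_on (add_conf (\<lambda>y. if y = x then n else 0)) R"
proof (induction n)
  case 0
  have "add_conf (\<lambda>y. if y = x then 0 else 0) \<eta> = \<eta>" if "\<eta> \<in> R" for \<eta>
    using that R_subset_S by (auto simp: add_conf_def intro: stabilize_stable)
  then show ?case by (auto simp: inj_on_def)
next
  case (Suc n)
  have "add_conf (\<lambda>y. if y = x then Suc n else 0) \<eta> = add_conf (\<lambda>y. if y = x then n else 0) (add x \<eta>)"
    if "\<eta> \<in> R" for \<eta>
  proof -
    have "add_conf (\<lambda>y. if y = x then n else 0) (add x \<eta>)
        = add_conf (\<lambda>y. single x y + (if y = x then n else 0)) \<eta>"
      unfolding add_eq using that R_subset_Z assms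
      by (intro add_conf_plus single_Z) (auto simp: Z_def)
    also have "(\<lambda>y. single x y + (if y = x then n else 0)) = (\<lambda>y. if y = x then Suc n else 0)"
      by auto
    finally show ?thesis by (rule sym)
  qed
  note Suc_eq = this
  show ?case
  proof (rule inj_onI)
    fix \<eta> \<zeta> assume \<eta>: "\<eta> \<in> R" and \<zeta>: "\<zeta> \<in> R"
      and "add_conf (\<lambda>y. if y = x then Suc n else 0) \<eta> = add_conf (\<lambda>y. if y = x then Suc n else 0) \<zeta>"
    then have "add_conf (\<lambda>y. if y = x then n else 0) (add x \<eta>) = add_conf (\<lambda>y. if y = x then n else 0) (add x \<zeta>)"
      by (simp only: Suc_eq[OF \<eta>] Suc_eq[OF \<zeta>])
    then have "add x \<eta> = add x \<zeta>"
      using add_R[OF \<eta> assms(2)] add_R[OF \<zeta> assms(2)] by (rule inj_onD[OF Suc])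
    then show "\<eta> = \<zeta>" using \<eta> \<zeta> by (rule inj_onD[OF assms(1)])
  qed
qed

text \<open>The defining relation of the sandpile group at \<open>x\<close>: \<open>d x\<close>
  grains at \<open>x\<close> are worth one grain along each edge at \<open>x\<close>.\<close>

lemma add_conf_topple:
  assumes "\<eta> \<in> Z" "x \<in> U"
  shows "add_conf (\<lambda>y. if y = x then d x else 0) \<eta> = add_conf (\<lambda>y. if y \<in> U then a x y else 0) \<eta>"
  unfolding add_conf_def
proof (rule stabilize_topples)
  let ?\<eta> = "\<lambda>y. \<eta> y + (if y = x then d x else 0)"
  have "topple H x ?\<eta> = (\<lambda>y. \<eta> y + (if y \<in> U then a x y else 0))"
    using assms no_loop[OF assms(2)] by (auto simp: topple_eq fun_eq_iff)
  moreover have "legal_topple H ?\<eta> (topple H x ?\<eta>)" using assms(2) by (intro legal_toppleI) simp_all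
  ultimately have "legal_topple H ?\<eta> (\<lambda>y. \<eta> y + (if y \<in> U then a x y else 0))" by (simp only:)
  then show "(legal_topple H)\<^sup>*\<^sup>* ?\<eta> (\<lambda>y. \<eta> y + (if y \<in> U then a x y else 0))" by blast
  show "?\<eta> \<in> Z" using assms by (auto simp: Z_def)
qed

text \<open>Injectivity spreads inwards from the sink. For neighbours of the sink it comes from
  \<open>add_conf_sink\<close>, an identity involving \<open>add y\<close>. If it holds at a
  neighbour \<open>z\<close> of \<open>y\<close>, adding \<open>d z\<close> grains at
  \<open>z\<close> is injective, and by the relation at \<open>z\<close> this addition contains
  \<open>add y\<close>. By \<open>leaving\<close>, the set of failures has no vertex to start
  from.\<close>

lemma inj_on_add:
  assumes "x \<in> U"
  shows "inj_on (add x) R"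
proof (rule ccontr)
  let ?F = "{x \<in> U. \<not> inj_on (add x) R}"
  assume "\<not> inj_on (add x) R"
  then have "?F \<subseteq> U" "?F \<noteq> {}" using assms by auto
  then obtain y where y: "y \<in> ?F" "sum (a y) ?F < d y" using leaving by blast
  then have yU: "y \<in> U" by simp
  have "inj_on (add y) R"
  proof (cases "sum (a y) U < d y")
    case True
    let ?s = "\<lambda>x. if x \<in> U then d x - sum (a x) U else 0"
    show ?thesis
    proof (rule inj_on_factor[where \<sigma> = ?s])
      show "inj_on (add_conf ?s) R" using add_conf_sink by (auto simp: inj_on_def)
    qed (use True yU in \<open>auto simp: Z_def\<close>)
  next
    case False
    then have "sum (a y) ?F < sum (a y) U" using y(2) sum_le_degree[OF yU] by simp
    moreover have "sum (a y) ?F = sum (a y) U" if "\<forall>z\<in>U - ?F. a y z = 0"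
      using finite_U _ that by (rule sum.mono_neutral_left) blast
    ultimately have "\<exists>z\<in>U - ?F. a y z \<noteq> 0" by fastforce
    then obtain z where z: "z \<in> U" "inj_on (add z) R" "0 < a z y"
      using a_sym[of y] by auto
    let ?\<sigma> = "\<lambda>y. if y \<in> U then a z y else 0"
    show ?thesis
    proof (rule inj_on_factor[where \<sigma> = ?\<sigma>])
      have "inj_on (add_conf (\<lambda>y. if y = z then d z else 0)) R"
        using z by (intro add_conf_multiple)
      moreover have "inj_on (add_conf (\<lambda>y. if y = z then d z else 0)) R \<longleftrightarrow> inj_on (add_conf ?\<sigma>) R"
        using R_subset_Z z(1) by (intro inj_on_cong add_conf_topple) auto
      ultimately show "inj_on (add_conf ?\<sigma>) R" by simp
    qed (use z yU in \<open>auto simp: Z_def\<close>)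
  qed
  then show False using y by simp
qed

lemma bij_betw_add: "x \<in> U \<Longrightarrow> bij_betw (add x) R R"
  using inj_on_add add_R finite_R
  by (intro bij_betw_imageI endo_inj_surj) auto

lemma fold_add_R: "set l \<subseteq> U \<Longrightarrow> \<eta> \<in> R \<Longrightarrow> fold add l \<eta> \<in> R"
  by (induction l arbitrary: \<eta>) (auto intro: add_R)

section \<open>Reachability by adding grains one at a time\<close>

lemma add_conf_fold:
  assumes "\<eta> \<in> S" "\<sigma> \<in> Z"
  shows "\<exists>l. set l \<subseteq> U \<and> fold add l \<eta> = add_conf \<sigma> \<eta>"
  using assms
proof (induction "sum \<sigma> U" arbitrary: \<sigma> \<eta>)
  case 0
  then have "\<sigma> = (\<lambda>_. 0)" using finite_U by (auto simp: Z_def)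
  then show ?case
    using stabilize_stable[OF 0(2)] by (intro exI[of _ "[]"]) (simp add: add_conf_def)
next
  case (Suc n)
  then have "sum \<sigma> U \<noteq> 0" by simp
  then obtain x where x: "x \<in> U" "0 < \<sigma> x" using finite_U by auto
  let ?\<tau> = "\<sigma>(x := \<sigma> x - 1)"
  have \<tau>: "?\<tau> \<in> Z" using Suc.prems by (auto simp: Z_def)
  have "sum \<sigma> U = \<sigma> x + sum \<sigma> (U - {x})" using finite_U x(1) by (rule sum.remove)
  moreover have "sum ?\<tau> U = \<sigma> x - 1 + sum \<sigma> (U - {x})"
    by (subst sum.remove[OF finite_U x(1)]) (auto intro: sum.cong)
  ultimately have "n = sum ?\<tau> U" using Suc.hyps(2) x(2) by simp
  from Suc.hyps(1)[OF this add_S[OF Suc.prems(1) x(1)] \<tau>]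
  obtain l where l: "set l \<subseteq> U" "fold add l (add x \<eta>) = add_conf ?\<tau> (add x \<eta>)" by blast
  note l(2)
  also have "add_conf ?\<tau> (add x \<eta>) = add_conf (\<lambda>y. single x y + ?\<tau> y) \<eta>"
    unfolding add_eq using Suc.prems S_subset_Z \<tau> x(1) by (intro add_conf_plus single_Z) auto
  also have "(\<lambda>y. single x y + ?\<tau> y) = \<sigma>" using x by (auto simp: fun_eq_iff)
  finally show ?case using l(1) x(1) by (intro exI[of _ "x # l"]) simp
qed

lemma reach_max:
  assumes "\<eta> \<in> S"
  obtains l where "set l \<subseteq> U" "fold add l \<eta> = max_config"
proof -
  let ?\<sigma> = "\<lambda>x. max_config x - \<eta> x"
  have "add_conf ?\<sigma> \<eta> = stabilize H max_config"
    unfolding add_conf_def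
    by (rule arg_cong[where f = "stabilize H"])
       (use assms in \<open>auto simp: S_eq stable_configs_def max_config_def fun_eq_iff\<close>)
  also have "\<dots> = max_config" using max_config_R R_subset_S by (intro stabilize_stable) blast
  finally show thesis
    using add_conf_fold[OF assms, of ?\<sigma>] that by (auto simp: Z_def max_config_def)
qed

text \<open>\<open>T\<close> is what can be reached from \<open>max_config\<close>. Each
  \<open>add x\<close> is injective on \<open>R\<close> and maps the finite set \<open>T\<close>
  into itself, hence permutes it, so \<open>T\<close> is also closed under preimages in
  \<open>R\<close>. Every element of \<open>R\<close> leads to \<open>max_config\<close> and
  therefore lies in \<open>T\<close>.\<close>

lemma reach_R:
  assumes "\<eta> \<in> S" "\<zeta> \<in> R"
  obtains l where "set l \<subseteq> U" "fold add l \<eta> = \<zeta>"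
proof -
  define T where "T = {fold add l max_config |l. set l \<subseteq> U}"
  have TR: "T \<subseteq> R" unfolding T_def using fold_add_R max_config_R by blast
  have T_add: "add x \<xi> \<in> T" if "\<xi> \<in> T" "x \<in> U" for x \<xi>
  proof -
    obtain l where "set l \<subseteq> U" "\<xi> = fold add l max_config" using \<open>\<xi> \<in> T\<close> unfolding T_def by blast
    then show ?thesis unfolding T_def using that(2) by (auto intro!: exI[of _ "l @ [x]"])
  qed
  have T_back: "\<xi> \<in> T" if \<xi>: "\<xi> \<in> R" "x \<in> U" "add x \<xi> \<in> T" for x \<xi>
  proof -
    have "finite T" using TR finite_R by (rule finite_subset)
    moreover have "inj_on (add x) T" using inj_on_add[OF \<xi>(2)] TR by (rule inj_on_subset)
    moreover have "add x ` T \<subseteq> T" using T_add \<xi>(2) by blast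
    ultimately have "add x ` T = T" by (intro endo_inj_surj)
    then have "add x \<xi> \<in> add x ` T" using \<xi>(3) by simp
    then obtain \<xi>' where \<xi>': "\<xi>' \<in> T" "add x \<xi> = add x \<xi>'" by blast
    then have "\<xi> = \<xi>'" using inj_onD[OF inj_on_add[OF \<xi>(2)] \<xi>'(2) \<xi>(1)] TR by blast
    then show ?thesis using \<xi>'(1) by simp
  qed
  have "\<xi> \<in> T" if "set l \<subseteq> U" "\<xi> \<in> R" "fold add l \<xi> \<in> T" for l \<xi>
    using that
  proof (induction l arbitrary: \<xi>)
    case (Cons x l)
    then have "x \<in> U" "set l \<subseteq> U" "fold add l (add x \<xi>) \<in> T" by simp_all
    then have "add x \<xi> \<in> T" using Cons.IH add_R Cons.prems(2) by blast
    then show ?case using T_back Cons.prems(2) \<open>x \<in> U\<close> by blast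
  qed simp
  moreover obtain k where "set k \<subseteq> U" "fold add k \<zeta> = max_config"
    using assms(2) R_subset_S by (blast intro: reach_max)
  moreover have "max_config \<in> T" unfolding T_def by (auto intro!: exI[of _ "[]"])
  ultimately have "\<zeta> \<in> T" using assms(2) by metis
  then obtain l where "set l \<subseteq> U" "fold add l max_config = \<zeta>" unfolding T_def by blast
  moreover obtain k where "set k \<subseteq> U" "fold add k \<eta> = max_config" using assms(1) by (rule reach_max)
  ultimately show thesis using that[of "k @ l"] by simp
qed

section \<open>The stationary distribution\<close>

lemma sandpile_kernel_eq: "sandpile_kernel H \<eta> = map_pmf (\<lambda>x. add x \<eta>) (pmf_of_set U)"
  unfolding sandpile_kernel_def U_def ..

lemma bind_sandpile_kernel:
  "bind_pmf p (sandpile_kernel H) = bind_pmf (pmf_of_set U) (\<lambda>x. map_pmf (add x) p)"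
proof -
  have "bind_pmf p (sandpile_kernel H)
      = bind_pmf p (\<lambda>\<eta>. bind_pmf (pmf_of_set U) (\<lambda>x. return_pmf (add x \<eta>)))"
    by (rule bind_pmf_cong[OF refl]) (simp add: sandpile_kernel_eq map_pmf_def)
  also have "\<dots> = bind_pmf (pmf_of_set U) (\<lambda>x. bind_pmf p (\<lambda>\<eta>. return_pmf (add x \<eta>)))"
    by (rule bind_commute_pmf)
  finally show ?thesis by (simp add: map_pmf_def)
qed

lemma stationary_uniform: "stationary H (pmf_of_set R)"
proof -
  have "map_pmf (add x) (pmf_of_set R) = pmf_of_set R" if "x \<in> U" for x
    using bij_betw_add[OF that] finite_R R_nonempty
    by (intro map_pmf_of_set_bij_betw) auto
  then have "bind_pmf (pmf_of_set U) (\<lambda>x. map_pmf (add x) (pmf_of_set R))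
      = bind_pmf (pmf_of_set U) (\<lambda>_. pmf_of_set R)"
    using finite_U U_nonempty by (intro bind_pmf_cong) auto
  then show ?thesis
    using R_subset_S R_nonempty finite_R
    by (simp add: stationary_def bind_sandpile_kernel S_def)
qed

context
  fixes p assumes p: "stationary H p"
begin

lemma stationary_S: "set_pmf p \<subseteq> S"
  using p by (simp add: stationary_def S_def)

lemma stationary_eq: "bind_pmf (pmf_of_set U) (\<lambda>x. map_pmf (add x) p) = p"
  using p by (simp add: stationary_def bind_sandpile_kernel)

lemma stationary_prob: "measure_pmf.prob p A = (\<Sum>x\<in>U. measure_pmf.prob p (add x -` A)) / card U"
proof -
  have "measure_pmf.prob q A = pmf (map_pmf (\<lambda>\<eta>. \<eta> \<in> A) q) True" for q :: "('v \<Rightarrow> nat) pmf"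
    by (simp add: pmf_map vimage_def)
  then have "measure_pmf.prob p A
      = pmf (map_pmf (\<lambda>\<eta>. \<eta> \<in> A) (bind_pmf (pmf_of_set U) (\<lambda>x. map_pmf (add x) p))) True"
    by (simp add: stationary_eq)
  also have "\<dots> = pmf (bind_pmf (pmf_of_set U) (\<lambda>x. map_pmf (\<lambda>\<eta>. add x \<eta> \<in> A) p)) True"
    by (simp add: map_bind_pmf pmf.map_comp o_def)
  also have "\<dots> = (\<Sum>x\<in>U. pmf (map_pmf (\<lambda>\<eta>. add x \<eta> \<in> A) p) True) / card U"
    using finite_U U_nonempty by (simp add: pmf_bind_pmf_of_set)
  finally show ?thesis by (simp add: pmf_map vimage_def)
qed

lemma stationary_pmf: "pmf p \<zeta> = (\<Sum>x\<in>U. measure_pmf.prob p (add x -` {\<zeta>})) / card U"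
  using stationary_prob[of "{\<zeta>}"] by (simp add: measure_pmf_single)

text \<open>Since additions preserve \<open>R\<close>, the preimage of \<open>R\<close> under each
  \<open>add x\<close> has at least the mass of \<open>R\<close>. By stationarity the average of
  these masses is the mass of \<open>R\<close>, so all are equal and no mass enters \<open>R\<close>
  from outside. A support point off \<open>R\<close> would enter it on its way to
  \<open>max_config\<close>.\<close>

lemma stationary_supp_R: "set_pmf p \<subseteq> R"
proof
  fix \<eta> assume \<eta>: "\<eta> \<in> set_pmf p"
  have le: "measure_pmf.prob p R \<le> measure_pmf.prob p (add x -` R)" if "x \<in> U" for x
    using add_R that by (intro measure_pmf.finite_measure_mono) auto
  have "(\<Sum>x\<in>U. measure_pmf.prob p (add x -` R)) = (\<Sum>x\<in>U. measure_pmf.prob p R)"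
    using stationary_prob[of R] finite_U U_nonempty by (simp add: field_simps card_gt_0_iff)
  note sums = this[symmetric]
  have eq: "measure_pmf.prob p R = measure_pmf.prob p (add x -` R)" if "x \<in> U" for x
    using sums le that finite_U by (rule sum_mono_inv)
  have pull_back: "\<zeta> \<in> R" if \<zeta>: "\<zeta> \<in> set_pmf p" "x \<in> U" "add x \<zeta> \<in> R" for x \<zeta>
  proof (rule ccontr)
    assume "\<zeta> \<notin> R"
    have "measure_pmf.prob p R + measure_pmf.prob p {\<zeta>} = measure_pmf.prob p (insert \<zeta> R)"
      using \<open>\<zeta> \<notin> R\<close> by (subst measure_pmf.finite_measure_Union[symmetric]) auto
    also have "\<dots> \<le> measure_pmf.prob p (add x -` R)"
      using add_R \<zeta> by (intro measure_pmf.finite_measure_mono) auto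
    also have "\<dots> = measure_pmf.prob p R" using eq[OF \<zeta>(2)] by (rule sym)
    finally have "pmf p \<zeta> \<le> 0" by (simp add: measure_pmf_single)
    then show False using \<zeta>(1) by (simp add: set_pmf_iff pmf_nonneg order.antisym)
  qed
  have step: "add x \<zeta> \<in> set_pmf p" if "\<zeta> \<in> set_pmf p" "x \<in> U" for x \<zeta>
  proof -
    have "set_pmf p = (\<Union>x\<in>U. add x ` set_pmf p)"
      using arg_cong[OF stationary_eq, of set_pmf] finite_U U_nonempty by simp
    then show ?thesis using that by blast
  qed
  obtain l where l: "set l \<subseteq> U" "fold add l \<eta> = max_config"
    using \<eta> stationary_S by (blast intro: reach_max)
  have "\<zeta> \<in> R" if "set l \<subseteq> U" "\<zeta> \<in> set_pmf p" "fold add l \<zeta> \<in> R" for l \<zeta>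
    using that
  proof (induction l arbitrary: \<zeta>)
    case (Cons x l)
    then have "x \<in> U" "set l \<subseteq> U" "fold add l (add x \<zeta>) \<in> R" by simp_all
    moreover from this have "add x \<zeta> \<in> R" using Cons.IH step[OF Cons.prems(2)] by blast
    ultimately show ?case using pull_back[OF Cons.prems(2)] by blast
  qed simp
  then show "\<eta> \<in> R" using l \<eta> max_config_R by metis
qed

text \<open>Maximum principle: by injectivity, \<open>pmf p\<close> at a point of \<open>R\<close>
  is the average over \<open>x\<close> of its values at the preimages in \<open>R\<close> under
  \<open>add x\<close>. A maximal value thus passes to every such preimage, and each element of
  \<open>R\<close> leads to the maximizer \<open>\<zeta>0\<close>.\<close>

lemma stationary_unique: "p = pmf_of_set R"
proof -
  let ?M = "Max (pmf p ` R)"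
  have "?M \<in> pmf p ` R" using finite_R R_nonempty by (intro Max_in) auto
  then obtain \<zeta>0 where \<zeta>0: "\<zeta>0 \<in> R" "pmf p \<zeta>0 = ?M" by auto
  have le: "pmf p \<zeta> \<le> ?M" if "\<zeta> \<in> R" for \<zeta> using that finite_R by simp
  have pull_back: "pmf p \<eta> = ?M" if \<eta>: "\<eta> \<in> R" "x \<in> U" "pmf p (add x \<eta>) = ?M" for x \<eta>
  proof -
    have pre: "\<exists>\<xi>\<in>R. add y \<xi> = add x \<eta> \<and> measure_pmf.prob p (add y -` {add x \<eta>}) = pmf p \<xi>"
      if y: "y \<in> U" for y
    proof -
      have "add x \<eta> \<in> R" using \<eta> add_R by simp
      then have "add x \<eta> \<in> add y ` R" using bij_betw_add[OF y] by (simp add: bij_betw_def)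
      then obtain \<xi> where \<xi>: "\<xi> \<in> R" "add y \<xi> = add x \<eta>" by auto
      have "measure_pmf.prob p (add y -` {add x \<eta>}) = measure_pmf.prob p (add y -` {add x \<eta>} \<inter> set_pmf p)"
        by (rule measure_Int_set_pmf[symmetric])
      also have "add y -` {add x \<eta>} \<inter> set_pmf p = {\<xi>} \<inter> set_pmf p"
      proof -
        have "\<zeta> = \<xi>" if "\<zeta> \<in> set_pmf p" "add y \<zeta> = add x \<eta>" for \<zeta>
        proof (rule inj_onD[OF inj_on_add[OF y]])
          show "add y \<zeta> = add y \<xi>" using that(2) \<xi>(2) by (rule trans[OF _ sym])
          show "\<zeta> \<in> R" using that(1) stationary_supp_R by blast
        qed (rule \<xi>(1))
        then show ?thesis using \<xi>(2) by blast
      qed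
      also have "measure_pmf.prob p \<dots> = pmf p \<xi>"
        by (simp add: measure_Int_set_pmf measure_pmf_single)
      finally show ?thesis using \<xi> by blast
    qed
    have "measure_pmf.prob p (add y -` {add x \<eta>}) \<le> ?M" if "y \<in> U" for y
      using pre[OF that] le by auto
    note le' = this
    have sums: "(\<Sum>y\<in>U. measure_pmf.prob p (add y -` {add x \<eta>})) = (\<Sum>y\<in>U. ?M)"
      using stationary_pmf[of "add x \<eta>"] \<eta>(3) finite_U U_nonempty by (simp add: field_simps card_gt_0_iff)
    have "measure_pmf.prob p (add x -` {add x \<eta>}) = ?M"
      using sums le' \<eta>(2) finite_U by (rule sum_mono_inv)
    moreover obtain \<xi> where \<xi>: "\<xi> \<in> R" "add x \<xi> = add x \<eta>"
      "measure_pmf.prob p (add x -` {add x \<eta>}) = pmf p \<xi>"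
      using pre[OF \<eta>(2)] by blast
    moreover have "\<xi> = \<eta>" using inj_on_add[OF \<eta>(2)] \<xi>(2,1) \<eta>(1) by (rule inj_onD)
    ultimately show ?thesis by simp
  qed
  have "pmf p \<zeta> = ?M" if "set l \<subseteq> U" "\<zeta> \<in> R" "pmf p (fold add l \<zeta>) = ?M" for l \<zeta>
    using that
  proof (induction l arbitrary: \<zeta>)
    case (Cons x l)
    then have "x \<in> U" "set l \<subseteq> U" "pmf p (fold add l (add x \<zeta>)) = ?M" by simp_all
    moreover from this have "pmf p (add x \<zeta>) = ?M" using Cons.IH add_R[OF Cons.prems(2)] by blast
    ultimately show ?case using pull_back[OF Cons.prems(2)] by blast
  qed simp
  moreover have "\<exists>l. set l \<subseteq> U \<and> fold add l \<zeta> = \<zeta>0" if "\<zeta> \<in> R" for \<zeta>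
    using reach_R[of \<zeta> \<zeta>0] that \<zeta>0 R_subset_S by blast
  ultimately have const: "pmf p \<zeta> = ?M" if "\<zeta> \<in> R" for \<zeta>
    using that \<zeta>0 by metis
  have "(\<Sum>\<zeta>\<in>R. pmf p \<zeta>) = 1"
    using finite_R stationary_supp_R by (rule sum_pmf_eq_1)
  then have "real (card R) * ?M = 1" using const by simp
  then have M: "?M = 1 / card R" using R_nonempty finite_R by (simp add: field_simps)
  show ?thesis
  proof (rule pmf_eqI)
    fix \<zeta>
    show "pmf p \<zeta> = pmf (pmf_of_set R) \<zeta>"
    proof (cases "\<zeta> \<in> R")
      case True
      then show ?thesis using const M R_nonempty finite_R by simp
    next
      case False
      then have "\<zeta> \<notin> set_pmf p" using stationary_supp_R by blast
      then show ?thesis using False R_nonempty finite_R by (simp add: set_pmf_iff)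
    qed
  qed
qed

end

lemma sandpile_measure_eq: "sandpile_measure H = pmf_of_set R"
  unfolding sandpile_measure_def
  using stationary_uniform stationary_unique by (rule the_equality)

text \<open>The word \<open>l\<close> that drives \<open>\<eta>\<close> into \<open>R\<close> is an
  initial segment of the additions with positive probability, so almost sure return must also occur
  after starting with \<open>l\<close>. Since \<open>R\<close> is never left, a return after
  \<open>l\<close> puts \<open>\<eta>\<close> into \<open>R\<close>.\<close>

lemma recurrent_subset_R: "recurrent H \<subseteq> R"
proof
  fix \<eta> assume "\<eta> \<in> recurrent H"
  then have \<eta>: "\<eta> \<in> S"
    and AE: "AE \<omega> in stream_space (measure_pmf (pmf_of_set U)). \<exists>n>0. fold add (stake n \<omega>) \<eta> = \<eta>"
    unfolding recurrent_def S_def U_def sandpile_chain_def by auto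
  let ?P = "\<lambda>l. set l \<subseteq> U \<and> fold add l \<eta> \<in> R"
  obtain l0 where "set l0 \<subseteq> U" "fold add l0 \<eta> = max_config"
    by (rule reach_max[OF \<eta>])
  then have "?P l0" using max_config_R by simp
  \<comment> \<open>Minimal length settles a return to \<open>\<eta>\<close> during
    \<open>l\<close>: the rest of \<open>l\<close> would be a shorter word leading into
    \<open>R\<close>.\<close>
  then obtain l where l: "?P l" "\<And>k. ?P k \<Longrightarrow> length l \<le> length k"
    using ex_has_least_nat[of ?P l0 length] by blast
  have "AE \<omega> in stream_space (measure_pmf (pmf_of_set U)). \<exists>n>0. fold add (stake n (l @- \<omega>)) \<eta> = \<eta>"
    using AE l(1) finite_U U_nonempty by (intro AE_stream_space_shift) auto
  moreover have "AE \<omega> in stream_space (measure_pmf (pmf_of_set U)). \<forall>n. set (stake n \<omega>) \<subseteq> U"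
    using AE_stream_space_stake[of "pmf_of_set U"] finite_U U_nonempty by simp
  ultimately have "AE \<omega> in stream_space (measure_pmf (pmf_of_set U)).
      (\<exists>n>0. fold add (stake n (l @- \<omega>)) \<eta> = \<eta>) \<and> (\<forall>n. set (stake n \<omega>) \<subseteq> U)"
    by (rule AE_conjI)
  then have "\<exists>\<omega>. (\<exists>n>0. fold add (stake n (l @- \<omega>)) \<eta> = \<eta>) \<and> (\<forall>n. set (stake n \<omega>) \<subseteq> U)"
    by (rule AE_stream_space_ex)
  then obtain n \<omega> where n: "n > 0" "fold add (stake n (l @- \<omega>)) \<eta> = \<eta>"
    and \<omega>: "set (stake m \<omega>) \<subseteq> U" for m by blast
  show "\<eta> \<in> R"
  proof (cases "n \<le> length l")
    case True
    then have take: "fold add (take n l) \<eta> = \<eta>" using n(2) by (simp add: stake_shift)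
    have "fold add l \<eta> = fold add (drop n l) (fold add (take n l) \<eta>)"
      by (metis append_take_drop_id comp_apply fold_append)
    then have "fold add (drop n l) \<eta> \<in> R" using take l(1) by simp
    moreover have "set (drop n l) \<subseteq> U" using l(1) set_drop_subset by fast
    ultimately have "length l \<le> length (drop n l)" using l(2) by blast
    then have "l = []" using n(1) by (cases l) auto
    then show ?thesis using l(1) by simp
  next
    case False
    then have "stake n (l @- \<omega>) = l @ stake (n - length l) \<omega>" by (simp add: stake_shift)
    then have "fold add (stake (n - length l) \<omega>) (fold add l \<eta>) = \<eta>" using n(2) by simp
    then show ?thesis using fold_add_R[OF \<omega>, of "fold add l \<eta>"] l(1) by metis
  qed
qed

text \<open>The probability \<open>h \<zeta>\<close> of never visiting \<open>\<eta>\<close> from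
  \<open>\<zeta>\<close> is harmonic off \<open>\<eta>\<close>. Its maximum over \<open>R\<close>
  spreads along a word leading from a maximizer to \<open>\<eta>\<close>, where \<open>h\<close>
  vanishes; so \<open>h\<close> is zero on \<open>R\<close>, in particular after the first step from
  \<open>\<eta>\<close>.\<close>

lemma R_subset_recurrent: "R \<subseteq> recurrent H"
proof
  fix \<eta> assume \<eta>: "\<eta> \<in> R"
  let ?q = "pmf_of_set U"
  let ?S = "stream_space (measure_pmf ?q)"
  have q: "set_pmf ?q = U" using finite_U U_nonempty by simp
  interpret S: prob_space ?S
    by (rule prob_space.prob_space_stream_space) (rule measure_pmf.prob_space_axioms)
  \<comment> \<open>\<open>k = 0\<close> is used for hitting \<open>\<eta>\<close>,
    \<open>k = 1\<close> for returning to it. The condition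
    \<open>set (stake n \<omega>) \<subseteq> U\<close> holds almost surely and leaves only finitely
    many prefixes of each length, which makes the event measurable.\<close>
  define avoid where
    "avoid k \<zeta> = {\<omega> \<in> space ?S. \<forall>n\<ge>k. set (stake n \<omega>) \<subseteq> U \<and> fold add (stake n \<omega>) \<zeta> \<noteq> \<eta>}" for k \<zeta>
  have avoid_sets: "avoid k \<zeta> \<in> sets ?S" for k \<zeta>
  proof -
    have "avoid k \<zeta> = (\<Inter>n\<in>{k..}. \<Union>l\<in>{l. set l \<subseteq> U \<and> length l = n \<and> fold add l \<zeta> \<noteq> \<eta>}.
        {\<omega> \<in> space ?S. stake n \<omega> = l})"
      unfolding avoid_def by auto
    also have "\<dots> \<in> sets ?S"
    proof (rule sets.countable_INT')
      show "(\<lambda>n. \<Union>l\<in>{l. set l \<subseteq> U \<and> length l = n \<and> fold add l \<zeta> \<noteq> \<eta>}.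
          {\<omega> \<in> space ?S. stake n \<omega> = l}) ` {k..} \<subseteq> sets ?S"
      proof (intro image_subsetI sets.finite_UN)
        show "finite {l. set l \<subseteq> U \<and> length l = n \<and> fold add l \<zeta> \<noteq> \<eta>}" for n
          by (rule finite_subset[OF _ finite_lists_length_eq[OF finite_U, of n]]) blast
        show "{\<omega> \<in> space ?S. stake n \<omega> = l} \<in> sets ?S" for n l
          using pred_stake_eq[where q = ?q] by (rule predE)
      qed
    qed auto
    finally show ?thesis .
  qed
  define h where "h \<zeta> = S.prob (avoid 0 \<zeta>)" for \<zeta>
  have step: "S.prob (avoid k \<zeta>) = (\<Sum>x\<in>U. h (add x \<zeta>)) / card U" if k: "k = 0 \<longrightarrow> \<zeta> \<noteq> \<eta>" "k \<le> 1" for k \<zeta>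
  proof -
    have shift: "S.prob {\<omega> \<in> space ?S. x ## \<omega> \<in> avoid k \<zeta>} = h (add x \<zeta>)" if x: "x \<in> U" for x
    proof -
      have "(\<forall>n\<ge>k. set (stake n (x ## \<omega>)) \<subseteq> U \<and> fold add (stake n (x ## \<omega>)) \<zeta> \<noteq> \<eta>)
          \<longleftrightarrow> (\<forall>n. set (stake n \<omega>) \<subseteq> U \<and> fold add (stake n \<omega>) (add x \<zeta>) \<noteq> \<eta>)" (is "?l = ?r") for \<omega>
      proof
        assume l: ?l
        show ?r
        proof
          fix n
          have "k \<le> Suc n" using k(2) by simp
          then show "set (stake n \<omega>) \<subseteq> U \<and> fold add (stake n \<omega>) (add x \<zeta>) \<noteq> \<eta>"
            using l[rule_format, of "Suc n"] by simp
        qed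
      next
        assume r: ?r
        show ?l
        proof (intro allI impI)
          fix n assume "k \<le> n"
          then show "set (stake n (x ## \<omega>)) \<subseteq> U \<and> fold add (stake n (x ## \<omega>)) \<zeta> \<noteq> \<eta>"
            using r x k by (cases n) auto
        qed
      qed
      then have "{\<omega> \<in> space ?S. x ## \<omega> \<in> avoid k \<zeta>} = avoid 0 (add x \<zeta>)"
        unfolding avoid_def by (auto simp: space_stream_space)
      then show ?thesis by (simp add: h_def)
    qed
    have "ennreal (S.prob (avoid k \<zeta>)) = (\<integral>\<^sup>+x. S.prob {\<omega> \<in> space ?S. x ## \<omega> \<in> avoid k \<zeta>} \<partial>measure_pmf ?q)"
    proof -
      have "{\<omega> \<in> space ?S. \<omega> \<in> avoid k \<zeta>} = avoid k \<zeta>" unfolding avoid_def by blast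
      then show ?thesis
        using prob_space.prob_stream_space[OF measure_pmf.prob_space_axioms, of ?q "\<lambda>\<omega>. \<omega> \<in> avoid k \<zeta>"] avoid_sets
        by simp
    qed
    also have "\<dots> = (\<Sum>x\<in>U. ennreal (S.prob {\<omega> \<in> space ?S. x ## \<omega> \<in> avoid k \<zeta>})) / card U"
      using finite_U U_nonempty by (simp add: nn_integral_pmf_of_set)
    also have "\<dots> = (\<Sum>x\<in>U. ennreal (h (add x \<zeta>))) / card U"
      using shift by simp
    also have "\<dots> = ennreal ((\<Sum>x\<in>U. h (add x \<zeta>)) / card U)"
    proof -
      have "(\<Sum>x\<in>U. ennreal (h (add x \<zeta>))) = ennreal (\<Sum>x\<in>U. h (add x \<zeta>))"
        by (rule sum_ennreal) (simp add: h_def)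
      moreover have "0 < real (card U)" using finite_U U_nonempty by (simp add: card_gt_0_iff)
      moreover have "0 \<le> (\<Sum>x\<in>U. h (add x \<zeta>))" by (simp add: h_def sum_nonneg)
      ultimately show ?thesis by (simp add: divide_ennreal ennreal_of_nat_eq_real_of_nat)
    qed
    finally show ?thesis
      by (subst (asm) ennreal_inj) (auto simp: h_def intro!: divide_nonneg_nonneg sum_nonneg)
  qed
  have h_\<eta>: "h \<eta> = 0"
  proof -
    have "avoid 0 \<eta> = {}" unfolding avoid_def by (auto intro!: exI[of _ 0])
    then show ?thesis by (simp add: h_def)
  qed
  let ?m = "Max (h ` R)"
  have le: "h \<zeta> \<le> ?m" if "\<zeta> \<in> R" for \<zeta> using that finite_R by simp
  have "?m \<in> h ` R" using finite_R R_nonempty by (intro Max_in) auto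
  then obtain \<zeta>0 where \<zeta>0: "\<zeta>0 \<in> R" "h \<zeta>0 = ?m" by auto
  have spread: "h (add x \<zeta>) = ?m" if \<zeta>: "\<zeta> \<in> R" "h \<zeta> = ?m" "\<zeta> \<noteq> \<eta>" "x \<in> U" for x \<zeta>
  proof -
    have sums: "(\<Sum>x\<in>U. h (add x \<zeta>)) = (\<Sum>x\<in>U. ?m)"
      using step[of 0 \<zeta>] \<zeta> finite_U U_nonempty by (simp add: field_simps card_gt_0_iff flip: h_def)
    have "h (add x \<zeta>) \<le> ?m" if "x \<in> U" for x using le add_R \<zeta>(1) that by blast
    from sums this \<zeta>(4) finite_U show ?thesis by (rule sum_mono_inv)
  qed
  have "?m = 0" if "set l \<subseteq> U" "\<zeta> \<in> R" "h \<zeta> = ?m" "fold add l \<zeta> = \<eta>" for l \<zeta>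
    using that
  proof (induction l arbitrary: \<zeta>)
    case Nil
    then show ?case using h_\<eta> by simp
  next
    case (Cons x l)
    then have x: "x \<in> U" "set l \<subseteq> U" "fold add l (add x \<zeta>) = \<eta>" by simp_all
    show ?case
    proof (cases "\<zeta> = \<eta>")
      case True
      then show ?thesis using h_\<eta> Cons.prems(3) by simp
    next
      case False
      show ?thesis
        using x(2) add_R[OF Cons.prems(2) x(1)] spread[OF Cons.prems(2,3) False x(1)] x(3)
        by (rule Cons.IH)
    qed
  qed
  moreover obtain l where "set l \<subseteq> U" "fold add l \<zeta>0 = \<eta>"
    using \<zeta>0(1) R_subset_S \<eta> by (blast intro: reach_R)
  ultimately have "?m = 0" using \<zeta>0 by blast
  then have h0: "h \<zeta> = 0" if "\<zeta> \<in> R" for \<zeta>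
    using le[OF that] by (simp add: h_def order.antisym measure_nonneg)
  have "S.prob (avoid 1 \<eta>) = 0"
    using step[of 1 \<eta>] h0 add_R[OF \<eta>] by simp
  then have "AE \<omega> in ?S. \<omega> \<notin> avoid 1 \<eta>"
    using avoid_sets by (intro AE_not_in) (simp add: null_sets_def S.emeasure_eq_measure)
  moreover have "AE \<omega> in ?S. \<forall>n. set (stake n \<omega>) \<subseteq> U"
    using AE_stream_space_stake[of ?q] by (simp add: q)
  ultimately have "AE \<omega> in ?S. \<exists>n>0. fold add (stake n \<omega>) \<eta> = \<eta>"
  proof eventually_elim
    case (elim \<omega>)
    then show ?case unfolding avoid_def by (auto simp: space_stream_space Suc_le_eq)
  qed
  then show "\<eta> \<in> recurrent H"
    using \<eta> R_subset_S unfolding recurrent_def sandpile_chain_def S_def U_def by auto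
qed

lemma recurrent_eq: "recurrent H = R"
  using recurrent_subset_R R_subset_recurrent by blast

end

section \<open>Wired graphs and transfer currents\<close>

lemma burnable_configs_cong:
  assumes "\<And>x y. x \<in> U \<Longrightarrow> y \<in> U \<Longrightarrow> a x y = b x y" "\<And>x. x \<in> U \<Longrightarrow> d x = e x"
  shows "burnable_configs U a d = burnable_configs U b e"
proof -
  have "burnable U a \<eta> \<longleftrightarrow> burnable U b \<eta>" for \<eta>
  proof -
    have "sum (a x) F = sum (b x) F" if "F \<subseteq> U" "x \<in> F" for x F
      using that by (intro sum.cong refl assms(1)) auto
    then have "(\<exists>x\<in>F. sum (a x) F \<le> \<eta> x) \<longleftrightarrow> (\<exists>x\<in>F. sum (b x) F \<le> \<eta> x)" if "F \<subseteq> U" for F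
      using that by (intro bex_cong refl) simp
    then show ?thesis unfolding burnable_def by simp
  qed
  moreover have "stable_configs U d = stable_configs U e"
    using assms(2) unfolding stable_configs_def by auto
  ultimately show ?thesis unfolding burnable_configs_def by simp
qed

section \<open>Components of the underlying undirected graph\<close>

lemma adjacent_mk_symmetric:
  "(x, y) \<in> arcs_ends (with_proj (mk_symmetric G)) \<longleftrightarrow> (\<exists>e\<in>arcs G. {tail G e, head G e} = {x, y})"
  by (auto simp: arcs_ends_conv parcs_mk_symmetric doubleton_eq_iff)

definition adjacency :: "('v, 'e) pre_digraph \<Rightarrow> ('v \<times> 'v) set" where
  "adjacency G = {(x, y). \<exists>e\<in>arcs G. {tail G e, head G e} = {x, y}}"

lemma reachable_mk_symmetric_iff:
  "v \<rightarrow>\<^sup>*\<^bsub>with_proj (mk_symmetric G)\<^esub> u \<longleftrightarrow> (v, u) \<in> rtrancl_on (verts G) (adjacency G)"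
proof -
  have "arcs_ends (with_proj (mk_symmetric G)) = adjacency G"
  proof (rule Set.set_eqI)
    fix p :: "'a \<times> 'a"
    obtain x y where p: "p = (x, y)" by (cases p)
    show "p \<in> arcs_ends (with_proj (mk_symmetric G)) \<longleftrightarrow> p \<in> adjacency G"
      unfolding p adjacent_mk_symmetric adjacency_def by simp
  qed
  moreover have "verts (with_proj (mk_symmetric G)) = verts G" by simp
  ultimately show ?thesis unfolding reachable_def by (simp only:)
qed

lemma component_of_vert_iff:
  "u \<in> component_of_vert G v \<longleftrightarrow> (v, u) \<in> rtrancl_on (verts G) (adjacency G)"
  unfolding component_of_vert_def by (simp only: mem_Collect_eq reachable_mk_symmetric_iff)

lemma component_of_vert_refl: "v \<in> verts G \<Longrightarrow> v \<in> component_of_vert G v"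
  unfolding component_of_vert_iff by (rule rtrancl_on_refl)

lemma component_of_vert_step:
  assumes "x \<in> component_of_vert G v" "e \<in> arcs G" "{tail G e, head G e} = {x, y}" "y \<in> verts G"
  shows "y \<in> component_of_vert G v"
proof -
  have "(x, y) \<in> adjacency G" using assms(2,3) unfolding adjacency_def by blast
  with assms(1) show ?thesis
    unfolding component_of_vert_iff using assms(4) by (rule rtrancl_on_into_rtrancl_on)
qed

lemma component_of_vert_trans:
  assumes "x \<in> component_of_vert G v"
  shows "component_of_vert G x \<subseteq> component_of_vert G v"
proof
  fix u assume "u \<in> component_of_vert G x"
  with assms show "u \<in> component_of_vert G v"
    unfolding component_of_vert_iff by (rule rtrancl_on_trans)
qed

lemma component_of_vert_closed:
  assumes "v \<in> A"
    and "\<And>e x y. e \<in> arcs G \<Longrightarrow> x \<in> A \<Longrightarrow> y \<in> verts G \<Longrightarrow> {tail G e, head G e} = {x, y} \<Longrightarrow> y \<in> A"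
  shows "component_of_vert G v \<subseteq> A"
proof
  fix u assume "u \<in> component_of_vert G v"
  then have "(v, u) \<in> rtrancl_on (verts G) (adjacency G)" unfolding component_of_vert_iff .
  then show "u \<in> A"
  proof (induction rule: rtrancl_on_induct)
    case (step y z)
    then obtain e where "e \<in> arcs G" "{tail G e, head G e} = {y, z}"
      unfolding adjacency_def by blast
    then show ?case using assms(2) step.IH step.hyps(4) by blast
  qed (rule assms(1))
qed

section \<open>The infinite graph and its wired finite graphs\<close>

locale infinite_graph =
  fixes G :: "('v, 'e) pre_digraph"
  assumes loopfree: "loopfree_digraph G"
    and locally_finite: "locally_finite G"
    and connected: "Digraph_Component.connected G"
    and infinite_verts: "infinite (verts G)"
begin

sublocale loopfree_digraph G by (rule loopfree)

definition ends :: "'e \<Rightarrow> 'v set" where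
  "ends e = {tail G e, head G e}"

sublocale M: loopless_multigraph ends "arcs G"
proof
  show "card (ends e) = 2" if "e \<in> arcs G" for e
    using no_loops[OF that] by (simp add: ends_def)
  show "finite {e \<in> arcs G. x \<in> ends e}" for x
  proof (cases "x \<in> verts G")
    case True
    have "{e \<in> arcs G. x \<in> ends e} = in_arcs G x \<union> out_arcs G x"
      by (auto simp: ends_def)
    then show ?thesis using locally_finite True by (simp add: locally_finite_def)
  next
    case False
    then have "{e \<in> arcs G. x \<in> ends e} = {}" by (auto simp: ends_def)
    then show ?thesis by (simp only: finite.emptyI)
  qed
qed

lemma ends_subset: "e \<in> arcs G \<Longrightarrow> ends e \<subseteq> verts G"
  by (simp add: ends_def)

text \<open>A finite \<open>F\<close> without an outgoing edge would contain a whole component,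
  which is all of the infinite \<open>verts G\<close>. For wired graphs this yields the connection
  to the sink.\<close>

lemma leaving_edge:
  assumes "F \<subseteq> verts G" "finite F" "F \<noteq> {}"
  shows "\<exists>x\<in>F. \<exists>e\<in>arcs G. x \<in> ends e \<and> \<not> ends e \<subseteq> F"
proof (rule ccontr)
  assume no: "\<not> (\<exists>x\<in>F. \<exists>e\<in>arcs G. x \<in> ends e \<and> \<not> ends e \<subseteq> F)"
  obtain v where v: "v \<in> F" using assms(3) by blast
  have "component_of_vert G v \<subseteq> F"
    using v
  proof (rule component_of_vert_closed)
    fix e x y assume e: "e \<in> arcs G" "x \<in> F" "{tail G e, head G e} = {x, y}"
    then have "ends e = {x, y}" unfolding ends_def by simp
    then have "\<not> \<not> ends e \<subseteq> F" using no e(1,2) by auto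
    then show "y \<in> F" using \<open>ends e = {x, y}\<close> by simp
  qed
  moreover have "verts G \<subseteq> component_of_vert G v"
  proof
    fix u assume u: "u \<in> verts G"
    have verts: "verts (with_proj (mk_symmetric G)) = verts G" by simp
    have all: "\<forall>u\<in>verts (with_proj (mk_symmetric G)). \<forall>v\<in>verts (with_proj (mk_symmetric G)).
        u \<rightarrow>\<^sup>*\<^bsub>with_proj (mk_symmetric G)\<^esub> v"
      using connected unfolding Digraph_Component.connected_def strongly_connected_def by (rule conjunct2)
    have "v \<in> verts G" using v assms(1) by blast
    from bspec[OF bspec[OF all[unfolded verts] this] u]
    have "v \<rightarrow>\<^sup>*\<^bsub>with_proj (mk_symmetric G)\<^esub> u" .
    then show "u \<in> component_of_vert G v" unfolding component_of_vert_def by (rule CollectI)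
  qed
  ultimately have "verts G \<subseteq> F" by blast
  then have "finite (verts G)" using assms(2) by (rule finite_subset)
  then show False using infinite_verts by contradiction
qed

abbreviation touching :: "'v set \<Rightarrow> 'e set" where
  "touching V \<equiv> edges_touching G V"

lemma touching_eq: "touching V = {e \<in> arcs G. ends e \<inter> V \<noteq> {}}"
  unfolding edges_touching_def ends_def by auto

lemma finite_touching: "finite V \<Longrightarrow> finite (touching V)"
proof -
  assume "finite V"
  then have "finite (\<Union>x\<in>V. {e \<in> arcs G. x \<in> ends e})" using M.finite_incident by blast
  then show ?thesis by (rule finite_subset[rotated]) (auto simp: touching_eq)
qed

lemma nonsink_wired [simp]: "nonsink (wired G V) = V"
  by (auto simp: nonsink_def wired_def)

lemma wired_ends:
  assumes "x \<in> V" "y \<in> V"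
  shows "{tail (wired G V) e, head (wired G V) e} = {Some x, Some y} \<longleftrightarrow> ends e = {x, y}"
  using assms by (auto simp: wired_def ends_def doubleton_eq_iff)

lemma edge_mult_wired:
  assumes "x \<in> V" "y \<in> V"
  shows "edge_mult (wired G V) (Some x) (Some y) = M.mult (arcs G) x y"
proof -
  have "{e \<in> touching V. ends e = {x, y}} = {e \<in> arcs G. ends e = {x, y}}"
    using assms by (auto simp: touching_eq)
  moreover have "arcs (wired G V) = touching V" by (simp add: wired_def)
  ultimately show ?thesis
    unfolding edge_mult_def M.mult_def wired_ends[OF assms] by simp
qed

lemma degree_wired:
  assumes "x \<in> V"
  shows "degree_of (wired G V) (Some x) = M.deg (arcs G) UNIV x"
proof -
  have "in_arcs (wired G V) (Some x) = {e \<in> arcs G. head G e = x}"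
    "out_arcs (wired G V) (Some x) = {e \<in> arcs G. tail G e = x}"
    using assms by (auto simp: wired_def in_arcs_def out_arcs_def touching_eq ends_def split: if_splits)
  then have "degree_of (wired G V) (Some x) = card {e \<in> arcs G. head G e = x} + card {e \<in> arcs G. tail G e = x}"
    by (simp add: degree_of_def in_degree_def out_degree_def)
  also have "\<dots> = card ({e \<in> arcs G. head G e = x} \<union> {e \<in> arcs G. tail G e = x})"
  proof (rule card_Un_disjoint[symmetric])
    show "finite {e \<in> arcs G. head G e = x}" "finite {e \<in> arcs G. tail G e = x}"
      by (rule finite_subset[OF _ M.finite_incident[of x]]; auto simp: ends_def)+
    show "{e \<in> arcs G. head G e = x} \<inter> {e \<in> arcs G. tail G e = x} = {}"
      using no_loops by blast
  qed
  also have "{e \<in> arcs G. head G e = x} \<union> {e \<in> arcs G. tail G e = x} = {e \<in> arcs G. x \<in> ends e \<and> ends e \<subseteq> UNIV}"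
    by (auto simp: ends_def)
  finally show ?thesis by (simp only: M.deg_def)
qed

lemma sum_mult_le_degree:
  assumes "E \<subseteq> arcs G" "finite V" "x \<in> V"
  shows "sum (M.mult E x) V \<le> M.deg E UNIV x"
  using assms M.sum_mult[OF assms] by (simp add: M.deg_mono)

lemma sandpile_wired:
  assumes V: "finite V" "V \<noteq> {}" "V \<subseteq> verts G"
  shows "sandpile (wired G V)"
proof
  have sum_eq: "(\<Sum>y\<in>F. edge_mult (wired G V) (Some x) (Some y)) = M.deg (arcs G) F x"
    if "F \<subseteq> V" "x \<in> F" for F x
  proof -
    have "(\<Sum>y\<in>F. edge_mult (wired G V) (Some x) (Some y)) = sum (M.mult (arcs G) x) F"
      using that by (intro sum.cong refl edge_mult_wired) auto
    also have "\<dots> = M.deg (arcs G) F x"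
      using that V(1) by (intro M.sum_mult) (auto intro: finite_subset)
    finally show ?thesis .
  qed
  show "edge_mult (wired G V) (Some x) (Some x) = 0" if "x \<in> nonsink (wired G V)" for x
  proof -
    have "ends e \<noteq> {x, x}" if "e \<in> arcs G" for e using M.card_ends[OF that] by auto
    then have "{e \<in> arcs G. ends e = {x, x}} = {}" by blast
    then have "M.mult (arcs G) x x = 0" unfolding M.mult_def by (simp only: card.empty)
    then show ?thesis using that edge_mult_wired[of x V x] by simp
  qed
  show "sum (\<lambda>y. edge_mult (wired G V) (Some x) (Some y)) (nonsink (wired G V)) \<le> degree_of (wired G V) (Some x)"
    if "x \<in> nonsink (wired G V)" for x
    using that sum_eq[of V x] by (simp add: degree_wired M.deg_mono)
  show "\<exists>x\<in>F. sum (\<lambda>y. edge_mult (wired G V) (Some x) (Some y)) F < degree_of (wired G V) (Some x)"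
    if F: "F \<subseteq> nonsink (wired G V)" "F \<noteq> {}" for F
  proof -
    have FV: "F \<subseteq> V" using F by simp
    moreover have "finite F" using FV V(1) by (rule finite_subset)
    ultimately obtain x e where x: "x \<in> F" "e \<in> arcs G" "x \<in> ends e" "\<not> ends e \<subseteq> F"
      using leaving_edge[of F] V(3) F(2) by blast
    have "M.deg (arcs G) F x < M.deg (arcs G) UNIV x"
      using x by (intro M.deg_less[of _ _ _ e]) auto
    moreover have "x \<in> V" using x FV by blast
    ultimately show ?thesis
      using x(1) sum_eq[OF FV x(1)] by (intro bexI[of _ x]) (simp_all add: degree_wired)
  qed
qed (use V in auto)

lemma
  assumes V: "finite V" "V \<noteq> {}" "V \<subseteq> verts G"
  shows recurrent_wired: "recurrent (wired G V) = M.rec (arcs G) V"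
    and sandpile_measure_wired: "sandpile_measure (wired G V) = pmf_of_set (M.rec (arcs G) V)"
    and rec_nonempty: "M.rec (arcs G) V \<noteq> {}"
proof -
  interpret S: sandpile "wired G V" "nonsink (wired G V)"
    "\<lambda>x y. edge_mult (wired G V) (Some x) (Some y)" "\<lambda>x. degree_of (wired G V) (Some x)"
    using sandpile_wired[OF V] by simp_all
  have "S.R = burnable_configs V (M.mult (arcs G)) (M.deg (arcs G) UNIV)"
    unfolding S.R_def nonsink_wired
    by (rule burnable_configs_cong) (simp_all add: V edge_mult_wired degree_wired)
  also have "\<dots> = M.rec (arcs G) V" using V by (intro M.rec_eq_burnable_configs[symmetric]) auto
  finally have R: "S.R = M.rec (arcs G) V" .
  show "recurrent (wired G V) = M.rec (arcs G) V" using S.recurrent_eq R by simp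
  show "sandpile_measure (wired G V) = pmf_of_set (M.rec (arcs G) V)" using S.sandpile_measure_eq R by simp
  show "M.rec (arcs G) V \<noteq> {}" using S.R_nonempty R by simp
qed

lemma finite_rec: "E \<subseteq> arcs G \<Longrightarrow> finite V \<Longrightarrow> finite (M.rec E V)"
  by (simp add: M.rec_eq_burnable_configs finite_burnable_configs)

lemma card_rec_eq_det:
  assumes "E \<subseteq> arcs G" "finite V"
  shows "real (card (M.rec E V)) = det_on V (lap (M.mult E) (M.deg E UNIV))"
  unfolding M.rec_eq_burnable_configs[OF assms]
  using assms(2) sum_mult_le_degree[OF assms] by (rule card_burnable_configs)

section \<open>Finite components off \<open>W\<close> and the reduction to a finite core\<close>

abbreviation comp :: "'v set \<Rightarrow> 'v \<Rightarrow> 'v set" where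
  "comp W \<equiv> component_of_vert (remove_verts G W)"

lemma verts_remove_verts [simp]: "verts (remove_verts G W) = verts G - W"
  by (simp add: remove_verts_def)

lemma arcs_remove_verts: "arcs (remove_verts G W) = {e \<in> arcs G. ends e \<inter> W = {}}"
  by (auto simp: remove_verts_def ends_def)

lemma ends_remove_verts: "{tail (remove_verts G W) e, head (remove_verts G W) e} = ends e"
  by (simp add: remove_verts_def ends_def)

lemma comp_step:
  assumes "x \<in> comp W v" "e \<in> arcs G" "ends e = {x, y}" "x \<notin> W" "y \<notin> W"
  shows "y \<in> comp W v"
proof (rule component_of_vert_step[OF assms(1)])
  show "e \<in> arcs (remove_verts G W)" using assms by (auto simp: arcs_remove_verts)
  show "{tail (remove_verts G W) e, head (remove_verts G W) e} = {x, y}"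
    unfolding ends_remove_verts by (rule assms(3))
  have "y \<in> ends e" using assms(3) by simp
  then show "y \<in> verts (remove_verts G W)" using ends_subset assms by auto
qed

lemma comp_neighbour:
  assumes "e \<in> arcs G" "ends e = {x, y}" "x \<notin> W" "y \<notin> W"
  shows "comp W y \<subseteq> comp W x"
proof (rule component_of_vert_trans)
  have "x \<in> verts G" using ends_subset[OF assms(1)] assms(2) by simp
  then have "x \<in> comp W x" using assms(3) by (intro component_of_vert_refl) simp
  then show "y \<in> comp W x" using assms by (rule comp_step)
qed

lemma comp_mono:
  assumes "W \<subseteq> V" "v \<in> verts G - V"
  shows "comp V v \<subseteq> comp W v"
proof -
  have "component_of_vert (remove_verts G V) v \<subseteq> comp W v \<inter> (verts G - V)"
  proof (rule component_of_vert_closed)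
    have "v \<in> verts (remove_verts G W)" using assms by auto
    then have "v \<in> comp W v" by (rule component_of_vert_refl)
    then show "v \<in> comp W v \<inter> (verts G - V)" using assms(2) by blast
    fix e x y assume e: "e \<in> arcs (remove_verts G V)" "x \<in> comp W v \<inter> (verts G - V)"
      "y \<in> verts (remove_verts G V)" "{tail (remove_verts G V) e, head (remove_verts G V) e} = {x, y}"
    then have "ends e = {x, y}" "e \<in> arcs G" by (simp_all add: ends_remove_verts arcs_remove_verts)
    then show "y \<in> comp W v \<inter> (verts G - V)"
      using e assms(1) by (auto intro: comp_step)
  qed
  then show ?thesis by blast
qed

text \<open>\<open>W \<union> fin_part W\<close> is the core: all that depends on \<xi> takes place
  there, and it is the same in every wired graph large enough to contain it.\<close>

definition fin_part :: "'v set \<Rightarrow> 'v set" where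
  "fin_part W = {v \<in> verts G - W. finite (comp W v)}"

lemma fin_part_closed:
  assumes "e \<in> arcs G" "x \<in> ends e" "x \<in> fin_part W"
  shows "ends e \<subseteq> W \<union> fin_part W"
proof -
  obtain y where y: "ends e = {x, y}" using assms(1,2) by (rule M.ends_other)
  have "y \<in> verts G" using ends_subset[OF assms(1)] y by blast
  moreover have "finite (comp W y)" if "y \<notin> W"
    using comp_neighbour[OF assms(1) y _ that] assms(3) unfolding fin_part_def
    by (auto intro: finite_subset)
  ultimately show ?thesis using y assms(3) unfolding fin_part_def by auto
qed

text \<open>Vertices off the core lie in infinite components of \<open>G - W\<close>. A finite
  \<open>F\<close> cannot contain such a component, so some edge avoiding \<open>W\<close> leaves
  \<open>F\<close>; it cannot end in \<open>fin_part W\<close>, whose edges stay inside the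
  core.\<close>

lemma attached_outside_fin_part:
  assumes V: "finite V" "V \<subseteq> verts G" "W \<union> fin_part W \<subseteq> V"
  shows "M.attached (arcs G) V (V - (W \<union> fin_part W))"
  unfolding M.attached_def
proof (intro allI impI)
  let ?Q = "W \<union> fin_part W"
  fix F assume F: "F \<subseteq> V - ?Q" "F \<noteq> {}"
  have VQ: "V - (V - ?Q) = ?Q" using V(3) by blast
  have "\<exists>x\<in>F. \<exists>e\<in>arcs G. x \<in> ends e \<and> ends e \<inter> W = {} \<and> \<not> ends e \<subseteq> F"
  proof (rule ccontr)
    assume no: "\<not> (\<exists>x\<in>F. \<exists>e\<in>arcs G. x \<in> ends e \<and> ends e \<inter> W = {} \<and> \<not> ends e \<subseteq> F)"
    obtain v where v: "v \<in> F" using F(2) by blast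
    then have "comp W v \<subseteq> F"
    proof (rule component_of_vert_closed)
      fix e x y assume e: "e \<in> arcs (remove_verts G W)" "x \<in> F"
        "{tail (remove_verts G W) e, head (remove_verts G W) e} = {x, y}"
      then have e': "ends e = {x, y}" "e \<in> arcs G" "ends e \<inter> W = {}"
        by (simp_all add: ends_remove_verts arcs_remove_verts)
      have "x \<in> ends e" using e'(1) by simp
      then have "ends e \<subseteq> F" using no e' e(2) by blast
      then show "y \<in> F" using e'(1) by simp
    qed
    moreover have "finite F" using F(1) V(1) by (meson Diff_subset finite_subset subset_trans)
    ultimately have "finite (comp W v)" by (rule finite_subset)
    then have "v \<in> ?Q" using v F(1) V(2) unfolding fin_part_def by auto
    then show False using v F(1) by blast
  qed
  then obtain x e where x: "x \<in> F" "e \<in> arcs G" "x \<in> ends e" "ends e \<inter> W = {}" "\<not> ends e \<subseteq> F" by blast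
  have "ends e \<inter> fin_part W = {}"
  proof (rule ccontr)
    assume "ends e \<inter> fin_part W \<noteq> {}"
    then obtain z where "z \<in> ends e" "z \<in> fin_part W" by blast
    then have "ends e \<subseteq> ?Q" by (rule fin_part_closed[OF x(2)])
    then show False using x(1,3) F(1) by blast
  qed
  then have "\<not> ends e \<subseteq> F \<union> ?Q" using x(4,5) by blast
  then show "\<exists>x\<in>F. \<exists>e\<in>arcs G. x \<in> ends e \<and> \<not> ends e \<subseteq> F \<union> (V - (V - ?Q))"
    unfolding VQ using x(1-3) by blast
qed

text \<open>Enlarging the removed set only shrinks components, so a vertex of
  \<open>fin_part W\<close> outside \<open>V\<close> would lie in a finite component of
  \<open>G - V\<close>.\<close>

lemma fin_part_subset:
  assumes "all_components_infinite (remove_verts G V)" "W \<subseteq> V"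
  shows "fin_part W \<subseteq> V"
proof (rule ccontr)
  assume "\<not> fin_part W \<subseteq> V"
  then obtain v where v: "v \<in> fin_part W" "v \<notin> V" by blast
  then have vV: "v \<in> verts G - V" unfolding fin_part_def by blast
  have "finite (comp V v)"
    using comp_mono[OF assms(2) vV] v(1) unfolding fin_part_def by (auto intro: finite_subset)
  then show False using assms(1) vV unfolding all_components_infinite_def by auto
qed

text \<open>Frees minimality from the particular \<open>V\<close> in the definition: the vertices
  off the core are attached to the sink, so they can be merged into it.\<close>

lemma gen_minimal_wired:
  assumes V: "finite V" "V \<subseteq> verts G" and W: "W \<union> fin_part W \<subseteq> V"
    and gm: "gen_minimal_in (wired G V) W \<xi>"
  shows "M.gen_minimal (arcs G) (W \<union> fin_part W) W \<xi>"
proof -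
  let ?Q = "W \<union> fin_part W"
  have "V \<noteq> {}" using gm W unfolding gen_minimal_in_def by auto
  then have rec: "recurrent (wired G V) = M.rec (arcs G) V" using V by (intro recurrent_wired)
  have "M.gen_minimal (arcs G) V W \<xi>"
    using gm unfolding gen_minimal_in_def M.gen_minimal_def M.rec_on_def rec by blast
  then have "M.gen_minimal (arcs G) (V - (V - ?Q)) W \<xi>"
    using V W by (intro M.gen_minimal_diff attached_outside_fin_part) auto
  moreover have "V - (V - ?Q) = ?Q" using W by blast
  ultimately show ?thesis by simp
qed

lemma gen_minimal_core:
  assumes "minimal_config G W \<xi> \<or> gen_minimal_config G W \<xi>"
  shows "W \<noteq> {}" "finite (W \<union> fin_part W)" "W \<union> fin_part W \<subseteq> verts G"
    "M.gen_minimal (arcs G) (W \<union> fin_part W) W \<xi>"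
proof -
  obtain V where V: "finite V" "W \<subseteq> V" "V \<subseteq> verts G" "fin_part W \<subseteq> V"
    and gm: "gen_minimal_in (wired G V) W \<xi>"
    using assms
  proof
    assume min: "minimal_config G W \<xi>"
    \<comment> \<open>With only infinite components in \<open>G - W\<close> the core is
      \<open>W\<close> itself, so any admissible \<open>V\<close> contains it.\<close>
    then have "fin_part W = {}"
      unfolding minimal_config_def all_components_infinite_def fin_part_def by auto
    then show thesis using that min unfolding minimal_config_def minimal_in_def by auto
  next
    assume "gen_minimal_config G W \<xi>"
    then show thesis using that fin_part_subset unfolding gen_minimal_config_def by meson
  qed
  show "W \<noteq> {}" using gm unfolding gen_minimal_in_def by blast
  show "finite (W \<union> fin_part W)" using V by (meson Un_least finite_subset)
  show "W \<union> fin_part W \<subseteq> verts G" using V by blast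
  show "M.gen_minimal (arcs G) (W \<union> fin_part W) W \<xi>"
    using V by (intro gen_minimal_wired[OF _ _ _ gm]) auto
qed

lemma deleted_edges:
  assumes "minimal_config G W \<xi> \<or> gen_minimal_config G W \<xi>"
  obtains D where "D \<subseteq> edges_touching G W"
    "\<And>V. finite V \<Longrightarrow> W \<union> fin_part W \<subseteq> V \<Longrightarrow>
      card (M.rec (arcs G - D) V) = card (M.rec_on (arcs G) V W \<xi>)"
proof -
  note core = gen_minimal_core[OF assms]
  obtain D where D: "D \<subseteq> {e \<in> arcs G. ends e \<inter> W \<noteq> {}}"
    "\<And>V. finite V \<Longrightarrow> W \<union> fin_part W \<subseteq> V \<Longrightarrow>
      card (M.rec (arcs G - D) V) = card (M.rec_on (arcs G) V W \<xi>)"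
  proof (rule M.deleted_edges_exist[OF order_refl core(2) _ core(4)])
    show "ends e \<subseteq> W \<union> fin_part W"
      if "e \<in> arcs G" "ends e \<inter> (W \<union> fin_part W - W) \<noteq> {}" for e
      using fin_part_closed[OF that(1)] that(2) by blast
  qed auto
  then show thesis using that by (simp add: touching_eq)
qed

section \<open>Incidence vectors, the Laplacian and the Dirichlet form\<close>

definition inc :: "'e \<Rightarrow> 'v \<Rightarrow> real" where
  "inc e x = of_bool (tail G e = x) - of_bool (head G e = x)"

definition grad :: "('v \<Rightarrow> real) \<Rightarrow> 'e \<Rightarrow> real" where
  "grad h e = h (tail G e) - h (head G e)"

abbreviation \<Delta> :: "'v \<Rightarrow> 'v \<Rightarrow> real" where
  "\<Delta> \<equiv> lap (M.mult (arcs G)) (M.deg (arcs G) UNIV)"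

lemma inc_outside: "x \<notin> ends e \<Longrightarrow> inc e x = 0"
  by (auto simp: inc_def ends_def)

lemma inc_product:
  assumes "e \<in> arcs G" "x \<in> ends e"
  shows "inc e x * inc e y = of_bool (x = y) - of_bool (ends e = {x, y})"
  using assms no_loops[OF assms(1)] by (auto simp: inc_def ends_def doubleton_eq_iff of_bool_def)

text \<open>The Laplacian is the Gram matrix of the incidence vectors. Summing only over the edges
  at \<open>x\<close> keeps the sum finite when \<open>E\<close> is infinite.\<close>

lemma lap_eq_sum:
  assumes E: "E \<subseteq> arcs G"
  shows "lap (M.mult E) (M.deg E UNIV) x y = (\<Sum>e | e \<in> E \<and> x \<in> ends e. inc e x * inc e y)"
proof -
  let ?E = "{e \<in> E. x \<in> ends e}"
  have fin: "finite ?E" using M.finite_incident'[OF E, of x "\<lambda>_. True"] by simp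
  have "(\<Sum>e\<in>?E. inc e x * inc e y) = (\<Sum>e\<in>?E. of_bool (x = y) - of_bool (ends e = {x, y}))"
    using E by (intro sum.cong inc_product) auto
  also have "\<dots> = real (card ?E) * of_bool (x = y) - real (card {e \<in> ?E. ends e = {x, y}})"
    using fin by (simp add: sum_subtractf sum.If_cases of_bool_def Int_def)
  also have "{e \<in> ?E. ends e = {x, y}} = {e \<in> E. ends e = {x, y}}" by auto
  also have "?E = {e \<in> E. x \<in> ends e \<and> ends e \<subseteq> UNIV}" by simp
  finally show ?thesis by (simp add: lap_def M.deg_def M.mult_def)
qed

lemma sum_edges_at:
  assumes "E \<subseteq> arcs G" "finite T" "{e \<in> E. x \<in> ends e} \<subseteq> T" "T \<subseteq> E"
  shows "(\<Sum>e | e \<in> E \<and> x \<in> ends e. inc e x * f e) = (\<Sum>e\<in>T. inc e x * f e)"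
proof (rule sum.mono_neutral_left)
  show "\<forall>e\<in>T - {e \<in> E. x \<in> ends e}. inc e x * f e = 0"
  proof
    fix e assume "e \<in> T - {e \<in> E. x \<in> ends e}"
    then have "x \<notin> ends e" using assms(4) by blast
    then show "inc e x * f e = 0" by (simp add: inc_outside)
  qed
qed (use assms in auto)

text \<open>Deleting \<open>D\<close> subtracts one rank-one term per edge, which is the left-hand
  side of \<open>det_on_sub_gram\<close> with \<open>b = inc\<close>.\<close>

lemma lap_delete:
  assumes D: "D \<subseteq> arcs G" "finite D"
  shows "lap (M.mult (arcs G - D)) (M.deg (arcs G - D) UNIV) x y = \<Delta> x y - (\<Sum>e\<in>D. inc e x * inc e y)"
proof -
  let ?A = "{e \<in> arcs G - D. x \<in> ends e}" and ?B = "{e \<in> D. x \<in> ends e}"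
  have "\<Delta> x y = (\<Sum>e\<in>{e \<in> arcs G. x \<in> ends e}. inc e x * inc e y)"
    by (rule lap_eq_sum) simp
  also have "{e \<in> arcs G. x \<in> ends e} = ?A \<union> ?B" using D by blast
  also have "(\<Sum>e\<in>?A \<union> ?B. inc e x * inc e y) = (\<Sum>e\<in>?A. inc e x * inc e y) + (\<Sum>e\<in>?B. inc e x * inc e y)"
  proof (rule sum.union_disjoint)
    show "finite ?A" by (rule finite_subset[OF _ M.finite_incident[of x]]) blast
    show "finite ?B" using D(2) by simp
  qed blast
  also have "(\<Sum>e\<in>?B. inc e x * inc e y) = (\<Sum>e\<in>D. inc e x * inc e y)"
    using D by (intro sum_edges_at) auto
  also have "(\<Sum>e\<in>?A. inc e x * inc e y) = lap (M.mult (arcs G - D)) (M.deg (arcs G - D) UNIV) x y"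
    by (rule lap_eq_sum[symmetric]) blast
  finally show ?thesis by simp
qed

lemma grad_eq_sum:
  assumes "finite V" "\<And>x. x \<notin> V \<Longrightarrow> h x = 0"
  shows "grad h e = (\<Sum>x\<in>V. inc e x * h x)"
proof -
  have "(\<Sum>x\<in>V. of_bool (z = x) * h x) = h z" for z
    using assms by (cases "z \<in> V") (auto simp: of_bool_def if_distrib[of "\<lambda>t. t * _"] cong: if_cong)
  then show ?thesis by (simp add: grad_def inc_def left_diff_distrib sum_subtractf)
qed

lemma lap_apply:
  assumes V: "finite V" and h: "\<And>x. x \<notin> V \<Longrightarrow> h x = 0"
    and T: "finite T" "{e \<in> arcs G. x \<in> ends e} \<subseteq> T" "T \<subseteq> arcs G"
  shows "(\<Sum>y\<in>V. \<Delta> x y * h y) = (\<Sum>e\<in>T. inc e x * grad h e)"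
proof -
  have "(\<Sum>y\<in>V. \<Delta> x y * h y) = (\<Sum>y\<in>V. \<Sum>e\<in>T. inc e x * inc e y * h y)"
  proof (rule sum.cong[OF refl])
    fix y
    have "\<Delta> x y = (\<Sum>e\<in>T. inc e x * inc e y)"
      using lap_eq_sum[OF order_refl, of x y] sum_edges_at[OF order_refl T] by simp
    then show "\<Delta> x y * h y = (\<Sum>e\<in>T. inc e x * inc e y * h y)" by (simp add: sum_distrib_right)
  qed
  also have "\<dots> = (\<Sum>e\<in>T. inc e x * (\<Sum>y\<in>V. inc e y * h y))"
    by (subst sum.swap) (simp add: sum_distrib_left mult.assoc)
  finally show ?thesis by (simp add: grad_eq_sum[OF V h])
qed

definition energy :: "'v set \<Rightarrow> ('v \<Rightarrow> real) \<Rightarrow> ('v \<Rightarrow> real) \<Rightarrow> real" where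
  "energy V h l = (\<Sum>e\<in>touching V. grad h e * grad l e)"

lemma energy_eq:
  assumes V: "finite V" and h: "\<And>x. x \<notin> V \<Longrightarrow> h x = 0" and l: "\<And>x. x \<notin> V \<Longrightarrow> l x = 0"
  shows "energy V h l = (\<Sum>x\<in>V. l x * (\<Sum>y\<in>V. \<Delta> x y * h y))"
proof -
  have "energy V h l = (\<Sum>e\<in>touching V. \<Sum>x\<in>V. l x * (inc e x * grad h e))"
    unfolding energy_def
  proof (rule sum.cong[OF refl])
    fix e
    have "grad h e * grad l e = grad h e * (\<Sum>x\<in>V. inc e x * l x)"
      by (simp add: grad_eq_sum[OF V l])
    also have "\<dots> = (\<Sum>x\<in>V. l x * (inc e x * grad h e))"
      by (simp add: sum_distrib_left algebra_simps)
    finally show "grad h e * grad l e = (\<Sum>x\<in>V. l x * (inc e x * grad h e))" .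
  qed
  also have "\<dots> = (\<Sum>x\<in>V. l x * (\<Sum>e\<in>touching V. inc e x * grad h e))"
    by (subst sum.swap) (simp add: sum_distrib_left)
  also have "\<dots> = (\<Sum>x\<in>V. l x * (\<Sum>y\<in>V. \<Delta> x y * h y))"
    using V h by (intro sum.cong refl arg_cong2[where f = "(*)"] lap_apply[symmetric] finite_touching)
      (auto simp: touching_eq)
  finally show ?thesis .
qed

section \<open>Potentials and the Green form\<close>

definition is_potential :: "'v set \<Rightarrow> ('v \<Rightarrow> real) \<Rightarrow> ('v \<Rightarrow> real) \<Rightarrow> bool" where
  "is_potential V s k \<longleftrightarrow> (\<forall>x. x \<notin> V \<longrightarrow> k x = 0) \<and> (\<forall>x\<in>V. (\<Sum>y\<in>V. \<Delta> x y * k y) = s x)"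

lemma det_nonzero:
  assumes "finite V" "V \<subseteq> verts G"
  shows "det_on V \<Delta> \<noteq> 0"
proof (cases "V = {}")
  case False
  then have "card (M.rec (arcs G) V) > 0"
    using rec_nonempty[of V] finite_rec[of "arcs G" V] assms by (simp add: card_gt_0_iff)
  then show ?thesis using card_rec_eq_det[of "arcs G" V] assms by simp
qed simp

lemma potential_exists:
  assumes "finite V" "V \<subseteq> verts G"
  shows "\<exists>k. is_potential V s k"
proof -
  obtain k where k: "\<And>x. x \<in> V \<Longrightarrow> (\<Sum>y\<in>V. \<Delta> x y * k y) = s x"
    using det_on_solvable[OF assms(1) det_nonzero[OF assms]] by metis
  then have "is_potential V s (\<lambda>x. if x \<in> V then k x else 0)" by (simp add: is_potential_def)
  then show ?thesis by blast
qed

lemma potential_unique: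
  assumes "finite V" "V \<subseteq> verts G" "is_potential V s k" "is_potential V s k'"
  shows "k = k'"
proof
  fix x
  have "(\<Sum>y\<in>V. \<Delta> z y * (k y - k' y)) = 0" if "z \<in> V" for z
    using assms(3,4) that by (simp add: is_potential_def right_diff_distrib sum_subtractf)
  then have "k x - k' x = 0" if "x \<in> V"
    using det_on_eq_0[OF assms(1) that, of "\<lambda>y. k y - k' y" \<Delta>] det_nonzero[OF assms(1,2)] by blast
  then show "k x = k' x" using assms(3,4) by (cases "x \<in> V") (auto simp: is_potential_def)
qed

definition potential :: "'v set \<Rightarrow> ('v \<Rightarrow> real) \<Rightarrow> 'v \<Rightarrow> real" where
  "potential V s = (SOME k. is_potential V s k)"

text \<open>The bilinear form of the inverse of \<open>\<Delta>\<close> restricted to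
  \<open>V\<close>, the sink being held at potential zero.\<close>

definition green :: "'v set \<Rightarrow> ('v \<Rightarrow> real) \<Rightarrow> ('v \<Rightarrow> real) \<Rightarrow> real" where
  "green V s t = (\<Sum>x\<in>V. t x * potential V s x)"

context
  fixes V :: "'v set"
  assumes finV: "finite V" and VG: "V \<subseteq> verts G"
begin

lemma is_potential_potential: "is_potential V s (potential V s)"
  unfolding potential_def using potential_exists[OF finV VG] by (rule someI_ex)

lemma potential_outside: "x \<notin> V \<Longrightarrow> potential V s x = 0"
  using is_potential_potential[of s] unfolding is_potential_def by simp

lemma lap_potential: "x \<in> V \<Longrightarrow> (\<Sum>y\<in>V. \<Delta> x y * potential V s y) = s x"
  using is_potential_potential[of s] unfolding is_potential_def by simp

lemma energy_potential:
  assumes "\<And>x. x \<notin> V \<Longrightarrow> l x = 0"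
  shows "energy V (potential V s) l = (\<Sum>x\<in>V. s x * l x)"
proof -
  have "energy V (potential V s) l = (\<Sum>x\<in>V. l x * (\<Sum>y\<in>V. \<Delta> x y * potential V s y))"
    using finV potential_outside assms by (rule energy_eq)
  also have "\<dots> = (\<Sum>x\<in>V. s x * l x)"
    by (intro sum.cong refl) (simp add: lap_potential)
  finally show ?thesis .
qed

lemma green_eq_energy: "green V s t = energy V (potential V t) (potential V s)"
  by (simp add: green_def energy_potential potential_outside)

lemma green_sym: "green V s t = green V t s"
  unfolding green_eq_energy energy_def by (simp add: mult.commute)

lemma green_inc: "green V s (inc e) = grad (potential V s) e"
  unfolding green_def by (rule grad_eq_sum[OF finV potential_outside, symmetric])

lemma green_add_right: "green V s (\<lambda>x. t x + c * u x) = green V s t + c * green V s u"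
  by (simp add: green_def distrib_right sum.distrib sum_distrib_left mult.assoc)

lemma green_quadratic:
  "green V (\<lambda>x. s x + c * t x) (\<lambda>x. s x + c * t x) = green V s s + 2 * c * green V s t + c\<^sup>2 * green V t t"
proof -
  have "green V (\<lambda>x. s x + c * t x) u = green V s u + c * green V t u" for u
  proof -
    have "green V (\<lambda>x. s x + c * t x) u = green V u (\<lambda>x. s x + c * t x)" by (rule green_sym)
    also have "\<dots> = green V u s + c * green V u t" by (rule green_add_right)
    also have "green V u s = green V s u" by (rule green_sym)
    also have "green V u t = green V t u" by (rule green_sym)
    finally show ?thesis .
  qed
  then show ?thesis
    using green_sym[of t s] by (simp add: green_add_right power2_eq_square algebra_simps)
qed

text \<open>Dirichlet's principle, which makes \<open>green V s s\<close> monotone in \<open>V\<close>.\<close>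
lemma green_ge:
  assumes l: "\<And>x. x \<notin> V \<Longrightarrow> l x = 0"
  shows "2 * (\<Sum>x\<in>V. s x * l x) - energy V l l \<le> green V s s"
proof -
  let ?k = "potential V s"
  have "0 \<le> (\<Sum>e\<in>touching V. (grad l e - grad ?k e)\<^sup>2)" by (intro sum_nonneg) simp
  also have "\<dots> = (\<Sum>e\<in>touching V. grad l e * grad l e + grad ?k e * grad ?k e - 2 * (grad ?k e * grad l e))"
    by (intro sum.cong refl) (simp add: power2_eq_square algebra_simps)
  also have "\<dots> = energy V l l + energy V ?k ?k - 2 * energy V ?k l"
    by (simp add: energy_def sum.distrib sum_subtractf sum_distrib_left)
  finally show ?thesis
    using energy_potential[of l s] l green_eq_energy[of s s] by simp
qed

end

lemma grad_outside:
  assumes "\<And>x. x \<notin> V \<Longrightarrow> h x = 0" "e \<in> arcs G" "e \<notin> touching V"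
  shows "grad h e = 0"
  using assms by (auto simp: grad_def touching_eq ends_def)

text \<open>The potential for \<open>V\<close> vanishes off \<open>V\<close>, so in
  \<open>V'\<close> it has the same energy and the same pairing with \<open>s\<close>, and it
  competes in Dirichlet's principle for \<open>V'\<close>.\<close>

lemma green_mono:
  assumes V: "finite V'" "V' \<subseteq> verts G" "V \<subseteq> V'"
  shows "green V s s \<le> green V' s s"
proof -
  have V0: "finite V" "V \<subseteq> verts G" using V finite_subset by auto
  let ?k = "potential V s"
  have out: "?k x = 0" if "x \<notin> V" for x using potential_outside[OF V0 that] .
  then have out': "?k x = 0" if "x \<notin> V'" for x using that V(3) by blast
  have "energy V' ?k ?k = energy V ?k ?k"
    unfolding energy_def
  proof (rule sum.mono_neutral_right)
    show "finite (touching V')" using V(1) by (rule finite_touching)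
    show "touching V \<subseteq> touching V'" using V(3) by (auto simp: touching_eq)
    show "\<forall>e\<in>touching V' - touching V. grad ?k e * grad ?k e = 0"
    proof
      fix e assume "e \<in> touching V' - touching V"
      then have "grad ?k e = 0" using out by (intro grad_outside[of V]) (auto simp: touching_eq)
      then show "grad ?k e * grad ?k e = 0" by simp
    qed
  qed
  moreover have "(\<Sum>x\<in>V'. s x * ?k x) = (\<Sum>x\<in>V. s x * ?k x)"
    using V out by (intro sum.mono_neutral_right) auto
  ultimately show ?thesis
    using green_ge[OF V(1,2), of ?k s] out' green_eq_energy[OF V0, of s s] by (simp add: green_def)
qed

text \<open>Origin of the \<open>4\<close>: \<open>?Q\<close> is the energy of its own potential and
  so bounds the square of the gradient along any edge. As \<open>?Q\<close> is also a sum or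
  difference of two such gradients, its square is at most twice the sum of their squares, that is at
  most \<open>4 * ?Q\<close>.\<close>

lemma green_bound:
  assumes V: "finite V" "V \<subseteq> verts G" and "e \<in> arcs G" "f \<in> arcs G" and c: "c\<^sup>2 = 1"
  shows "green V (\<lambda>x. inc e x + c * inc f x) (\<lambda>x. inc e x + c * inc f x) \<le> 4"
proof -
  let ?s = "\<lambda>x. inc e x + c * inc f x"
  let ?k = "potential V ?s"
  let ?Q = "green V ?s ?s"
  have Q: "?Q = grad ?k e + c * grad ?k f"
    using green_add_right[OF V, of ?s "inc e" c "inc f"] by (simp add: green_inc[OF V])
  have sq: "(grad ?k g)\<^sup>2 \<le> ?Q" if "g \<in> arcs G" for g
  proof (cases "g \<in> touching V")
    case True
    have "(grad ?k g)\<^sup>2 \<le> energy V ?k ?k"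
      unfolding energy_def power2_eq_square
      using finite_touching[OF V(1)] True by (intro member_le_sum) auto
    then show ?thesis using green_eq_energy[OF V, of ?s ?s] by simp
  next
    case False
    then have "grad ?k g = 0" using that potential_outside[OF V] by (intro grad_outside[of V])
    moreover have "0 \<le> ?Q" unfolding green_eq_energy[OF V] energy_def by (intro sum_nonneg) simp
    ultimately show ?thesis by simp
  qed
  have "?Q\<^sup>2 = (grad ?k e)\<^sup>2 + (grad ?k f)\<^sup>2 + 2 * (grad ?k e * (c * grad ?k f))"
    unfolding Q using c by (simp add: power2_sum power_mult_distrib)
  also have "2 * (grad ?k e * (c * grad ?k f)) \<le> (grad ?k e)\<^sup>2 + (grad ?k f)\<^sup>2"
    using sum_squares_bound[of "grad ?k e" "c * grad ?k f"] c by (simp add: power_mult_distrib mult.assoc)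
  finally have "?Q\<^sup>2 \<le> 4 * ?Q" using sq[OF assms(3)] sq[OF assms(4)] by simp
  then have "?Q * (?Q - 4) \<le> 0" by (simp add: power2_eq_square algebra_simps)
  then show ?thesis by (simp add: mult_le_0_iff) linarith
qed

section \<open>Transfer currents of wired graphs\<close>

abbreviation current :: "'v set \<Rightarrow> 'e \<Rightarrow> 'e \<Rightarrow> real" where
  "current V e f \<equiv> green V (inc e) (inc f)"

lemma arcs_wired [simp]: "arcs (wired G V) = touching V"
  by (simp add: wired_def)

lemma net_outflow_eq:
  assumes "finite (arcs H)"
  shows "net_outflow H h v
    = (\<Sum>f\<in>arcs H. (of_bool (tail H f = v) - of_bool (head H f = v)) * (h (tail H f) - h (head H f)))"
proof -
  have "(\<Sum>f\<in>arcs H. of_bool (P f) * (h (tail H f) - h (head H f)))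
      = (\<Sum>f\<in>{f \<in> arcs H. P f}. h (tail H f) - h (head H f))" for P
    using assms by (simp add: sum.inter_filter of_bool_def if_distrib[of "\<lambda>t. t * _"] cong: if_cong)
  then show ?thesis
    by (simp add: net_outflow_def out_arcs_def in_arcs_def left_diff_distrib sum_subtractf)
qed

context
  fixes V :: "'v set"
  assumes finV: "finite V" and VG: "V \<subseteq> verts G"
begin

text \<open>Unit current potentials are determined only up to a constant. Normalizing the value at
  the sink to zero gives functions on all vertices that vanish off \<open>V\<close>, as the
  Dirichlet problem requires.\<close>

definition grounded :: "('v option \<Rightarrow> real) \<Rightarrow> 'v \<Rightarrow> real" where
  "grounded h x = (if x \<in> V then h (Some x) - h None else 0)"

lemma grad_grounded:
  "h (tail (wired G V) e) - h (head (wired G V) e) = grad (grounded h) e"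
  by (auto simp: wired_def grad_def grounded_def)

lemma net_outflow_wired:
  assumes "x \<in> V"
  shows "net_outflow (wired G V) h (Some x) = (\<Sum>y\<in>V. \<Delta> x y * grounded h y)"
proof -
  have "net_outflow (wired G V) h (Some x) = (\<Sum>f\<in>touching V. inc f x * grad (grounded h) f)"
    unfolding net_outflow_eq[of "wired G V", unfolded arcs_wired, OF finite_touching[OF finV]] grad_grounded
    using assms by (intro sum.cong refl) (auto simp: wired_def inc_def)
  also have "\<dots> = (\<Sum>y\<in>V. \<Delta> x y * grounded h y)"
    using finV finite_touching[OF finV] assms
    by (intro lap_apply[symmetric]) (auto simp: grounded_def touching_eq)
  finally show ?thesis .
qed

lemma sum_net_outflow:
  "(\<Sum>v\<in>verts (wired G V). net_outflow (wired G V) h v) = 0"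
proof -
  let ?H = "wired G V"
  have fin: "finite (verts ?H)" using finV by (simp add: wired_def)
  have "(\<Sum>v\<in>verts ?H. net_outflow ?H h v)
      = (\<Sum>f\<in>touching V. (\<Sum>v\<in>verts ?H. of_bool (tail ?H f = v) - of_bool (head ?H f = v)) * (h (tail ?H f) - h (head ?H f)))"
    unfolding net_outflow_eq[of ?H, unfolded arcs_wired, OF finite_touching[OF finV]]
    by (subst sum.swap) (simp only: sum_distrib_right)
  also have "\<dots> = 0"
  proof (rule sum.neutral, rule ballI)
    fix f assume "f \<in> touching V"
    have "tail ?H f \<in> verts ?H" "head ?H f \<in> verts ?H" by (auto simp: wired_def)
    then have "(\<Sum>v\<in>verts ?H. of_bool (tail ?H f = v) - of_bool (head ?H f = v)) = (0 :: real)"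
      using fin by (simp add: sum_subtractf of_bool_def)
    then show "(\<Sum>v\<in>verts ?H. of_bool (tail ?H f = v) - of_bool (head ?H f = v)) * (h (tail ?H f) - h (head ?H f)) = 0"
      by simp
  qed
  finally show ?thesis .
qed

text \<open>Net outflows and source terms both add up to zero over all vertices, so the equation at
  the sink follows from the others, and only the Dirichlet problem on \<open>V\<close>
  remains.\<close>

lemma unit_current_potential_iff:
  "unit_current_potential (wired G V) e h \<longleftrightarrow> is_potential V (inc e) (grounded h)"
proof -
  let ?H = "wired G V"
  let ?r = "\<lambda>v. of_bool (v = tail ?H e) - of_bool (v = head ?H e) :: real"
  have Some_iff: "?r (Some x) = inc e x" if "x \<in> V" for x
    using that by (auto simp: wired_def inc_def)
  have verts: "verts ?H = insert None (Some ` V)" by (simp add: wired_def)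
  have fin: "finite (Some ` V)" using finV by simp
  have tail_head: "tail ?H e \<in> verts ?H" "head ?H e \<in> verts ?H" by (auto simp: wired_def)
  have "(\<Sum>v\<in>verts ?H. ?r v) = 0"
    using tail_head finV verts by (simp add: sum_subtractf of_bool_def)
  then have r_None: "?r None = - (\<Sum>x\<in>V. ?r (Some x))"
    using fin unfolding verts by (simp add: sum.reindex)
  have out_None: "net_outflow ?H h None = - (\<Sum>x\<in>V. net_outflow ?H h (Some x))"
    using sum_net_outflow[of h] fin unfolding verts by (simp add: sum.reindex)
  have "unit_current_potential ?H e h \<longleftrightarrow> (\<forall>x\<in>V. net_outflow ?H h (Some x) = ?r (Some x))"
  proof
    assume all: "\<forall>x\<in>V. net_outflow ?H h (Some x) = ?r (Some x)"
    then have "net_outflow ?H h None = ?r None"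
      unfolding out_None r_None by (intro arg_cong[where f = uminus] sum.cong refl) blast
    then show "unit_current_potential ?H e h"
      using all unfolding unit_current_potential_def verts by blast
  qed (auto simp: unit_current_potential_def verts)
  also have "\<dots> \<longleftrightarrow> (\<forall>x\<in>V. (\<Sum>y\<in>V. \<Delta> x y * grounded h y) = inc e x)"
    by (intro ball_cong refl) (simp only: net_outflow_wired Some_iff)
  also have "\<dots> \<longleftrightarrow> is_potential V (inc e) (grounded h)"
    by (simp add: is_potential_def grounded_def)
  finally show ?thesis .
qed

text \<open>An edge \<open>e\<close> with both ends outside \<open>V\<close> has both of them at the
  sink; its source then vanishes, in agreement with \<open>inc e\<close> on \<open>V\<close>. So the
  formula is valid from the start of an exhaustion.\<close>

lemma transfer_current_wired: "transfer_current (wired G V) e f = current V e f"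
  unfolding transfer_current_def
proof (rule the_equality)
  let ?k = "potential V (inc e)"
  let ?h = "case_option 0 ?k"
  have "grounded ?h = ?k"
    using potential_outside[OF finV VG] by (auto simp: grounded_def fun_eq_iff)
  moreover have "is_potential V (inc e) ?k" by (rule is_potential_potential[OF finV VG])
  ultimately show "\<exists>h. unit_current_potential (wired G V) e h \<and>
      current V e f = h (tail (wired G V) f) - h (head (wired G V) f)"
    unfolding unit_current_potential_iff grad_grounded green_inc[OF finV VG] by metis
next
  fix c assume "\<exists>h. unit_current_potential (wired G V) e h \<and> c = h (tail (wired G V) f) - h (head (wired G V) f)"
  then obtain h where "is_potential V (inc e) (grounded h)" and c: "c = grad (grounded h) f"
    unfolding unit_current_potential_iff grad_grounded by blast
  then have "grounded h = potential V (inc e)"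
    using is_potential_potential[OF finV VG] by (intro potential_unique[OF finV VG])
  then show "c = current V e f" using c green_inc[OF finV VG] by simp
qed

end

section \<open>Limits along exhaustions\<close>

lemma exhaustion_eventually:
  assumes "exhaustion G Vs" "finite A" "A \<subseteq> verts G"
  shows "\<forall>\<^sub>F n in sequentially. A \<subseteq> Vs n"
proof -
  have "\<forall>\<^sub>F n in sequentially. x \<in> Vs n" if "x \<in> A" for x
  proof -
    have "(\<Union>n. Vs n) = verts G" using assms(1) by (simp add: exhaustion_def)
    then have "x \<in> (\<Union>n. Vs n)" using assms(3) that by auto
    then obtain m where "x \<in> Vs m" by blast
    moreover have "incseq Vs" using assms(1) unfolding exhaustion_def by blast
    ultimately have "x \<in> Vs n" if "m \<le> n" for n
      using incseqD[of Vs, OF _ that] by blast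
    then show ?thesis unfolding eventually_sequentially by blast
  qed
  then have "\<forall>\<^sub>F n in sequentially. \<forall>x\<in>A. x \<in> Vs n"
    using assms(2) by (simp add: eventually_ball_finite)
  then show ?thesis unfolding subset_eq .
qed

lemma exhaustion_finite: "exhaustion G Vs \<Longrightarrow> finite (Vs n)" "exhaustion G Vs \<Longrightarrow> Vs n \<subseteq> verts G"
  unfolding exhaustion_def by blast+

text \<open>Taking the supremum over all finite vertex sets, not along one exhaustion, makes the
  limit the same for every exhaustion.\<close>

definition green_sup :: "('v \<Rightarrow> real) \<Rightarrow> real" where
  "green_sup s = (SUP V\<in>{V. finite V \<and> V \<subseteq> verts G}. green V s s)"

lemma green_tendsto:
  assumes ex: "exhaustion G Vs" and bound: "\<And>V. finite V \<Longrightarrow> V \<subseteq> verts G \<Longrightarrow> green V s s \<le> B"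
  shows "(\<lambda>n. green (Vs n) s s) \<longlonglongrightarrow> green_sup s"
proof -
  let ?I = "{V. finite V \<and> V \<subseteq> verts G}"
  have bdd: "bdd_above ((\<lambda>V. green V s s) ` ?I)" using bound by (intro bdd_aboveI2[of _ _ B]) auto
  show ?thesis
  proof (rule increasing_tendsto)
    show "\<forall>\<^sub>F n in sequentially. green (Vs n) s s \<le> green_sup s"
      unfolding green_sup_def using exhaustion_finite[OF ex]
      by (intro always_eventually allI cSUP_upper bdd) auto
    fix c assume "c < green_sup s"
    then obtain V where V: "finite V" "V \<subseteq> verts G" "c < green V s s"
      unfolding green_sup_def using less_cSUP_iff[OF _ bdd] by auto
    have "\<forall>\<^sub>F n in sequentially. V \<subseteq> Vs n" using ex V(1,2) by (rule exhaustion_eventually)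
    then show "\<forall>\<^sub>F n in sequentially. c < green (Vs n) s s"
    proof eventually_elim
      case (elim n)
      then have "green V s s \<le> green (Vs n) s s" by (intro green_mono exhaustion_finite[OF ex])
      then show ?case using V(3) by simp
    qed
  qed
qed

lemma current_converges:
  assumes "exhaustion G Us" "e \<in> arcs G" "f \<in> arcs G"
  shows "\<exists>y. \<forall>Vs. exhaustion G Vs \<longrightarrow> (\<lambda>n. current (Vs n) e f) \<longlonglongrightarrow> y"
proof (intro exI allI impI)
  fix Vs assume ex: "exhaustion G Vs"
  let ?s = "\<lambda>c x. inc e x + c * inc f x"
  have lim: "(\<lambda>n. green (Vs n) (?s c) (?s c)) \<longlonglongrightarrow> green_sup (?s c)" if "c\<^sup>2 = 1" for c
    using ex green_bound[OF _ _ assms(2,3) that] by (rule green_tendsto)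
  \<comment> \<open>Polarization: monotonicity is available only for the quadratic form, and the
    entry for \<open>e\<close> and \<open>f\<close> is recovered from its values at the sum and the
    difference of the incidence vectors.\<close>
  have "(\<lambda>n. (green (Vs n) (?s 1) (?s 1) - green (Vs n) (?s (-1)) (?s (-1))) / 4)
      \<longlonglongrightarrow> (green_sup (?s 1) - green_sup (?s (-1))) / 4"
    by (intro tendsto_intros lim) simp_all
  moreover have "(green (Vs n) (?s 1) (?s 1) - green (Vs n) (?s (-1)) (?s (-1))) / 4 = current (Vs n) e f" for n
    unfolding green_quadratic[OF exhaustion_finite[OF ex]] by simp
  ultimately show "(\<lambda>n. current (Vs n) e f) \<longlonglongrightarrow> (green_sup (?s 1) - green_sup (?s (-1))) / 4"
    by simp
qed

lemma transfer_current_inf_tendsto: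
  assumes "exhaustion G Vs" "e \<in> arcs G" "f \<in> arcs G"
  shows "(\<lambda>n. current (Vs n) e f) \<longlonglongrightarrow> transfer_current_inf G e f"
proof -
  let ?P = "\<lambda>y. \<forall>Vs. exhaustion G Vs \<longrightarrow> (\<lambda>n. transfer_current (wired G (Vs n)) e f) \<longlonglongrightarrow> y"
  have eq: "transfer_current (wired G (Us n)) e f = current (Us n) e f" if "exhaustion G Us" for Us n
    using exhaustion_finite[OF that] by (rule transfer_current_wired)
  obtain y where y: "\<And>Vs. exhaustion G Vs \<Longrightarrow> (\<lambda>n. current (Vs n) e f) \<longlonglongrightarrow> y"
    using current_converges[OF assms] by blast
  then have "?P y" using eq by simp
  moreover have "z = y" if "?P z" for z
    using that assms(1) y[OF assms(1)] eq[OF assms(1)] LIMSEQ_unique by fastforce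
  ultimately have "transfer_current_inf G e f = y"
    unfolding transfer_current_inf_def by (rule the_equality)
  then show ?thesis using y[OF assms(1)] by simp
qed

lemma prob_eq_det:
  assumes V: "finite V" "V \<noteq> {}" "V \<subseteq> verts G" and D: "D \<subseteq> arcs G" "finite D"
    and card: "card (M.rec (arcs G - D) V) = card (M.rec_on (arcs G) V W \<xi>)"
  shows "measure_pmf.prob (sandpile_measure (wired G V)) {\<eta>. \<forall>w\<in>W. \<eta> w = \<xi> w}
    = det_on D (\<lambda>e f. of_bool (e = f) - current V e f)"
proof -
  have "measure_pmf.prob (sandpile_measure (wired G V)) {\<eta>. \<forall>w\<in>W. \<eta> w = \<xi> w}
      = card (M.rec (arcs G) V \<inter> {\<eta>. \<forall>w\<in>W. \<eta> w = \<xi> w}) / card (M.rec (arcs G) V)"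
    unfolding sandpile_measure_wired[OF V]
    using rec_nonempty[OF V] finite_rec[OF order_refl V(1)] by (rule measure_pmf_of_set)
  also have "M.rec (arcs G) V \<inter> {\<eta>. \<forall>w\<in>W. \<eta> w = \<xi> w} = M.rec_on (arcs G) V W \<xi>"
    unfolding M.rec_on_def by blast
  also have "real (card (M.rec_on (arcs G) V W \<xi>)) = det_on V (\<lambda>x y. \<Delta> x y - (\<Sum>e\<in>D. inc e x * inc e y))"
  proof -
    have "arcs G - D \<subseteq> arcs G" by blast
    then have "real (card (M.rec (arcs G - D) V))
        = det_on V (lap (M.mult (arcs G - D)) (M.deg (arcs G - D) UNIV))"
      using V(1) by (rule card_rec_eq_det)
    also have "\<dots> = det_on V (\<lambda>x y. \<Delta> x y - (\<Sum>e\<in>D. inc e x * inc e y))"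
      by (rule det_on_cong) (rule lap_delete[OF D])
    finally show ?thesis using card by simp
  qed
  also have "\<dots> = det_on V \<Delta> * det_on D (\<lambda>e f. of_bool (e = f) - (\<Sum>x\<in>V. inc e x * potential V (inc f) x))"
    using V(1) D(2) by (rule det_on_sub_gram) (rule lap_potential[OF V(1,3)])
  also have "(\<lambda>e f. of_bool (e = f) - (\<Sum>x\<in>V. inc e x * potential V (inc f) x))
      = (\<lambda>e f. of_bool (e = f) - current V e f)"
  proof (intro ext arg_cong[where f = "(-) _"])
    fix e f
    have "(\<Sum>x\<in>V. inc e x * potential V (inc f) x) = green V (inc f) (inc e)" by (simp only: green_def)
    \<comment> \<open>\<open>det_on_sub_gram\<close> produces the transposed entries; reciprocity of
      the network, the symmetry of \<open>green\<close>, turns them into the currents.\<close>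
    also have "\<dots> = current V e f" by (rule green_sym[OF V(1,3)])
    finally show "(\<Sum>x\<in>V. inc e x * potential V (inc f) x) = current V e f" .
  qed
  also have "real (card (M.rec (arcs G) V)) = det_on V \<Delta>"
    using V(1) by (intro card_rec_eq_det) auto
  finally show ?thesis using det_nonzero[OF V(1,3)] by simp
qed

end

theorem theorem2:
  fixes G :: "('v, 'e) pre_digraph"
    and Vs :: "nat \<Rightarrow> 'v set"
    and W :: "'v set"
    and \<xi> :: "'v \<Rightarrow> nat"
  assumes "loopfree_digraph G"
    and "locally_finite G"
    and "Digraph_Component.connected G"
    and "infinite (verts G)"
    and "exhaustion G Vs"
    and "finite W" and "W \<subseteq> verts G"
    and "minimal_config G W \<xi> \<or> gen_minimal_config G W \<xi>"
  shows "\<exists>\<E> \<subseteq> edges_touching G W.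
    (\<lambda>n. measure_pmf.prob (sandpile_measure (wired G (Vs n))) {\<eta>. \<forall>w \<in> W. \<eta> w = \<xi> w})
      \<longlonglongrightarrow> det_on \<E> (kernel_K G)"
proof -
  interpret infinite_graph G using assms(1-4) by (rule infinite_graph.intro)
  note ex = \<open>exhaustion G Vs\<close> and core = gen_minimal_core[OF assms(8)]
  let ?Q = "W \<union> fin_part W"
  obtain D where D: "D \<subseteq> edges_touching G W"
    and card: "\<And>V. finite V \<Longrightarrow> ?Q \<subseteq> V \<Longrightarrow> card (M.rec (arcs G - D) V) = card (M.rec_on (arcs G) V W \<xi>)"
    using deleted_edges[OF assms(8)] by blast
  have D_arcs: "D \<subseteq> arcs G" using D by (auto simp: touching_eq)
  have D_finite: "finite D" using D finite_touching[OF \<open>finite W\<close>] by (rule finite_subset)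
  have "(\<lambda>n. det_on D (\<lambda>e f. of_bool (e = f) - current (Vs n) e f)) \<longlonglongrightarrow> det_on D (kernel_K G)"
    unfolding det_on_def kernel_K_def
  proof (intro tendsto_intros transfer_current_inf_tendsto[OF ex])
    fix p e assume "p \<in> {p. p permutes D}" "e \<in> D"
    then show "e \<in> arcs G" "p e \<in> arcs G" using D_arcs permutes_in_image[of p D e] by auto
  qed
  \<comment> \<open>Once the core lies in \<open>Vs n\<close>, the determinant formula is exact for
    that \<open>n\<close>; only the entries of the matrix still have to converge.\<close>
  moreover have "\<forall>\<^sub>F n in sequentially. ?Q \<subseteq> Vs n" using ex core(2,3) by (rule exhaustion_eventually)
  then have "\<forall>\<^sub>F n in sequentially. det_on D (\<lambda>e f. of_bool (e = f) - current (Vs n) e f)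
      = measure_pmf.prob (sandpile_measure (wired G (Vs n))) {\<eta>. \<forall>w\<in>W. \<eta> w = \<xi> w}"
  proof eventually_elim
    case (elim n)
    have fin: "finite (Vs n)" and sub: "Vs n \<subseteq> verts G" using exhaustion_finite[OF ex] by auto
    moreover have "Vs n \<noteq> {}" using elim core(1) by blast
    ultimately show ?case using D_arcs D_finite card[OF fin elim] by (intro prob_eq_det[symmetric])
  qed
  ultimately have "(\<lambda>n. measure_pmf.prob (sandpile_measure (wired G (Vs n))) {\<eta>. \<forall>w \<in> W. \<eta> w = \<xi> w})
      \<longlonglongrightarrow> det_on D (kernel_K G)"
    by (rule Lim_transform_eventually)
  then show ?thesis using D by blast
qed

end
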